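(* There is an equivalence of categories $\mathbb{E}:\mathrm{HC}_0(\mathfrak{g},K)\to\mathrm{Rep}(\mathfrak{B})$, given on the level of objects by assigning to $M$ the representation of the two-cyclic quiver $$V_-=M_{-1},\quad V_+=M_{+1},\quad A=X|_{M_{-1}}:V_-\to V_+,\quad B=Y|_{M_{+1}}:V_+\to V_-.$$
   Context: $G=\mathrm{SL}_2(\mathbb{R})$, $K=\mathrm{SO}_2(\mathbb{R})$, $\mathfrak{g}=\mathrm{Lie}(G)\otimes_{\mathbb R}\mathbb{C}$ with basis $H=\begin{pmatrix}0&-i\\i&0\end{pmatrix}$, $X=\frac12\begin{pmatrix}1&i\\i&-1\end{pmatrix}$, $Y=\frac12\begin{pmatrix}1&-i\\-i&-1\end{pmatrix}$, so $[H,X]=2X$, $[H,Y]=-2Y$, $[X,Y]=H$. Casimir element: $C=H^2-2H+4XY\in U(\mathfrak{g})$. A $(\mathfrak{g},K)$-module is a complex vector space $M$ with a $\mathfrak{g}$-action and a locally smooth $K$-action such that $\mathrm{Ad}_k(Z)v=k(Z(k^{-1}v))$ for $k\in K$, $Z\in\mathfrak{g}$, $v\in M$, and such that the differential of the $K$-action is the restriction of the $\mathfrak{g}$-action to the complexified Lie algebra of $K$. Put $M_n=\{v\in M:Hv=nv\}$. $M$ is a Harish-Chandra module if it is finitely generated over $U(\mathfrak{g})$ and $M=\bigoplus_{n\in\mathbb{Z}}M_n$ with all $M_n$ finite dimensional. $\mathrm{HC}_0(\mathfrak{g},K)$ is the full subcategory of the category of Harish-Chandra modules consisting of those $M$ with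 $M=\bigoplus_{n\ \mathrm{odd}}M_n$ for which there is an integer $m>0$ with $(C+1)^mM=0$. Let $\mathfrak{D}=\mathbb{C}[[t]]$, $\mathfrak{m}=(t)$, $\mathfrak{B}=\begin{pmatrix}\mathfrak{D}&\mathfrak{m}\\\mathfrak{D}&\mathfrak{D}\end{pmatrix}\subset\mathrm{Mat}_{2\times2}(\mathfrak{D})$, and let $\mathrm{Rep}(\mathfrak{B})$ be the category of finite dimensional left $\mathfrak{B}$-modules. It is identified with the category of finite dimensional nilpotent representations $(V_-,V_+,A:V_-\to V_+,B:V_+\to V_-)$ of the two-cyclic quiver with vertices $-,+$ and arrows $a:-\to+$, $b:+\to-$, via $a\mapsto E_{21}$, $b\mapsto tE_{12}$ (first position corresponding to $-$, second to $+$); nilpotent means that $AB$ and $BA$ are nilpotent. *)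

theory Defs
  imports
    "HOL-Analysis.Analysis"
    "HOL-Computational_Algebra.Formal_Power_Series"
    "Jordan_Normal_Form.Missing_VectorSpace"
begin

section \<open>Categories and equivalences\<close>

text \<open>
  In a hom-set category, \<open>Cmp C A B D g f\<close> is the composite of \<open>f : A \<rightarrow> B\<close> and \<open>g : B \<rightarrow> D\<close>.
  The objects are passed along because the morphisms below are extensional functions, whose
  composite has to be restricted to the carrier of the source.
\<close>

record ('o, 'm) cat =
  Ob :: "'o set"
  Hom :: "'o \<Rightarrow> 'o \<Rightarrow> 'm set"
  Idt :: "'o \<Rightarrow> 'm"
  Cmp :: "'o \<Rightarrow> 'o \<Rightarrow> 'o \<Rightarrow> 'm \<Rightarrow> 'm \<Rightarrow> 'm"

locale category =
  fixes C :: "('o, 'm) cat"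
  assumes Idt_in_Hom: "A \<in> Ob C \<Longrightarrow> Idt C A \<in> Hom C A A"
    and Cmp_in_Hom:
      "\<lbrakk>A \<in> Ob C; B \<in> Ob C; D \<in> Ob C; f \<in> Hom C A B; g \<in> Hom C B D\<rbrakk>
        \<Longrightarrow> Cmp C A B D g f \<in> Hom C A D"
    and Cmp_Idt_right: "\<lbrakk>A \<in> Ob C; B \<in> Ob C; f \<in> Hom C A B\<rbrakk> \<Longrightarrow> Cmp C A A B f (Idt C A) = f"
    and Cmp_Idt_left: "\<lbrakk>A \<in> Ob C; B \<in> Ob C; f \<in> Hom C A B\<rbrakk> \<Longrightarrow> Cmp C A B B (Idt C B) f = f"
    and Cmp_assoc:
      "\<lbrakk>A \<in> Ob C; B \<in> Ob C; D \<in> Ob C; E \<in> Ob C;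
        f \<in> Hom C A B; g \<in> Hom C B D; h \<in> Hom C D E\<rbrakk>
        \<Longrightarrow> Cmp C A D E h (Cmp C A B D g f) = Cmp C A B E (Cmp C B D E h g) f"

locale cat_functor = source: category C + target: category D
  for C :: "('o, 'm) cat" and D :: "('p, 'n) cat" +
  fixes Fo :: "'o \<Rightarrow> 'p" and Fm :: "'o \<Rightarrow> 'o \<Rightarrow> 'm \<Rightarrow> 'n"
  assumes Fo_in_Ob: "A \<in> Ob C \<Longrightarrow> Fo A \<in> Ob D"
    and Fm_in_Hom:
      "\<lbrakk>A \<in> Ob C; B \<in> Ob C; f \<in> Hom C A B\<rbrakk> \<Longrightarrow> Fm A B f \<in> Hom D (Fo A) (Fo B)"
    and Fm_Idt: "A \<in> Ob C \<Longrightarrow> Fm A A (Idt C A) = Idt D (Fo A)"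
    and Fm_Cmp:
      "\<lbrakk>A \<in> Ob C; B \<in> Ob C; B' \<in> Ob C; f \<in> Hom C A B; g \<in> Hom C B B'\<rbrakk>
        \<Longrightarrow> Fm A B' (Cmp C A B B' g f) = Cmp D (Fo A) (Fo B) (Fo B') (Fm B B' g) (Fm A B f)"

definition cat_iso :: "('o, 'm) cat \<Rightarrow> 'o \<Rightarrow> 'o \<Rightarrow> 'm \<Rightarrow> bool" where
  "cat_iso C A B f \<longleftrightarrow>
     f \<in> Hom C A B \<and> (\<exists>g \<in> Hom C B A. Cmp C A B A g f = Idt C A \<and> Cmp C B A B f g = Idt C B)"

definition naturally_isomorphic ::
  "('o, 'm) cat \<Rightarrow> ('p, 'n) cat \<Rightarrow> ('o \<Rightarrow> 'p) \<Rightarrow> ('o \<Rightarrow> 'o \<Rightarrow> 'm \<Rightarrow> 'n)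
    \<Rightarrow> ('o \<Rightarrow> 'p) \<Rightarrow> ('o \<Rightarrow> 'o \<Rightarrow> 'm \<Rightarrow> 'n) \<Rightarrow> bool" where
  "naturally_isomorphic C D Fo Fm Go Gm \<longleftrightarrow>
     (\<exists>\<eta>. (\<forall>A \<in> Ob C. cat_iso D (Fo A) (Go A) (\<eta> A)) \<and>
          (\<forall>A \<in> Ob C. \<forall>B \<in> Ob C. \<forall>f \<in> Hom C A B.
             Cmp D (Fo A) (Go A) (Go B) (Gm A B f) (\<eta> A) =
             Cmp D (Fo A) (Fo B) (Go B) (\<eta> B) (Fm A B f)))"

definition equivalence_of_categories ::
  "('o, 'm) cat \<Rightarrow> ('p, 'n) cat \<Rightarrow> ('o \<Rightarrow> 'p) \<Rightarrow> ('o \<Rightarrow> 'o \<Rightarrow> 'm \<Rightarrow> 'n) \<Rightarrow> bool" where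
  "equivalence_of_categories C D Fo Fm \<longleftrightarrow>
     cat_functor C D Fo Fm \<and>
     (\<exists>Go Gm. cat_functor D C Go Gm \<and>
        naturally_isomorphic C C (\<lambda>A. A) (\<lambda>A B f. f)
          (\<lambda>A. Go (Fo A)) (\<lambda>A B f. Gm (Fo A) (Fo B) (Fm A B f)) \<and>
        naturally_isomorphic D D (\<lambda>A. Fo (Go A)) (\<lambda>A B f. Fm (Go A) (Go B) (Gm A B f))
          (\<lambda>A. A) (\<lambda>A B f. f))"

section \<open>Linear algebra\<close>

definition complex_field :: "complex ring" where
  "complex_field = \<lparr>carrier = UNIV, mult = (*), one = 1, zero = 0, add = (+)\<rparr>"

lemma field_complex_field: "field complex_field"
proof -
  have "cring complex_field"
    by (intro cringI abelian_groupI comm_monoidI)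
      (auto simp: complex_field_def algebra_simps intro: exI[of _ "- x" for x])
  then show ?thesis
  proof (rule cring.cring_fieldI2)
    fix a assume "a \<in> carrier complex_field" "a \<noteq> \<zero>\<^bsub>complex_field\<^esub>"
    then show "\<exists>b\<in>carrier complex_field. a \<otimes>\<^bsub>complex_field\<^esub> b = \<one>\<^bsub>complex_field\<^esub>"
      by (intro bexI[of _ "inverse a"]) (auto simp: complex_field_def)
  qed (simp add: complex_field_def)
qed

abbreviation complex_vectorspace :: "(complex, 'u, 'x) module_scheme \<Rightarrow> bool" where
  "complex_vectorspace V \<equiv> vectorspace complex_field V"

abbreviation complex_subspace :: "'u set \<Rightarrow> (complex, 'u, 'x) module_scheme \<Rightarrow> bool" where
  "complex_subspace W V \<equiv> subspace complex_field W V"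

abbreviation finite_dimensional :: "(complex, 'u, 'x) module_scheme \<Rightarrow> bool" where
  "finite_dimensional V \<equiv> vectorspace.fin_dim complex_field V"

definition dual_space :: "(complex, 'u, 'x) module_scheme \<Rightarrow> ('u \<Rightarrow> complex) set" where
  "dual_space V = {\<phi>.
     (\<forall>x \<in> carrier V. \<forall>y \<in> carrier V. \<phi> (x \<oplus>\<^bsub>V\<^esub> y) = \<phi> x + \<phi> y) \<and>
     (\<forall>c. \<forall>x \<in> carrier V. \<phi> (c \<odot>\<^bsub>V\<^esub> x) = c * \<phi> x)}"

text \<open>\<open>V\<close> is the internal direct sum of the subspaces \<open>W n\<close>, \<open>n \<in> I\<close>.\<close>

definition internal_direct_sum ::
  "(complex, 'u, 'x) module_scheme \<Rightarrow> 'i set \<Rightarrow> ('i \<Rightarrow> 'u set) \<Rightarrow> bool" where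
  "internal_direct_sum V I W \<longleftrightarrow>
     (\<forall>n \<in> I. complex_subspace (W n) V) \<and>
     (\<forall>v \<in> carrier V. \<exists>!x. (\<forall>n \<in> I. x n \<in> W n) \<and> (\<forall>n. n \<notin> I \<longrightarrow> x n = \<zero>\<^bsub>V\<^esub>) \<and>
        finite {n. x n \<noteq> \<zero>\<^bsub>V\<^esub>} \<and> v = finsum V x {n. x n \<noteq> \<zero>\<^bsub>V\<^esub>})"

definition smooth_curve :: "(real \<Rightarrow> complex) \<Rightarrow> bool" where
  "smooth_curve f \<longleftrightarrow>
     (\<exists>D. D 0 = f \<and> (\<forall>n t. (D n has_vector_derivative D (Suc n) t) (at t)))"

section \<open>Harish-Chandra modules for \<open>SL\<^sub>2(\<real>)\<close>\<close>

text \<open>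
  The Lie algebra of \<open>SL\<^sub>2(\<real>)\<close>, tensored with the complex numbers, is realised as the trace zero
  complex matrices. The scalar multiple of a matrix \<open>Z\<close> by \<open>c\<close> is written \<open>mat c ** Z\<close>.
\<close>

definition sl2 :: "(complex^2^2) set" where
  "sl2 = {Z. trace Z = 0}"

definition H_mat :: "complex^2^2" where
  "H_mat = vector [vector [0, - \<i>], vector [\<i>, 0]]"

definition X_mat :: "complex^2^2" where
  "X_mat = mat (1/2) ** vector [vector [1, \<i>], vector [\<i>, -1]]"

definition Y_mat :: "complex^2^2" where
  "Y_mat = mat (1/2) ** vector [vector [1, - \<i>], vector [- \<i>, -1]]"

definition SO2 :: "(real^2^2) set" where
  "SO2 = {k. orthogonal_matrix k \<and> det k = 1}"

definition Ad :: "real^2^2 \<Rightarrow> complex^2^2 \<Rightarrow> complex^2^2" where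
  "Ad k Z = map_matrix of_real k ** Z ** map_matrix of_real (matrix_inv k)"

text \<open>
  \<open>rot \<theta> = exp (\<theta> J)\<close>, where \<open>J = \<i> H\<close> is the real matrix with rows \<open>(0, 1)\<close> and \<open>(-1, 0)\<close>, which
  spans the Lie algebra of \<open>SO\<^sub>2(\<real>)\<close>. The map \<open>rot\<close> is the universal covering of \<open>SO\<^sub>2(\<real>)\<close>, so a
  function on \<open>SO\<^sub>2(\<real>)\<close> is smooth iff its composite with \<open>rot\<close> is smooth on the real line.
\<close>

definition rot :: "real \<Rightarrow> real^2^2" where
  "rot \<theta> = vector [vector [cos \<theta>, sin \<theta>], vector [- sin \<theta>, cos \<theta>]]"

record 'u gk_module = "(complex, 'u) module" +
  gact :: "complex^2^2 \<Rightarrow> 'u \<Rightarrow> 'u"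
  kact :: "real^2^2 \<Rightarrow> 'u \<Rightarrow> 'u"

text \<open>
  Local smoothness of the \<open>K\<close>-action: every vector lies in a finite dimensional \<open>K\<close>-stable
  subspace \<open>W\<close> (\<open>locally_finite\<close>) on which \<open>K\<close> acts smoothly (\<open>smooth\<close>; smoothness of a map into a
  finite dimensional space is tested on linear functionals, and functionals on \<open>W\<close> extend to \<open>M\<close>).
  In the same way \<open>differential\<close> says that the derivative at \<open>\<theta> = 0\<close> of \<open>\<theta> \<mapsto> rot \<theta> v\<close> is
  \<open>(\<i> H) v\<close>; by linearity this determines the action of the complexified Lie algebra of \<open>K\<close>.
\<close>

locale gk_mod =
  fixes M :: "'u gk_module" (structure)
  assumes vs: "complex_vectorspace M"
    and gact_linear: "Z \<in> sl2 \<Longrightarrow> gact M Z \<in> module_hom complex_field M M"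
    and gact_add:
      "\<lbrakk>Z \<in> sl2; Z' \<in> sl2; v \<in> carrier M\<rbrakk> \<Longrightarrow> gact M (Z + Z') v = gact M Z v \<oplus> gact M Z' v"
    and gact_scale:
      "\<lbrakk>Z \<in> sl2; v \<in> carrier M\<rbrakk> \<Longrightarrow> gact M (mat c ** Z) v = c \<odot> gact M Z v"
    and gact_bracket:
      "\<lbrakk>Z \<in> sl2; Z' \<in> sl2; v \<in> carrier M\<rbrakk> \<Longrightarrow>
        gact M (Z ** Z' - Z' ** Z) v = gact M Z (gact M Z' v) \<ominus> gact M Z' (gact M Z v)"
    and kact_linear: "k \<in> SO2 \<Longrightarrow> kact M k \<in> module_hom complex_field M M"
    and kact_one: "v \<in> carrier M \<Longrightarrow> kact M (mat 1) v = v"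
    and kact_mult:
      "\<lbrakk>k \<in> SO2; l \<in> SO2; v \<in> carrier M\<rbrakk> \<Longrightarrow> kact M (k ** l) v = kact M k (kact M l v)"
    and locally_finite:
      "v \<in> carrier M \<Longrightarrow>
        \<exists>W. complex_subspace W M \<and> finite_dimensional (M\<lparr>carrier := W\<rparr>) \<and> v \<in> W \<and>
            (\<forall>k \<in> SO2. \<forall>w \<in> W. kact M k w \<in> W)"
    and smooth:
      "\<lbrakk>v \<in> carrier M; \<phi> \<in> dual_space M\<rbrakk> \<Longrightarrow> smooth_curve (\<lambda>\<theta>. \<phi> (kact M (rot \<theta>) v))"
    and Ad_compat:
      "\<lbrakk>k \<in> SO2; Z \<in> sl2; v \<in> carrier M\<rbrakk> \<Longrightarrow>
        gact M (Ad k Z) v = kact M k (gact M Z (kact M (matrix_inv k) v))"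
    and differential:
      "\<lbrakk>v \<in> carrier M; \<phi> \<in> dual_space M\<rbrakk> \<Longrightarrow>
        ((\<lambda>\<theta>. \<phi> (kact M (rot \<theta>) v)) has_vector_derivative \<phi> (gact M (mat \<i> ** H_mat) v)) (at 0)"

definition weight_space :: "'u gk_module \<Rightarrow> int \<Rightarrow> 'u set" where
  "weight_space M n = {v \<in> carrier M. gact M H_mat v = of_int n \<odot>\<^bsub>M\<^esub> v}"

text \<open>
  The \<open>U(\<gg>)\<close>-submodule generated by \<open>S\<close>: the linear span of all \<open>Z\<^sub>1 \<cdots> Z\<^sub>r s\<close> with \<open>Z\<^sub>i \<in> \<gg>\<close>
  and \<open>s \<in> S\<close>, since \<open>U(\<gg>)\<close> is spanned by the products \<open>Z\<^sub>1 \<cdots> Z\<^sub>r\<close>.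
\<close>

definition U_span :: "'u gk_module \<Rightarrow> 'u set \<Rightarrow> 'u set" where
  "U_span M S =
     module.span complex_field M
       {foldr (gact M) Zs s | Zs s. set Zs \<subseteq> sl2 \<and> s \<in> S}"

definition harish_chandra :: "'u gk_module \<Rightarrow> bool" where
  "harish_chandra M \<longleftrightarrow>
     gk_mod M \<and>
     (\<exists>S. finite S \<and> S \<subseteq> carrier M \<and> U_span M S = carrier M) \<and>
     internal_direct_sum M UNIV (weight_space M) \<and>
     (\<forall>n. finite_dimensional (M\<lparr>carrier := weight_space M n\<rparr>))"

text \<open>The action of \<open>C = H\<^sup>2 - 2H + 4XY\<close>.\<close>

definition casimir :: "'u gk_module \<Rightarrow> 'u \<Rightarrow> 'u" where
  "casimir M v =
     gact M H_mat (gact M H_mat v) \<ominus>\<^bsub>M\<^esub> 2 \<odot>\<^bsub>M\<^esub> gact M H_mat v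
       \<oplus>\<^bsub>M\<^esub> 4 \<odot>\<^bsub>M\<^esub> gact M X_mat (gact M Y_mat v)"

definition gk_hom :: "'u gk_module \<Rightarrow> 'u gk_module \<Rightarrow> ('u \<Rightarrow> 'u) set" where
  "gk_hom M N = {f \<in> extensional (carrier M) \<inter> module_hom complex_field M N.
     (\<forall>Z \<in> sl2. \<forall>v \<in> carrier M. f (gact M Z v) = gact N Z (f v)) \<and>
     (\<forall>k \<in> SO2. \<forall>v \<in> carrier M. f (kact M k v) = kact N k (f v))}"

text \<open>
  The objects of the categories below are the modules whose carrier is a subset of the type \<open>'u\<close>,
  which plays the role of the universe. All modules considered here have at most the cardinality
  of the continuum, so every one of them occurs up to isomorphism as soon as the complex numbers
  can be injected into \<open>'u\<close>.
\<close>

definition HC :: "('u gk_module, 'u \<Rightarrow> 'u) cat" where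
  "HC = \<lparr>Ob = {M. harish_chandra M}, Hom = gk_hom,
         Idt = (\<lambda>M. restrict (\<lambda>v. v) (carrier M)),
         Cmp = (\<lambda>L M N g f. compose (carrier L) g f)\<rparr>"

definition HC0 :: "('u gk_module, 'u \<Rightarrow> 'u) cat" where
  "HC0 = HC\<lparr>Ob := {M \<in> Ob HC.
     internal_direct_sum M {n. odd n} (weight_space M) \<and>
     (\<exists>m>0. \<forall>v \<in> carrier M. ((\<lambda>w. casimir M w \<oplus>\<^bsub>M\<^esub> w) ^^ m) v = \<zero>\<^bsub>M\<^esub>)}\<rparr>"

section \<open>Finite dimensional left modules over \<open>\<BB>\<close>\<close>

text \<open>The locale \<^locale>\<open>module\<close> of the library only covers commutative base rings.\<close>

locale left_module = R: ring R + M: abelian_group M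
  for R :: "('r, 'x) ring_scheme" (structure) and M :: "('r, 'u) module" (structure) +
  assumes smult_closed: "\<lbrakk>a \<in> carrier R; x \<in> carrier M\<rbrakk> \<Longrightarrow> a \<odot>\<^bsub>M\<^esub> x \<in> carrier M"
    and smult_l_distr:
      "\<lbrakk>a \<in> carrier R; b \<in> carrier R; x \<in> carrier M\<rbrakk> \<Longrightarrow>
        (a \<oplus>\<^bsub>R\<^esub> b) \<odot>\<^bsub>M\<^esub> x = a \<odot>\<^bsub>M\<^esub> x \<oplus>\<^bsub>M\<^esub> b \<odot>\<^bsub>M\<^esub> x"
    and smult_r_distr:
      "\<lbrakk>a \<in> carrier R; x \<in> carrier M; y \<in> carrier M\<rbrakk> \<Longrightarrow>
        a \<odot>\<^bsub>M\<^esub> (x \<oplus>\<^bsub>M\<^esub> y) = a \<odot>\<^bsub>M\<^esub> x \<oplus>\<^bsub>M\<^esub> a \<odot>\<^bsub>M\<^esub> y"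
    and smult_assoc:
      "\<lbrakk>a \<in> carrier R; b \<in> carrier R; x \<in> carrier M\<rbrakk> \<Longrightarrow>
        (a \<otimes>\<^bsub>R\<^esub> b) \<odot>\<^bsub>M\<^esub> x = a \<odot>\<^bsub>M\<^esub> (b \<odot>\<^bsub>M\<^esub> x)"
    and smult_one: "x \<in> carrier M \<Longrightarrow> \<one>\<^bsub>R\<^esub> \<odot>\<^bsub>M\<^esub> x = x"

type_synonym B_elem = "complex fps^2^2"

text \<open>The upper right entry lies in the maximal ideal \<open>(t)\<close>, where \<open>t\<close> is \<^const>\<open>fps_X\<close>.\<close>

definition B_ring :: "B_elem ring" where
  "B_ring = \<lparr>carrier = {P. fps_X dvd P $ 1 $ 2}, mult = (**), one = mat 1, zero = 0, add = (+)\<rparr>"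

lemma ring_B_ring: "ring B_ring"
proof (rule ringI)
  show "abelian_group B_ring"
  proof (rule abelian_groupI)
    fix x assume "x \<in> carrier B_ring"
    then show "\<exists>y\<in>carrier B_ring. y \<oplus>\<^bsub>B_ring\<^esub> x = \<zero>\<^bsub>B_ring\<^esub>"
      by (intro bexI[of _ "- x"]) (auto simp: B_ring_def)
  qed (auto simp: B_ring_def add_ac)
  show "monoid B_ring"
  proof (rule monoidI)
    fix x y assume "x \<in> carrier B_ring" "y \<in> carrier B_ring"
    then show "x \<otimes>\<^bsub>B_ring\<^esub> y \<in> carrier B_ring"
      by (auto simp: B_ring_def matrix_matrix_mult_def sum_2)
  next
    show "\<one>\<^bsub>B_ring\<^esub> \<in> carrier B_ring"
      by (simp add: B_ring_def mat_def)
  qed (simp_all add: B_ring_def matrix_mul_assoc)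
qed (auto simp: B_ring_def matrix_matrix_mult_def distrib_left distrib_right sum.distrib vec_eq_iff)

text \<open>The complex vector space underlying a \<open>\<BB>\<close>-module, via the scalar matrices in \<open>\<BB>\<close>.\<close>

definition underlying_vs :: "(B_elem, 'u) module \<Rightarrow> (complex, 'u) module" where
  "underlying_vs V =
     \<lparr>carrier = carrier V, mult = mult V, one = one V, zero = zero V, add = add V,
      smult = (\<lambda>c v. mat (fps_const c) \<odot>\<^bsub>V\<^esub> v)\<rparr>"

definition B_hom :: "(B_elem, 'u) module \<Rightarrow> (B_elem, 'u) module \<Rightarrow> ('u \<Rightarrow> 'u) set" where
  "B_hom V W = extensional (carrier V) \<inter> module_hom B_ring V W"

definition RepB :: "((B_elem, 'u) module, 'u \<Rightarrow> 'u) cat" where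
  "RepB = \<lparr>Ob = {V. left_module B_ring V \<and> finite_dimensional (underlying_vs V)}, Hom = B_hom,
           Idt = (\<lambda>V. restrict (\<lambda>v. v) (carrier V)),
           Cmp = (\<lambda>U V W g f. compose (carrier U) g f)\<rparr>"

section \<open>Representations of the two-cyclic quiver\<close>

record 'u quiver_rep =
  Vminus :: "(complex, 'u) module"
  Vplus :: "(complex, 'u) module"
  Amap :: "'u \<Rightarrow> 'u"
  Bmap :: "'u \<Rightarrow> 'u"

text \<open>Operations are total functions in HOL, so equality is only asked for on the carriers.\<close>

definition same_vs :: "(complex, 'u) module \<Rightarrow> (complex, 'u) module \<Rightarrow> bool" where
  "same_vs V W \<longleftrightarrow>
     carrier V = carrier W \<and> \<zero>\<^bsub>V\<^esub> = \<zero>\<^bsub>W\<^esub> \<and>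
     (\<forall>x \<in> carrier V. \<forall>y \<in> carrier V. x \<oplus>\<^bsub>V\<^esub> y = x \<oplus>\<^bsub>W\<^esub> y) \<and>
     (\<forall>c. \<forall>x \<in> carrier V. c \<odot>\<^bsub>V\<^esub> x = c \<odot>\<^bsub>W\<^esub> x)"

definition same_quiver_rep :: "'u quiver_rep \<Rightarrow> 'u quiver_rep \<Rightarrow> bool" where
  "same_quiver_rep Q R \<longleftrightarrow>
     same_vs (Vminus Q) (Vminus R) \<and> same_vs (Vplus Q) (Vplus R) \<and>
     (\<forall>v \<in> carrier (Vminus Q). Amap Q v = Amap R v) \<and>
     (\<forall>v \<in> carrier (Vplus Q). Bmap Q v = Bmap R v)"

definition matrix_unit :: "2 \<Rightarrow> 2 \<Rightarrow> B_elem" where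
  "matrix_unit i j = (\<chi> k l. if k = i \<and> l = j then 1 else 0)"

text \<open>
  The identification of \<open>\<BB>\<close>-modules with representations of the quiver:
  \<open>V\<^sub>- = E\<^sub>1\<^sub>1 V\<close>, \<open>V\<^sub>+ = E\<^sub>2\<^sub>2 V\<close>, the arrow \<open>a\<close> acts by \<open>E\<^sub>2\<^sub>1\<close> and the arrow \<open>b\<close> by \<open>t E\<^sub>1\<^sub>2\<close>.
\<close>

definition quiver_rep_of_B_module :: "(B_elem, 'u) module \<Rightarrow> 'u quiver_rep" where
  "quiver_rep_of_B_module V =
     \<lparr>Vminus = (underlying_vs V)\<lparr>carrier := {matrix_unit 1 1 \<odot>\<^bsub>V\<^esub> v | v. v \<in> carrier V}\<rparr>,
      Vplus = (underlying_vs V)\<lparr>carrier := {matrix_unit 2 2 \<odot>\<^bsub>V\<^esub> v | v. v \<in> carrier V}\<rparr>,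
      Amap = (\<lambda>v. matrix_unit 2 1 \<odot>\<^bsub>V\<^esub> v),
      Bmap = (\<lambda>v. (mat fps_X ** matrix_unit 1 2) \<odot>\<^bsub>V\<^esub> v)\<rparr>"

definition quiver_rep_of_gk_module :: "'u gk_module \<Rightarrow> 'u quiver_rep" where
  "quiver_rep_of_gk_module M =
     \<lparr>Vminus = module.truncate (M\<lparr>carrier := weight_space M (-1)\<rparr>),
      Vplus = module.truncate (M\<lparr>carrier := weight_space M 1\<rparr>),
      Amap = gact M X_mat,
      Bmap = gact M Y_mat\<rparr>"

end

theory Submission
  imports "HOL-Algebra.Free_Abelian_Groups" Defs
begin

text \<open>
  On a module \<open>M\<close> in \<open>HC\<^sub>0\<close> the operator \<open>T = (C + 1) / 4\<close> is nilpotent and commutes with the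
  \<open>(\<gg>, K)\<close>-action, and on the weight space \<open>M\<^sub>n\<close> one has \<open>Y X = T - ((n + 1) / 2)\<^sup>2\<close> and
  \<open>X Y = T - ((n - 1) / 2)\<^sup>2\<close>. Hence \<open>X : M\<^sub>n \<rightarrow> M\<^sub>n\<^sub>+\<^sub>2\<close> is bijective for every odd \<open>n \<noteq> -1\<close>, while
  \<open>Y X\<close> on \<open>M\<^sub>-\<^sub>1\<close> and \<open>X Y\<close> on \<open>M\<^sub>1\<close> are just \<open>T\<close>. So \<open>t \<mapsto> T\<close>, \<open>a \<mapsto> X\<close>, \<open>b \<mapsto> Y\<close> makes
  \<open>M\<^sub>-\<^sub>1 \<oplus> M\<^sub>1\<close> a \<open>\<BB>\<close>-module, and a morphism is determined by, and can be freely prescribed on,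
  this part; \<open>K\<close> acts on \<open>M\<^sub>n\<close> by a character, so that it imposes no further condition.
  Conversely a finite dimensional \<open>\<BB>\<close>-module \<open>V\<close> comes from the direct sum of one copy of \<open>V\<^sub>+\<close>
  for every odd \<open>n > 0\<close> and one copy of \<open>V\<^sub>-\<close> for every odd \<open>n < 0\<close>, with \<open>X\<close> and \<open>Y\<close>
  given by elements of \<open>\<BB>\<close>. A fully faithful and essentially surjective functor is an equivalence.
\<close>

section \<open>Equivalences of categories\<close>

text \<open>Three obstacles shape the proof. All objects live on one fixed type \<open>'u\<close>,
  whereas the realization of a module \<open>V\<close> is an infinite direct sum, naturally a set of
  functions on the integers. It is moved back into \<open>'u\<close> by cardinality: if
  \<open>V\<close> is nonzero, the multiples of one vector already make it infinite, and then
  finitely supported families in \<open>V\<close> embed into \<open>V\<close>. Identities between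
  vectors have many terms. They are tested on linear functionals, where they become identities of
  complex numbers; functionals must therefore separate the points of infinite dimensional spaces
  too, which is the reason for Zorn's lemma. A map respecting the arrows of the quiver is at first
  only linear over polynomials in \<open>t\<close>; finite dimension makes \<open>t\<close>
  nilpotent, and linearity over power series follows. The weights -1 and 1 are singled out because
  the square subtracted from \<open>T\<close> vanishes only on the step between them: every other
  step is invertible. The carrier of the image of \<open>M\<close> is the subspace of these two
  weights itself, so that on morphisms the functor is restriction.\<close>

context category
begin

text \<open>The inner pair \<open>h\<close>, \<open>k\<close> cancels by associativity. With
  \<open>k\<close> and \<open>h\<close> a chosen isomorphism and its inverse, this says that
  conjugation by chosen isomorphisms respects composition.\<close>

lemma Cmp_sandwich:
  assumes "A \<in> Ob C" "B \<in> Ob C" "D \<in> Ob C" "E \<in> Ob C"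
    and "f \<in> Hom C A B" "k \<in> Hom C B D" "h \<in> Hom C D B" "g \<in> Hom C B E"
    and "Cmp C B D B h k = Idt C B"
  shows "Cmp C A D E (Cmp C D B E g h) (Cmp C A B D k f) = Cmp C A B E g f"
proof -
  have "Cmp C B D E (Cmp C D B E g h) k = g"
    using Cmp_assoc[of B D B E k h g] assms by (simp add: Cmp_Idt_right)
  then show ?thesis
    using assms by (simp add: Cmp_assoc Cmp_in_Hom)
qed

end

text \<open>The quasi-inverse sends \<open>Y\<close> to a chosen object \<open>G Y\<close> with
  \<open>Fo (G Y)\<close> isomorphic to \<open>Y\<close>, and a morphism to the preimage under
  \<open>Fm\<close> of its conjugate by the chosen isomorphisms. Equations in \<open>C\<close> are
  proved by applying the injective \<open>Fm\<close>.\<close>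

lemma equivalence_of_categoriesI:
  fixes C :: "('o, 'm) cat" and D :: "('p, 'n) cat"
  assumes F: "cat_functor C D Fo Fm"
    and fully_faithful: "\<And>A B. \<lbrakk>A \<in> Ob C; B \<in> Ob C\<rbrakk> \<Longrightarrow>
      bij_betw (Fm A B) (Hom C A B) (Hom D (Fo A) (Fo B))"
    and essentially_surjective: "\<And>Y. Y \<in> Ob D \<Longrightarrow> \<exists>X \<in> Ob C. \<exists>e. cat_iso D (Fo X) Y e"
  shows "equivalence_of_categories C D Fo Fm"
proof -
  interpret F: cat_functor C D Fo Fm by (rule F)
  have "\<forall>Y\<in>Ob D. \<exists>X e e'. X \<in> Ob C \<and> e \<in> Hom D (Fo X) Y \<and> e' \<in> Hom D Y (Fo X) \<and>
      Cmp D (Fo X) Y (Fo X) e' e = Idt D (Fo X) \<and> Cmp D Y (Fo X) Y e e' = Idt D Y"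
    using essentially_surjective unfolding cat_iso_def by blast
  from bchoice[OF this] obtain G where "\<forall>Y\<in>Ob D. \<exists>e e'. G Y \<in> Ob C \<and> e \<in> Hom D (Fo (G Y)) Y \<and>
      e' \<in> Hom D Y (Fo (G Y)) \<and> Cmp D (Fo (G Y)) Y (Fo (G Y)) e' e = Idt D (Fo (G Y)) \<and>
      Cmp D Y (Fo (G Y)) Y e e' = Idt D Y" by blast
  from bchoice[OF this] obtain e where "\<forall>Y\<in>Ob D. \<exists>e'. G Y \<in> Ob C \<and> e Y \<in> Hom D (Fo (G Y)) Y \<and>
      e' \<in> Hom D Y (Fo (G Y)) \<and> Cmp D (Fo (G Y)) Y (Fo (G Y)) e' (e Y) = Idt D (Fo (G Y)) \<and>
      Cmp D Y (Fo (G Y)) Y (e Y) e' = Idt D Y" by blast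
  from bchoice[OF this] obtain e' where Ge: "\<And>Y. Y \<in> Ob D \<Longrightarrow> G Y \<in> Ob C"
      "\<And>Y. Y \<in> Ob D \<Longrightarrow> e Y \<in> Hom D (Fo (G Y)) Y"
      "\<And>Y. Y \<in> Ob D \<Longrightarrow> e' Y \<in> Hom D Y (Fo (G Y))"
      "\<And>Y. Y \<in> Ob D \<Longrightarrow> Cmp D (Fo (G Y)) Y (Fo (G Y)) (e' Y) (e Y) = Idt D (Fo (G Y))"
      "\<And>Y. Y \<in> Ob D \<Longrightarrow> Cmp D Y (Fo (G Y)) Y (e Y) (e' Y) = Idt D Y"
    by blast
  note O = Ge(1) F.Fo_in_Ob
  \<comment> \<open>The conjugate of \<open>g\<close>: first \<open>e Y\<close>, then
    \<open>g\<close>, then \<open>e' Z\<close>. It becomes the image under \<open>Fm\<close> of the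
    value of the inverse functor at \<open>g\<close>.\<close>
  define h where "h Y Z g = Cmp D (Fo (G Y)) Y (Fo (G Z)) (Cmp D Y Z (Fo (G Z)) (e' Z) g) (e Y)"
    for Y Z g
  have h: "h Y Z g \<in> Hom D (Fo (G Y)) (Fo (G Z))"
    if "Y \<in> Ob D" "Z \<in> Ob D" "g \<in> Hom D Y Z" for Y Z g
    unfolding h_def using that by (intro F.target.Cmp_in_Hom) (auto simp: Ge O)
  define L where "L A B = inv_into (Hom C A B) (Fm A B)" for A B
  have L: "L A B g \<in> Hom C A B" "Fm A B (L A B g) = g"
    if "A \<in> Ob C" "B \<in> Ob C" "g \<in> Hom D (Fo A) (Fo B)" for A B g
    using fully_faithful[OF that(1,2)] that(3) unfolding L_def bij_betw_def
    by (auto intro: inv_into_into f_inv_into_f)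
  have inj: "f = g" if "Fm A B f = Fm A B g" "A \<in> Ob C" "B \<in> Ob C" "f \<in> Hom C A B" "g \<in> Hom C A B"
    for A B f g
    using fully_faithful[OF that(2,3)] that by (auto simp: bij_betw_def inj_on_def)
  define Gm where "Gm Y Z g = L (G Y) (G Z) (h Y Z g)" for Y Z g
  have Gm: "Gm Y Z g \<in> Hom C (G Y) (G Z)" "Fm (G Y) (G Z) (Gm Y Z g) = h Y Z g"
    if "Y \<in> Ob D" "Z \<in> Ob D" "g \<in> Hom D Y Z" for Y Z g
    unfolding Gm_def using that by (auto intro!: L h Ge)
  have h_Idt: "h Y Y (Idt D Y) = Idt D (Fo (G Y))" if "Y \<in> Ob D" for Y
    unfolding h_def using that by (simp add: Ge O F.target.Cmp_Idt_right)
  have h_e: "h Y Z g = Cmp D (Fo (G Y)) Z (Fo (G Z)) (e' Z) (Cmp D (Fo (G Y)) Y Z g (e Y))"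
    if "Y \<in> Ob D" "Z \<in> Ob D" "g \<in> Hom D Y Z" for Y Z g
    unfolding h_def using that by (simp add: F.target.Cmp_assoc Ge O)
  have h_Cmp: "h Y W (Cmp D Y Z W g f) = Cmp D (Fo (G Y)) (Fo (G Z)) (Fo (G W)) (h Z W g) (h Y Z f)"
    if that: "Y \<in> Ob D" "Z \<in> Ob D" "W \<in> Ob D" "f \<in> Hom D Y Z" "g \<in> Hom D Z W" for Y Z W f g
  proof -
    have "Cmp D (Fo (G Y)) (Fo (G Z)) (Fo (G W)) (h Z W g) (h Y Z f) =
        Cmp D (Fo (G Y)) Z (Fo (G W)) (Cmp D Z W (Fo (G W)) (e' W) g) (Cmp D (Fo (G Y)) Y Z f (e Y))"
      unfolding h_def[of Z W] h_e[OF that(1,2,4)]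
      using that by (intro F.target.Cmp_sandwich) (auto simp: Ge O intro!: F.target.Cmp_in_Hom)
    also have "\<dots> = h Y W (Cmp D Y Z W g f)"
      unfolding h_def using that by (simp add: F.target.Cmp_assoc F.target.Cmp_in_Hom Ge O)
    finally show ?thesis ..
  qed
  have G: "cat_functor D C G Gm"
  proof
    fix A assume A: "A \<in> Ob D"
    show "Gm A A (Idt D A) = Idt C (G A)"
      by (rule inj[of "G A" "G A"]) (use A in \<open>simp_all add: Gm h_Idt Ge F.Fm_Idt
          F.target.Idt_in_Hom F.source.Idt_in_Hom\<close>)
  next
    fix A B B' f g
    assume *: "A \<in> Ob D" "B \<in> Ob D" "B' \<in> Ob D" "f \<in> Hom D A B" "g \<in> Hom D B B'"
    then have gf: "Cmp D A B B' g f \<in> Hom D A B'"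
      by (intro F.target.Cmp_in_Hom)
    show "Gm A B' (Cmp D A B B' g f) = Cmp C (G A) (G B) (G B') (Gm B B' g) (Gm A B f)"
      by (rule inj[of "G A" "G B'"])
        (use * gf in \<open>simp_all add: Gm Ge h_Cmp F.Fm_Cmp F.source.Cmp_in_Hom\<close>)
  qed (auto simp: Ge Gm)
  \<comment> \<open>Fullness lifts \<open>e' (Fo A)\<close>, a morphism from \<open>Fo A\<close> to
    \<open>Fo (G (Fo A))\<close>, to the component at \<open>A\<close>; the lift of
    \<open>e (Fo A)\<close> is its inverse.\<close>
  have unit: "naturally_isomorphic C C (\<lambda>A. A) (\<lambda>A B f. f)
      (\<lambda>A. G (Fo A)) (\<lambda>A B f. Gm (Fo A) (Fo B) (Fm A B f))"
    unfolding naturally_isomorphic_def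
  proof (intro exI[of _ "\<lambda>A. L A (G (Fo A)) (e' (Fo A))"] conjI ballI)
    fix A assume A: "A \<in> Ob C"
    let ?k = "L A (G (Fo A)) (e' (Fo A))" and ?l = "L (G (Fo A)) A (e (Fo A))"
    have k: "?k \<in> Hom C A (G (Fo A))" "Fm A (G (Fo A)) ?k = e' (Fo A)"
      and l: "?l \<in> Hom C (G (Fo A)) A" "Fm (G (Fo A)) A ?l = e (Fo A)"
      using A by (auto intro!: L Ge O)
    have "Cmp C A (G (Fo A)) A ?l ?k = Idt C A"
      by (rule inj[of A A]) (use A k l in \<open>simp_all add: F.Fm_Cmp Ge O F.Fm_Idt
          F.source.Cmp_in_Hom F.source.Idt_in_Hom\<close>)
    moreover have "Cmp C (G (Fo A)) A (G (Fo A)) ?k ?l = Idt C (G (Fo A))"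
      by (rule inj[of "G (Fo A)" "G (Fo A)"]) (use A k l in \<open>simp_all add: F.Fm_Cmp Ge O F.Fm_Idt
          F.source.Cmp_in_Hom F.source.Idt_in_Hom\<close>)
    ultimately show "cat_iso C A (G (Fo A)) ?k"
      unfolding cat_iso_def using k l by blast
  next
    fix A B f assume *: "A \<in> Ob C" "B \<in> Ob C" "f \<in> Hom C A B"
    let ?k = "\<lambda>A. L A (G (Fo A)) (e' (Fo A))"
    have k: "?k A \<in> Hom C A (G (Fo A))" "Fm A (G (Fo A)) (?k A) = e' (Fo A)" if "A \<in> Ob C" for A
      using that by (auto intro!: L Ge O)
    have Ff: "Fm A B f \<in> Hom D (Fo A) (Fo B)" using * by (rule F.Fm_in_Hom)
    have "Cmp D (Fo A) (Fo (G (Fo A))) (Fo (G (Fo B))) (h (Fo A) (Fo B) (Fm A B f)) (e' (Fo A)) =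
        Cmp D (Fo A) (Fo B) (Fo (G (Fo B))) (e' (Fo B)) (Fm A B f)"
      unfolding h_def using * Ff
      by (subst F.target.Cmp_assoc[symmetric])
        (auto simp: Ge O F.target.Cmp_in_Hom F.target.Cmp_Idt_right)
    then show "Cmp C A (G (Fo A)) (G (Fo B)) (Gm (Fo A) (Fo B) (Fm A B f)) (?k A) =
        Cmp C A B (G (Fo B)) (?k B) f"
      by (intro inj[of A "G (Fo B)"])
        (use * k Ff in \<open>simp_all add: F.Fm_Cmp Ge O Gm F.source.Cmp_in_Hom\<close>)
  qed
  have counit: "naturally_isomorphic D D (\<lambda>A. Fo (G A)) (\<lambda>A B f. Fm (G A) (G B) (Gm A B f))
      (\<lambda>A. A) (\<lambda>A B f. f)"
    unfolding naturally_isomorphic_def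
  proof (intro exI[of _ e] conjI ballI)
    fix A assume "A \<in> Ob D"
    then show "cat_iso D (Fo (G A)) A (e A)"
      unfolding cat_iso_def using Ge by blast
  next
    fix A B f assume *: "A \<in> Ob D" "B \<in> Ob D" "f \<in> Hom D A B"
    have "Cmp D (Fo (G A)) (Fo (G B)) B (e B) (h A B f) = Cmp D (Fo (G A)) A B f (e A)"
      unfolding h_e[OF *] using *
      by (subst F.target.Cmp_assoc) (auto simp: Ge O F.target.Cmp_in_Hom F.target.Cmp_Idt_left)
    then show "Cmp D (Fo (G A)) A B f (e A) =
        Cmp D (Fo (G A)) (Fo (G B)) B (e B) (Fm (G A) (G B) (Gm A B f))"
      using * by (simp add: Gm)
  qed
  show ?thesis
    unfolding equivalence_of_categories_def using F G unit counit by blast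
qed

section \<open>Complex vector spaces and their duals\<close>

lemma complex_field_simps [simp]:
  "carrier complex_field = UNIV" "a \<otimes>\<^bsub>complex_field\<^esub> b = a * b" "\<one>\<^bsub>complex_field\<^esub> = 1"
  "\<zero>\<^bsub>complex_field\<^esub> = 0" "a \<oplus>\<^bsub>complex_field\<^esub> b = a + b"
  by (simp_all add: complex_field_def)

lemma a_inv_complex_field [simp]: "a_inv complex_field c = - c"
proof -
  interpret field complex_field by (rule field_complex_field)
  show ?thesis by (rule minus_equality) auto
qed

locale complex_vs = vectorspace complex_field V for V :: "(complex, 'u, 'x) module_scheme" (structure)
begin

lemma smult_simps [simp]:
  "x \<in> carrier V \<Longrightarrow> 1 \<odot> x = x" "x \<in> carrier V \<Longrightarrow> 0 \<odot> x = \<zero>" "c \<odot> \<zero> = \<zero>"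
  "x \<in> carrier V \<Longrightarrow> c \<odot> x \<in> carrier V"
  using smult_one smult_l_null smult_r_null smult_closed by auto

lemma smult_distr:
  "x \<in> carrier V \<Longrightarrow> (a + b) \<odot> x = a \<odot> x \<oplus> b \<odot> x"
  "x \<in> carrier V \<Longrightarrow> y \<in> carrier V \<Longrightarrow> a \<odot> (x \<oplus> y) = a \<odot> x \<oplus> a \<odot> y"
  "x \<in> carrier V \<Longrightarrow> (a * b) \<odot> x = a \<odot> (b \<odot> x)"
  using smult_l_distr[of a b x] smult_r_distr[of a x y] smult_assoc1[of a b x] by auto

lemma minus_eq_smult: "x \<in> carrier V \<Longrightarrow> \<ominus> x = (-1) \<odot> x"
  using smult_l_minus[of 1 x] by simp

lemma complex_subspace_iff:
  "complex_subspace W V \<longleftrightarrow> W \<subseteq> carrier V \<and> \<zero> \<in> W \<and>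
    (\<forall>x\<in>W. \<forall>y\<in>W. x \<oplus> y \<in> W) \<and> (\<forall>c. \<forall>x\<in>W. c \<odot> x \<in> W)"
  unfolding subspace_def LinearCombinations.submodule_def
  using vectorspace_axioms module_axioms by auto

lemma dual_spaceD:
  assumes "\<phi> \<in> dual_space V"
  shows dual_add: "\<lbrakk>x \<in> carrier V; y \<in> carrier V\<rbrakk> \<Longrightarrow> \<phi> (x \<oplus> y) = \<phi> x + \<phi> y"
    and dual_smult: "x \<in> carrier V \<Longrightarrow> \<phi> (c \<odot> x) = c * \<phi> x"
  using assms by (auto simp: dual_space_def)

lemma dual_zero: "\<phi> \<in> dual_space V \<Longrightarrow> \<phi> \<zero> = 0"
  using dual_smult[of \<phi> \<zero> 0] by simp

lemma dual_minus: "\<lbrakk>\<phi> \<in> dual_space V; x \<in> carrier V; y \<in> carrier V\<rbrakk> \<Longrightarrow> \<phi> (x \<ominus> y) = \<phi> x - \<phi> y"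
  by (simp add: a_minus_def dual_add minus_eq_smult dual_smult)

lemma dual_finsum:
  assumes "\<phi> \<in> dual_space V" "f \<in> A \<rightarrow> carrier V"
  shows "\<phi> (finsum V f A) = (\<Sum>a\<in>A. \<phi> (f a))"
  using assms(2)
proof (induction A rule: infinite_finite_induct)
  case (infinite A)
  then show ?case
    using assms(1) by (simp add: dual_zero finsum_infinite)
qed (auto simp: assms dual_zero dual_add)

text \<open>Zorn's lemma gives a maximal subspace \<open>U\<close> avoiding \<open>w\<close>; it is a hyperplane complementing
  the line of \<open>w\<close>, and the functional is the coordinate along \<open>w\<close>.\<close>

lemma dual_space_separates:
  assumes w: "w \<in> carrier V" "w \<noteq> \<zero>"
  shows "\<exists>\<phi>\<in>dual_space V. \<phi> w \<noteq> 0"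
proof -
  let ?\<A> = "{U. complex_subspace U V \<and> w \<notin> U}"
  have "{\<zero>} \<in> ?\<A>" using w by (auto simp: complex_subspace_iff)
  then have "?\<A> \<noteq> {}" by blast
  moreover have "\<Union>\<C> \<in> ?\<A>" if ne: "\<C> \<noteq> {}" and ch: "subset.chain ?\<A> \<C>" for \<C>
  proof -
    have sub: "complex_subspace U V" "w \<notin> U" if "U \<in> \<C>" for U
      using ch that unfolding subset.chain_def by blast+
    have lin: "A \<subseteq> B \<or> B \<subseteq> A" if "A \<in> \<C>" "B \<in> \<C>" for A B
      using ch that unfolding subset.chain_def by blast
    have "complex_subspace (\<Union>\<C>) V"
      unfolding complex_subspace_iff
    proof (intro conjI ballI allI)
      show "\<Union>\<C> \<subseteq> carrier V"
        using sub(1) unfolding complex_subspace_iff by (intro Union_least) simp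
      obtain D where "D \<in> \<C>" using ne by blast
      then show "\<zero> \<in> \<Union>\<C>"
        using sub(1)[of D] unfolding complex_subspace_iff by (intro UnionI[of D]) simp_all
    next
      fix x y assume "x \<in> \<Union>\<C>" "y \<in> \<Union>\<C>"
      then obtain A B where AB: "A \<in> \<C>" "B \<in> \<C>" "x \<in> A" "y \<in> B" by (elim UnionE)
      then obtain D where D: "D \<in> \<C>" "x \<in> D" "y \<in> D" using lin[OF AB(1,2)] by blast
      then have "x \<oplus> y \<in> D" using sub(1)[OF D(1)] unfolding complex_subspace_iff by simp
      then show "x \<oplus> y \<in> \<Union>\<C>" using D(1) by (intro UnionI)
    next
      fix c x assume "x \<in> \<Union>\<C>"
      then obtain D where D: "D \<in> \<C>" "x \<in> D" by (rule UnionE)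
      then have "c \<odot> x \<in> D" using sub(1)[OF D(1)] unfolding complex_subspace_iff by simp
      then show "c \<odot> x \<in> \<Union>\<C>" using D(1) by (intro UnionI)
    qed
    moreover have "w \<notin> \<Union>\<C>" using sub(2) by blast
    ultimately show ?thesis by simp
  qed
  ultimately have "\<exists>U\<in>?\<A>. \<forall>X\<in>?\<A>. U \<subseteq> X \<longrightarrow> X = U"
    by (rule subset_Zorn_nonempty)
  then obtain U where U: "complex_subspace U V" "w \<notin> U"
    and max: "\<And>X. complex_subspace X V \<Longrightarrow> w \<notin> X \<Longrightarrow> U \<subseteq> X \<Longrightarrow> X = U"
    by blast
  have Uc: "x \<in> carrier V" if "x \<in> U" for x using U that by (auto simp: complex_subspace_iff)
  have Ucl: "\<zero> \<in> U" "x \<in> U \<Longrightarrow> y \<in> U \<Longrightarrow> x \<oplus> y \<in> U" "x \<in> U \<Longrightarrow> c \<odot> x \<in> U" for x y c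
    using U by (auto simp: complex_subspace_iff)
  \<comment> \<open>If \<open>v\<close> lies outside \<open>U\<close>, then \<open>U\<close> plus
    the line of \<open>v\<close> is strictly larger and contains \<open>w\<close> by maximality. In
    \<open>w = u + a v\<close> the scalar \<open>a\<close> is nonzero since \<open>w\<close> is not
    in \<open>U\<close>, so the equation can be solved for \<open>v\<close>.\<close>
  have ex: "\<exists>c. v \<oplus> c \<odot> w \<in> U" if v: "v \<in> carrier V" for v
  proof (cases "v \<in> U")
    case True
    then show ?thesis using w v by (intro exI[of _ 0]) simp
  next
    case False
    let ?X = "{u \<oplus> a \<odot> v | u a. u \<in> U}"
    have "complex_subspace ?X V"
      unfolding complex_subspace_iff
    proof (intro conjI ballI allI)
      show "?X \<subseteq> carrier V" using Uc v by auto
      have "\<zero> = \<zero> \<oplus> 0 \<odot> v" using v by simp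
      then show "\<zero> \<in> ?X" using Ucl by blast
    next
      fix x y assume "x \<in> ?X" "y \<in> ?X"
      then obtain u a u' a' where *: "x = u \<oplus> a \<odot> v" "y = u' \<oplus> a' \<odot> v" "u \<in> U" "u' \<in> U" by blast
      have "x \<oplus> y = (u \<oplus> u') \<oplus> (a + a') \<odot> v"
        using * Uc v by (simp add: smult_distr M.add.m_ac)
      then show "x \<oplus> y \<in> ?X" using * Ucl by blast
    next
      fix c x assume "x \<in> ?X"
      then obtain u a where *: "x = u \<oplus> a \<odot> v" "u \<in> U" by blast
      have "c \<odot> x = c \<odot> u \<oplus> (c * a) \<odot> v"
        using * Uc v by (simp add: smult_distr)
      then show "c \<odot> x \<in> ?X" using * Ucl by blast
    qed
    moreover have "U \<subseteq> ?X"
    proof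
      fix u assume "u \<in> U"
      moreover have "u = u \<oplus> 0 \<odot> v" using \<open>u \<in> U\<close> Uc v by simp
      ultimately show "u \<in> ?X" by blast
    qed
    moreover have "v = \<zero> \<oplus> 1 \<odot> v" using v by simp
    then have "v \<in> ?X" using Ucl by blast
    ultimately have "w \<in> ?X" using max[of ?X] False by blast
    then obtain u a where *: "w = u \<oplus> a \<odot> v" "u \<in> U" by blast
    then have "a \<noteq> 0" using U Uc v by auto
    have "v \<oplus> (- (1 / a)) \<odot> w = v \<oplus> ((- (1 / a)) \<odot> u \<oplus> ((- (1/a)) * a) \<odot> v)"
      using * Uc v by (simp only: smult_distr smult_closed complex_field_simps UNIV_I smult_simps)
    also have "\<dots> = v \<oplus> ((- (1 / a)) \<odot> u \<oplus> (\<ominus> v))"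
      using \<open>a \<noteq> 0\<close> v by (simp add: minus_eq_smult)
    also have "\<dots> = (- (1 / a)) \<odot> u \<oplus> (v \<oplus> \<ominus> v)"
      using v Uc[OF *(2)] by (simp add: M.add.m_lcomm)
    also have "\<dots> = (- (1 / a)) \<odot> u"
      using v Uc[OF *(2)] by (simp add: M.r_neg)
    finally have "v \<oplus> (- (1 / a)) \<odot> w \<in> U" using Ucl(3)[OF *(2)] by simp
    then show ?thesis by (rule exI)
  qed
  have uniq: "c = c'" if v: "v \<in> carrier V" and c: "v \<oplus> c \<odot> w \<in> U" "v \<oplus> c' \<odot> w \<in> U" for v c c'
  proof (rule ccontr)
    assume ne: "c \<noteq> c'"
    have "(v \<oplus> c \<odot> w) \<oplus> (-1) \<odot> (v \<oplus> c' \<odot> w) = (v \<oplus> (-1) \<odot> v) \<oplus> (c \<odot> w \<oplus> ((-1) * c') \<odot> w)"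
      using v w by (simp only: smult_distr smult_simps M.add.m_ac M.add.m_closed)
    also have "\<dots> = (1 + (-1)) \<odot> v \<oplus> (c + (-1) * c') \<odot> w"
      using v w by (simp only: smult_distr smult_simps)
    also have "\<dots> = (c - c') \<odot> w" using v w by simp
    finally have "(c - c') \<odot> w \<in> U" using Ucl(2)[OF c(1) Ucl(3)[OF c(2), of "-1"]] by simp
    then have "(1 / (c - c')) \<odot> ((c - c') \<odot> w) \<in> U" using Ucl by blast
    then have "w \<in> U" using ne w by (simp flip: smult_distr(3))
    then show False using U by simp
  qed
  \<comment> \<open>Modulo \<open>U\<close> the vector \<open>v\<close> is \<open>- c\<close> times
    \<open>w\<close>, hence the sign; it gives the value 1 at \<open>w\<close>.\<close>
  define \<phi> where "\<phi> v = - (THE c. v \<oplus> c \<odot> w \<in> U)" for v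
  have \<phi>: "\<phi> v = - c" if "v \<in> carrier V" "v \<oplus> c \<odot> w \<in> U" for v c
  proof -
    have "(THE c. v \<oplus> c \<odot> w \<in> U) = c"
      by (rule the_equality) (rule that, rule uniq[OF that(1) _ that(2)])
    then show ?thesis unfolding \<phi>_def by simp
  qed
  have "\<phi> \<in> dual_space V"
    unfolding dual_space_def
  proof (intro CollectI conjI ballI allI)
    fix x y assume xy: "x \<in> carrier V" "y \<in> carrier V"
    then obtain c d where cd: "x \<oplus> c \<odot> w \<in> U" "y \<oplus> d \<odot> w \<in> U" using ex by blast
    have "(x \<oplus> y) \<oplus> (c + d) \<odot> w = (x \<oplus> c \<odot> w) \<oplus> (y \<oplus> d \<odot> w)"
      using xy w by (simp add: smult_distr M.add.m_ac)
    then have "(x \<oplus> y) \<oplus> (c + d) \<odot> w \<in> U" using Ucl(2)[OF cd] by simp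
    then show "\<phi> (x \<oplus> y) = \<phi> x + \<phi> y" using cd xy \<phi> by simp
  next
    fix a x assume x: "x \<in> carrier V"
    then obtain c where c: "x \<oplus> c \<odot> w \<in> U" using ex by blast
    have "a \<odot> x \<oplus> (a * c) \<odot> w = a \<odot> (x \<oplus> c \<odot> w)"
      using x w by (simp add: smult_distr)
    then have "a \<odot> x \<oplus> (a * c) \<odot> w \<in> U" using Ucl(3)[OF c, of a] by simp
    then show "\<phi> (a \<odot> x) = a * \<phi> x" using c x \<phi> by simp
  qed
  moreover have "w \<oplus> (-1) \<odot> w = \<zero>"
    using w smult_distr(1)[of w 1 "-1", symmetric] by simp
  then have "\<phi> w = 1" using \<phi>[of w "-1"] w Ucl by simp
  ultimately show ?thesis by (intro bexI[of _ \<phi>]) simp_all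
qed

text \<open>The standard way to prove an identity of vectors below: once a functional is applied,
  both sides are complex numbers and ring arithmetic decides.\<close>

lemma vec_eqI:
  assumes "x \<in> carrier V" "y \<in> carrier V" "\<And>\<phi>. \<phi> \<in> dual_space V \<Longrightarrow> \<phi> x = \<phi> y"
  shows "x = y"
proof (rule ccontr)
  assume "x \<noteq> y"
  moreover have "(x \<ominus> y) \<oplus> y = x"
    using assms(1,2) by (simp add: a_minus_def M.a_assoc M.l_neg)
  ultimately have "x \<ominus> y \<noteq> \<zero>" using assms(2) by (intro notI) simp
  then obtain \<phi> where \<phi>: "\<phi> \<in> dual_space V" "\<phi> (x \<ominus> y) \<noteq> 0"
    using dual_space_separates[of "x \<ominus> y"] assms(1,2) by blast
  then show False using assms(3)[OF \<phi>(1)] dual_minus[OF \<phi>(1) assms(1,2)] by simp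
qed

text \<open>Spanning is expressed through subspaces alone: a set generates if no proper subspace
  contains it. In this form finite dimensionality can be moved to subspaces and along linear maps
  without comparing spans in different structures.\<close>

lemma finite_dimensional_iff:
  "finite_dimensional V \<longleftrightarrow>
    (\<exists>A. finite A \<and> A \<subseteq> carrier V \<and> (\<forall>S. complex_subspace S V \<and> A \<subseteq> S \<longrightarrow> S = carrier V))"
proof
  assume "finite_dimensional V"
  then obtain A where A: "finite A" "A \<subseteq> carrier V" "span A = carrier V"
    by (auto simp: fin_dim_def)
  moreover have "S = carrier V" if S: "complex_subspace S V" "A \<subseteq> S" for S
  proof
    show "S \<subseteq> carrier V" using S(1) by (simp add: complex_subspace_iff)
    show "carrier V \<subseteq> S" using span_is_subset[OF S(2) is_module[OF S(1)]] A(3) by simp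
  qed
  ultimately show "\<exists>A. finite A \<and> A \<subseteq> carrier V \<and>
      (\<forall>S. complex_subspace S V \<and> A \<subseteq> S \<longrightarrow> S = carrier V)"
    by (intro exI[of _ A]) simp
next
  assume "\<exists>A. finite A \<and> A \<subseteq> carrier V \<and> (\<forall>S. complex_subspace S V \<and> A \<subseteq> S \<longrightarrow> S = carrier V)"
  then obtain A where A: "finite A" "A \<subseteq> carrier V"
    "\<And>S. complex_subspace S V \<Longrightarrow> A \<subseteq> S \<Longrightarrow> S = carrier V" by blast
  then have "span A = carrier V" using span_is_subspace[of A] in_own_span[of A] by simp
  then show "finite_dimensional V"
    unfolding fin_dim_def using A by (intro exI[of _ A]) simp
qed

text \<open>Subspaces of \<open>W\<close> are the intersections with \<open>W\<close> of subspaces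
  of \<open>V\<close>, so the criterion can be tested inside \<open>V\<close>.\<close>

lemma finite_dimensional_subspace_iff:
  assumes W: "complex_subspace W V"
  shows "finite_dimensional (V\<lparr>carrier := W\<rparr>) \<longleftrightarrow>
    (\<exists>A. finite A \<and> A \<subseteq> W \<and> (\<forall>S. complex_subspace S V \<and> A \<subseteq> S \<longrightarrow> W \<subseteq> S))"
proof -
  interpret W: complex_vs "V\<lparr>carrier := W\<rparr>"
    using W by (simp add: complex_vs_def subspace_is_vs)
  have "complex_subspace S (V\<lparr>carrier := W\<rparr>) \<longleftrightarrow> complex_subspace S V \<and> S \<subseteq> W" for S
    using W by (auto simp: W.complex_subspace_iff complex_subspace_iff)
  note sub = this
  have inter: "complex_subspace (S \<inter> W) V" if "complex_subspace S V" for S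
    using that W by (auto simp: complex_subspace_iff)
  have eq: "(\<forall>S. complex_subspace S V \<and> S \<subseteq> W \<and> A \<subseteq> S \<longrightarrow> S = W) \<longleftrightarrow>
      (\<forall>S. complex_subspace S V \<and> A \<subseteq> S \<longrightarrow> W \<subseteq> S)"
    (is "?L \<longleftrightarrow> ?R") if A: "A \<subseteq> W" for A
  proof
    assume L: ?L
    show ?R
    proof (intro allI impI)
      fix S assume S: "complex_subspace S V \<and> A \<subseteq> S"
      have "complex_subspace (S \<inter> W) V \<and> S \<inter> W \<subseteq> W \<and> A \<subseteq> S \<inter> W"
        using inter[of S] A S by simp
      with L have "S \<inter> W = W" by (elim allE[of _ "S \<inter> W"] impE)
      then show "W \<subseteq> S" by (simp add: Int_absorb1 le_iff_inf Int_commute)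
    qed
  next
    assume R: ?R
    show ?L
    proof (intro allI impI)
      fix S assume S: "complex_subspace S V \<and> S \<subseteq> W \<and> A \<subseteq> S"
      with R have "W \<subseteq> S" by simp
      with S show "S = W" by simp
    qed
  qed
  then show ?thesis
    unfolding W.finite_dimensional_iff sub by (simp add: eq conj_assoc cong: conj_cong)
qed

end

section \<open>Closure laws, functionals and finite sums\<close>

locale complex_space =
  fixes V :: "(complex, 'u, 'x) module_scheme" (structure)
  assumes vs: "complex_vectorspace V"
begin

lemma complex_vs: "complex_vs V" by (simp add: complex_vs_def vs)

lemma vec_closed [simp]:
  "\<zero> \<in> carrier V" "x \<in> carrier V \<Longrightarrow> y \<in> carrier V \<Longrightarrow> x \<oplus> y \<in> carrier V"
  "x \<in> carrier V \<Longrightarrow> c \<odot> x \<in> carrier V" "x \<in> carrier V \<Longrightarrow> y \<in> carrier V \<Longrightarrow> x \<ominus> y \<in> carrier V"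
  "x \<in> carrier V \<Longrightarrow> \<ominus> x \<in> carrier V"
proof -
  interpret complex_vs V by (rule complex_vs)
  show "\<zero> \<in> carrier V" "x \<in> carrier V \<Longrightarrow> y \<in> carrier V \<Longrightarrow> x \<oplus> y \<in> carrier V"
    "x \<in> carrier V \<Longrightarrow> c \<odot> x \<in> carrier V" "x \<in> carrier V \<Longrightarrow> y \<in> carrier V \<Longrightarrow> x \<ominus> y \<in> carrier V"
    "x \<in> carrier V \<Longrightarrow> \<ominus> x \<in> carrier V"
    by simp_all
qed

lemma finsum_closed: "(\<And>a. a \<in> A \<Longrightarrow> f a \<in> carrier V) \<Longrightarrow> finsum V f A \<in> carrier V"
proof -
  interpret complex_vs V by (rule complex_vs)
  show "(\<And>a. a \<in> A \<Longrightarrow> f a \<in> carrier V) \<Longrightarrow> finsum V f A \<in> carrier V"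
    by (rule finsum_closed) (rule Pi_I)
qed

lemma vec_simps [simp]:
  "x \<in> carrier V \<Longrightarrow> 1 \<odot> x = x" "x \<in> carrier V \<Longrightarrow> 0 \<odot> x = \<zero>" "c \<odot> \<zero> = \<zero>"
  "x \<in> carrier V \<Longrightarrow> x \<oplus> \<zero> = x" "x \<in> carrier V \<Longrightarrow> \<zero> \<oplus> x = x"
proof -
  interpret complex_vs V by (rule complex_vs)
  show "x \<in> carrier V \<Longrightarrow> 1 \<odot> x = x" "x \<in> carrier V \<Longrightarrow> 0 \<odot> x = \<zero>" "c \<odot> \<zero> = \<zero>"
    "x \<in> carrier V \<Longrightarrow> x \<oplus> \<zero> = x" "x \<in> carrier V \<Longrightarrow> \<zero> \<oplus> x = x"
    by simp_all
qed

lemmas finite_dimensional_iff = complex_vs.finite_dimensional_iff[OF complex_vs]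
lemmas finite_dimensional_subspace_iff = complex_vs.finite_dimensional_subspace_iff[OF complex_vs]
lemmas complex_subspace_iff = complex_vs.complex_subspace_iff[OF complex_vs]
lemmas vec_eqI = complex_vs.vec_eqI[OF complex_vs]
lemmas dual_simps = complex_vs.dual_add[OF complex_vs] complex_vs.dual_smult[OF complex_vs]
  complex_vs.dual_zero[OF complex_vs] complex_vs.dual_minus[OF complex_vs]

lemma dual_finsum:
  "\<lbrakk>\<phi> \<in> dual_space V; \<And>a. a \<in> A \<Longrightarrow> f a \<in> carrier V\<rbrakk> \<Longrightarrow> \<phi> (finsum V f A) = (\<Sum>a\<in>A. \<phi> (f a))"
  by (rule complex_vs.dual_finsum[OF complex_vs]) (auto intro: Pi_I)

lemma finsum_mono_neutral:
  assumes "finite A" "B \<subseteq> A" "\<And>a. a \<in> A \<Longrightarrow> f a \<in> carrier V" "\<And>a. a \<in> A - B \<Longrightarrow> f a = \<zero>"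
  shows "finsum V f A = finsum V f B"
proof (rule vec_eqI)
  fix \<phi> assume \<phi>: "\<phi> \<in> dual_space V"
  have "(\<Sum>a\<in>A. \<phi> (f a)) = (\<Sum>a\<in>B. \<phi> (f a))"
    using assms \<phi> by (intro sum.mono_neutral_right) (auto simp: dual_simps)
  moreover have "\<And>a. a \<in> B \<Longrightarrow> f a \<in> carrier V" using assms(2,3) by blast
  ultimately show "\<phi> (finsum V f A) = \<phi> (finsum V f B)"
    using \<phi> assms(3) by (simp add: dual_finsum)
qed (use assms in \<open>auto intro!: finsum_closed\<close>)

lemma subspace_closed:
  assumes "complex_subspace W V"
  shows "\<zero> \<in> W" "x \<in> W \<Longrightarrow> x \<in> carrier V" "x \<in> W \<Longrightarrow> y \<in> W \<Longrightarrow> x \<oplus> y \<in> W" "x \<in> W \<Longrightarrow> c \<odot> x \<in> W"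
  using assms unfolding complex_subspace_iff by auto

lemma minus_eq_add_smult: "x \<in> carrier V \<Longrightarrow> y \<in> carrier V \<Longrightarrow> x \<ominus> y = x \<oplus> (-1) \<odot> y"
  by (rule vec_eqI) (simp_all add: dual_simps)

lemma subspace_minus:
  "complex_subspace W V \<Longrightarrow> x \<in> W \<Longrightarrow> y \<in> W \<Longrightarrow> x \<ominus> y \<in> W"
  using minus_eq_add_smult[of x y] subspace_closed[of W] by simp

lemma subspace_finsum:
  assumes W: "complex_subspace W V" and f: "\<And>a. a \<in> A \<Longrightarrow> f a \<in> W"
  shows "finsum V f A \<in> W"
proof -
  interpret complex_vs V by (rule complex_vs)
  show ?thesis using f
  proof (induction A rule: infinite_finite_induct)
    case (insert a A)
    then show ?case using subspace_closed[OF W] by (subst finsum_insert) auto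
  qed (simp_all add: finsum_infinite subspace_closed(1)[OF W])
qed

end

section \<open>Linear maps\<close>

lemma module_hom_iff:
  "f \<in> module_hom complex_field V W \<longleftrightarrow>
    (\<forall>x\<in>carrier V. f x \<in> carrier W) \<and>
    (\<forall>x\<in>carrier V. \<forall>y\<in>carrier V. f (x \<oplus>\<^bsub>V\<^esub> y) = f x \<oplus>\<^bsub>W\<^esub> f y) \<and>
    (\<forall>c. \<forall>x\<in>carrier V. f (c \<odot>\<^bsub>V\<^esub> x) = c \<odot>\<^bsub>W\<^esub> f x)"
  unfolding module_hom_def by auto

lemma module_homD:
  assumes "f \<in> module_hom complex_field V W"
  shows hom_closed: "x \<in> carrier V \<Longrightarrow> f x \<in> carrier W"
    and hom_add: "\<lbrakk>x \<in> carrier V; y \<in> carrier V\<rbrakk> \<Longrightarrow> f (x \<oplus>\<^bsub>V\<^esub> y) = f x \<oplus>\<^bsub>W\<^esub> f y"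
    and hom_smult: "x \<in> carrier V \<Longrightarrow> f (c \<odot>\<^bsub>V\<^esub> x) = c \<odot>\<^bsub>W\<^esub> f x"
  using assms unfolding module_hom_iff by auto

lemma hom_comp_dual:
  assumes "f \<in> module_hom complex_field V W" "\<phi> \<in> dual_space W"
  shows "(\<lambda>x. \<phi> (f x)) \<in> dual_space V"
  using assms unfolding module_hom_iff dual_space_def by auto

lemma hom_zero:
  assumes "f \<in> module_hom complex_field V W" "complex_space V" "complex_space W"
  shows "f \<zero>\<^bsub>V\<^esub> = \<zero>\<^bsub>W\<^esub>"
proof -
  interpret V: complex_space V by fact
  interpret W: complex_space W by fact
  have "f (0 \<odot>\<^bsub>V\<^esub> \<zero>\<^bsub>V\<^esub>) = 0 \<odot>\<^bsub>W\<^esub> f \<zero>\<^bsub>V\<^esub>" using assms(1) by (rule hom_smult) simp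
  then show ?thesis using hom_closed[OF assms(1), of "\<zero>\<^bsub>V\<^esub>"] by simp
qed

lemma hom_minus:
  assumes "f \<in> module_hom complex_field V W" "complex_space V" "complex_space W"
    "x \<in> carrier V" "y \<in> carrier V"
  shows "f (x \<ominus>\<^bsub>V\<^esub> y) = f x \<ominus>\<^bsub>W\<^esub> f y"
proof -
  interpret V: complex_space V by fact
  interpret W: complex_space W by fact
  show ?thesis using assms(4,5) module_homD[OF assms(1)]
    by (simp add: V.minus_eq_add_smult W.minus_eq_add_smult)
qed

lemma hom_finsum:
  assumes f: "f \<in> module_hom complex_field V W" and V: "complex_space V" and W: "complex_space W"
    and x: "\<And>a. a \<in> A \<Longrightarrow> x a \<in> carrier V"
  shows "f (finsum V x A) = finsum W (\<lambda>a. f (x a)) A"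
proof -
  interpret V: complex_space V by fact
  interpret W: complex_space W by fact
  show ?thesis
  proof (rule W.vec_eqI)
    fix \<phi> assume "\<phi> \<in> dual_space W"
    then show "\<phi> (f (finsum V x A)) = \<phi> (finsum W (\<lambda>a. f (x a)) A)"
      using V.dual_finsum[OF hom_comp_dual[OF f \<open>\<phi> \<in> dual_space W\<close>], of A x]
      by (simp add: W.dual_finsum hom_closed[OF f] x)
  qed (auto intro!: hom_closed[OF f] V.finsum_closed W.finsum_closed x)
qed

lemma hom_comp:
  "\<lbrakk>f \<in> module_hom complex_field V W; g \<in> module_hom complex_field U V\<rbrakk> \<Longrightarrow>
    (\<lambda>x. f (g x)) \<in> module_hom complex_field U W"
  unfolding module_hom_iff by auto

lemma hom_funpow:
  assumes "f \<in> module_hom complex_field V V"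
  shows "(f ^^ n) \<in> module_hom complex_field V V"
proof (induction n)
  case (Suc n)
  show ?case using hom_comp[OF assms Suc] by (simp add: o_def)
qed (simp add: module_hom_iff)

section \<open>Direct sum decompositions given by their projections\<close>

locale graded_space = complex_space +
  fixes I :: "'i set" and W :: "'i \<Rightarrow> 'u set" and \<pi> :: "'i \<Rightarrow> 'u \<Rightarrow> 'u"
  assumes W_subspace: "n \<in> I \<Longrightarrow> complex_subspace (W n) V"
    and proj_hom: "\<pi> n \<in> module_hom complex_field V V"
    and proj_in: "n \<in> I \<Longrightarrow> v \<in> carrier V \<Longrightarrow> \<pi> n v \<in> W n"
    and proj_outside: "n \<notin> I \<Longrightarrow> v \<in> carrier V \<Longrightarrow> \<pi> n v = \<zero>"
    and finite_support: "v \<in> carrier V \<Longrightarrow> finite {n. \<pi> n v \<noteq> \<zero>}"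
    and proj_sum: "v \<in> carrier V \<Longrightarrow> finsum V (\<lambda>n. \<pi> n v) {n. \<pi> n v \<noteq> \<zero>} = v"
    and proj_homogeneous: "n \<in> I \<Longrightarrow> v \<in> W n \<Longrightarrow> \<pi> m v = (if m = n then v else \<zero>)"
begin

lemma proj_closed [simp]: "v \<in> carrier V \<Longrightarrow> \<pi> n v \<in> carrier V"
  by (rule hom_closed[OF proj_hom])

lemma proj_sum':
  assumes "v \<in> carrier V" "finite A" "{n. \<pi> n v \<noteq> \<zero>} \<subseteq> A"
  shows "finsum V (\<lambda>n. \<pi> n v) A = v"
proof -
  have "finsum V (\<lambda>n. \<pi> n v) A = finsum V (\<lambda>n. \<pi> n v) {n. \<pi> n v \<noteq> \<zero>}"
    by (rule finsum_mono_neutral) (use assms in auto)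
  then show ?thesis using proj_sum[OF assms(1)] by simp
qed

lemma homogeneous_closed: "n \<in> I \<Longrightarrow> v \<in> W n \<Longrightarrow> v \<in> carrier V"
  by (rule subspace_closed(2)[OF W_subspace])

lemma subspace_eq_carrier:
  assumes S: "complex_subspace S V" and W: "\<And>n. n \<in> I \<Longrightarrow> W n \<subseteq> S"
  shows "S = carrier V"
proof (intro equalityI subsetI)
  fix v assume v: "v \<in> carrier V"
  have "\<pi> n v \<in> S" for n
    using W[of n] proj_in[of n v] proj_outside[of n v] v subspace_closed(1)[OF S]
    by (cases "n \<in> I") auto
  then have "finsum V (\<lambda>n. \<pi> n v) {n. \<pi> n v \<noteq> \<zero>} \<in> S" by (intro subspace_finsum[OF S])
  then show "v \<in> S" using proj_sum[OF v] by simp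
qed (rule subspace_closed(2)[OF S])

lemma hom_eqI:
  assumes "f \<in> module_hom complex_field V U" "g \<in> module_hom complex_field V U" "complex_space U"
    and eq: "\<And>n v. n \<in> I \<Longrightarrow> v \<in> W n \<Longrightarrow> f v = g v" and v: "v \<in> carrier V"
  shows "f v = g v"
proof -
  have "complex_subspace {v \<in> carrier V. f v = g v} V"
    unfolding complex_subspace_iff
    using module_homD[OF assms(1)] module_homD[OF assms(2)]
      hom_zero[OF assms(1) complex_space_axioms assms(3)]
      hom_zero[OF assms(2) complex_space_axioms assms(3)] by auto
  then have "{v \<in> carrier V. f v = g v} = carrier V"
    by (rule subspace_eq_carrier) (use eq homogeneous_closed in auto)
  then show ?thesis using v by auto
qed

lemma internal_direct_sum: "internal_direct_sum V I W"
  unfolding internal_direct_sum_def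
proof (intro conjI ballI)
  fix v assume v: "v \<in> carrier V"
  show "\<exists>!x. (\<forall>n\<in>I. x n \<in> W n) \<and> (\<forall>n. n \<notin> I \<longrightarrow> x n = \<zero>) \<and>
      finite {n. x n \<noteq> \<zero>} \<and> v = finsum V x {n. x n \<noteq> \<zero>}"
  proof (rule ex1I[of _ "\<lambda>n. \<pi> n v"])
    fix x assume x: "(\<forall>n\<in>I. x n \<in> W n) \<and> (\<forall>n. n \<notin> I \<longrightarrow> x n = \<zero>) \<and>
      finite {n. x n \<noteq> \<zero>} \<and> v = finsum V x {n. x n \<noteq> \<zero>}"
    then have xW: "\<And>n. n \<in> I \<Longrightarrow> x n \<in> W n" and x0: "\<And>n. n \<notin> I \<Longrightarrow> x n = \<zero>"
      and fin: "finite {n. x n \<noteq> \<zero>}" and v_eq: "v = finsum V x {n. x n \<noteq> \<zero>}" by auto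
    have xc: "x n \<in> carrier V" for n
      using xW[of n] x0[of n] homogeneous_closed[of n] by (cases "n \<in> I") auto
    show "x = (\<lambda>n. \<pi> n v)"
    proof
      fix m
      \<comment> \<open>The projection to \<open>m\<close> kills every summand except
        \<open>x m\<close>, so every decomposition of \<open>v\<close> has the components
        \<open>\<pi> m v\<close>.\<close>
      have "\<pi> m v = finsum V (\<lambda>n. \<pi> m (x n)) {n. x n \<noteq> \<zero>}"
        unfolding v_eq by (rule hom_finsum[OF proj_hom complex_space_axioms complex_space_axioms]) (rule xc)
      also have "\<dots> = x m"
      proof (rule vec_eqI)
        fix \<phi> assume \<phi>: "\<phi> \<in> dual_space V"
        have "\<pi> m (x n) = (if m = n then x n else \<zero>)" if "x n \<noteq> \<zero>" for n
        proof -
          have "n \<in> I" using x0[of n] that by blast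
          then show ?thesis using proj_homogeneous xW by simp
        qed
        then have "(\<Sum>n\<in>{n. x n \<noteq> \<zero>}. \<phi> (\<pi> m (x n))) = (\<Sum>n\<in>{n. x n \<noteq> \<zero>}. if m = n then \<phi> (x n) else 0)"
          using \<phi> by (intro sum.cong) (auto simp: dual_simps)
        also have "\<dots> = \<phi> (x m)" using fin \<phi> by (simp add: sum.delta dual_simps)
        finally show "\<phi> (finsum V (\<lambda>n. \<pi> m (x n)) {n. x n \<noteq> \<zero>}) = \<phi> (x m)"
          using \<phi> xc by (simp add: dual_finsum)
      qed (auto intro!: finsum_closed xc simp: xc)
      finally show "x m = \<pi> m v" by simp
    qed
  qed (use v proj_in proj_outside finite_support proj_sum in auto)
qed (rule W_subspace)

end

text \<open>Uniqueness makes the components of a vector functions of it, and makes these functions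
  linear: adding or scaling the components of given vectors yields a decomposition of the sum or the
  multiple.\<close>

lemma graded_space_of_internal_direct_sum:
  assumes V: "complex_space V" and sum: "internal_direct_sum V I W"
  shows "\<exists>\<pi>. graded_space V I W \<pi>"
proof -
  interpret complex_space V by (rule V)
  let ?P = "\<lambda>v x. (\<forall>n\<in>I. x n \<in> W n) \<and> (\<forall>n. n \<notin> I \<longrightarrow> x n = \<zero>\<^bsub>V\<^esub>) \<and>
      finite {n. x n \<noteq> \<zero>\<^bsub>V\<^esub>} \<and> v = finsum V x {n. x n \<noteq> \<zero>\<^bsub>V\<^esub>}"
  have W: "complex_subspace (W n) V" if "n \<in> I" for n
    using sum that by (simp add: internal_direct_sum_def)
  have ex1: "\<exists>!x. ?P v x" if "v \<in> carrier V" for v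
    using sum that unfolding internal_direct_sum_def by blast
  define \<pi> where "\<pi> n v = (THE x. ?P v x) n" for n v
  have P: "?P v (\<lambda>n. \<pi> n v)" if "v \<in> carrier V" for v
    using theI'[OF ex1[OF that]] unfolding \<pi>_def .
  have W_closed: "x \<in> carrier V" if "n \<in> I" "x \<in> W n" for n x
    using subspace_closed(2)[OF W[OF that(1)] that(2)] .
  \<comment> \<open>Any finite \<open>A\<close> containing the support is allowed: for a sum of two
    vectors the natural range is the union of their supports, and the support of the sum may be
    smaller.\<close>
  have uniq: "x = (\<lambda>n. \<pi> n v)"
    if "\<And>n. n \<in> I \<Longrightarrow> x n \<in> W n" "\<And>n. n \<notin> I \<Longrightarrow> x n = \<zero>\<^bsub>V\<^esub>" "finite A"
      "\<And>n. n \<notin> A \<Longrightarrow> x n = \<zero>\<^bsub>V\<^esub>" "v = finsum V x A" for x v A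
  proof -
    have xc: "x n \<in> carrier V" for n
      using that(1)[of n] that(2)[of n] W_closed[of n] by (cases "n \<in> I") auto
    have supp: "{n. x n \<noteq> \<zero>\<^bsub>V\<^esub>} \<subseteq> A" using that(4) by blast
    have "finsum V x A = finsum V x {n. x n \<noteq> \<zero>\<^bsub>V\<^esub>}"
      by (rule finsum_mono_neutral) (use that(3) supp xc in auto)
    then have "?P v x" using that finite_subset[OF supp that(3)] by auto
    moreover have v: "v \<in> carrier V" unfolding that(5) by (rule finsum_closed) (rule xc)
    ultimately have "(THE x. ?P v x) = x" by (intro the1_equality ex1)
    then show ?thesis unfolding \<pi>_def by simp
  qed
  have pc: "\<pi> n v \<in> carrier V" if "v \<in> carrier V" for n v
    using P[OF that] W_closed[of n] by (cases "n \<in> I") auto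
  have ext: "finsum V (\<lambda>n. \<pi> n v) A = v"
    if "v \<in> carrier V" "finite A" "{n. \<pi> n v \<noteq> \<zero>\<^bsub>V\<^esub>} \<subseteq> A" for v A
  proof -
    have "finsum V (\<lambda>n. \<pi> n v) A = finsum V (\<lambda>n. \<pi> n v) {n. \<pi> n v \<noteq> \<zero>\<^bsub>V\<^esub>}"
      by (rule finsum_mono_neutral) (use that pc in auto)
    then show ?thesis using P[OF that(1)] by simp
  qed
  have "graded_space V I W \<pi>"
  proof (intro graded_space.intro graded_space_axioms.intro V)
    fix n
    have "\<pi> n (x \<oplus>\<^bsub>V\<^esub> y) = \<pi> n x \<oplus>\<^bsub>V\<^esub> \<pi> n y" if xy: "x \<in> carrier V" "y \<in> carrier V" for x y
    proof -
      let ?A = "{n. \<pi> n x \<noteq> \<zero>\<^bsub>V\<^esub>} \<union> {n. \<pi> n y \<noteq> \<zero>\<^bsub>V\<^esub>}"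
      have fin: "finite ?A" using P[OF xy(1)] P[OF xy(2)] by simp
      have "(\<lambda>n. \<pi> n x \<oplus>\<^bsub>V\<^esub> \<pi> n y) = (\<lambda>n. \<pi> n (x \<oplus>\<^bsub>V\<^esub> y))"
      proof (rule uniq[of _ ?A])
        show "x \<oplus>\<^bsub>V\<^esub> y = finsum V (\<lambda>n. \<pi> n x \<oplus>\<^bsub>V\<^esub> \<pi> n y) ?A"
        proof (rule vec_eqI)
          fix \<phi> assume \<phi>: "\<phi> \<in> dual_space V"
          have "\<phi> (finsum V (\<lambda>n. \<pi> n x) ?A) = \<phi> x" "\<phi> (finsum V (\<lambda>n. \<pi> n y) ?A) = \<phi> y"
            using ext[OF xy(1) fin] ext[OF xy(2) fin] by auto
          then show "\<phi> (x \<oplus>\<^bsub>V\<^esub> y) = \<phi> (finsum V (\<lambda>n. \<pi> n x \<oplus>\<^bsub>V\<^esub> \<pi> n y) ?A)"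
            using \<phi> xy pc by (simp add: dual_simps dual_finsum sum.distrib)
        qed (use xy pc in \<open>auto intro!: finsum_closed\<close>)
      qed (use fin P[OF xy(1)] P[OF xy(2)] W subspace_closed(3) in auto)
      then show ?thesis by (rule fun_cong[of _ _ n, symmetric])
    qed
    moreover have "\<pi> n (c \<odot>\<^bsub>V\<^esub> x) = c \<odot>\<^bsub>V\<^esub> \<pi> n x" if x: "x \<in> carrier V" for c x
    proof -
      have "(\<lambda>n. c \<odot>\<^bsub>V\<^esub> \<pi> n x) = (\<lambda>n. \<pi> n (c \<odot>\<^bsub>V\<^esub> x))"
      proof (rule uniq[of _ "{n. \<pi> n x \<noteq> \<zero>\<^bsub>V\<^esub>}"])
        show "c \<odot>\<^bsub>V\<^esub> x = finsum V (\<lambda>n. c \<odot>\<^bsub>V\<^esub> \<pi> n x) {n. \<pi> n x \<noteq> \<zero>\<^bsub>V\<^esub>}"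
        proof (rule vec_eqI)
          fix \<phi> assume \<phi>: "\<phi> \<in> dual_space V"
          have "\<phi> (finsum V (\<lambda>n. \<pi> n x) {n. \<pi> n x \<noteq> \<zero>\<^bsub>V\<^esub>}) = \<phi> x" using P[OF x] by simp
          then show "\<phi> (c \<odot>\<^bsub>V\<^esub> x) = \<phi> (finsum V (\<lambda>n. c \<odot>\<^bsub>V\<^esub> \<pi> n x) {n. \<pi> n x \<noteq> \<zero>\<^bsub>V\<^esub>})"
            using \<phi> x pc by (simp add: dual_simps dual_finsum sum_distrib_left[symmetric])
        qed (use x pc in \<open>auto intro!: finsum_closed\<close>)
      qed (use P[OF x] W subspace_closed(4) in auto)
      then show ?thesis by (rule fun_cong[of _ _ n, symmetric])
    qed
    ultimately show "\<pi> n \<in> module_hom complex_field V V"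
      using pc unfolding module_hom_iff by simp
  next
    fix n m v assume *: "n \<in> I" "v \<in> W n"
    have "(\<lambda>m. if m = n then v else \<zero>\<^bsub>V\<^esub>) = (\<lambda>m. \<pi> m v)"
    proof (rule uniq[of _ "{n}"])
      interpret complex_vs V by (rule complex_vs)
      show "v = (\<Oplus>\<^bsub>V\<^esub>m\<in>{n}. if m = n then v else \<zero>\<^bsub>V\<^esub>)"
        using W_closed[OF *] by (subst finsum_insert) simp_all
    qed (use * subspace_closed(1)[OF W] in auto)
    then show "\<pi> m v = (if m = n then v else \<zero>\<^bsub>V\<^esub>)"
      by (rule fun_cong[of _ _ m, symmetric])
  next
    fix v assume v: "v \<in> carrier V"
    show "finsum V (\<lambda>n. \<pi> n v) {n. \<pi> n v \<noteq> \<zero>\<^bsub>V\<^esub>} = v" using P[OF v] by simp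
    show "finite {n. \<pi> n v \<noteq> \<zero>\<^bsub>V\<^esub>}" using P[OF v] by simp
    show "n \<in> I \<Longrightarrow> \<pi> n v \<in> W n" for n using P[OF v] by simp
    show "n \<notin> I \<Longrightarrow> \<pi> n v = \<zero>\<^bsub>V\<^esub>" for n using P[OF v] by simp
  qed (rule W)
  then show ?thesis by (rule exI[of _ \<pi>])
qed

section \<open>Weights of \<open>(\<gg>, K)\<close>-modules\<close>

lemmas mat2_simps = vec_eq_iff forall_2 matrix_matrix_mult_def sum_2 vector_2 mat_def

lemma generators_in_sl2 [simp]: "H_mat \<in> sl2" "X_mat \<in> sl2" "Y_mat \<in> sl2"
  by (simp_all add: sl2_def trace_def H_mat_def X_mat_def Y_mat_def mat2_simps)

lemma sl2_closed: "Z \<in> sl2 \<Longrightarrow> Z' \<in> sl2 \<Longrightarrow> Z + Z' \<in> sl2" "Z \<in> sl2 \<Longrightarrow> mat c ** Z \<in> sl2"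
  by (simp_all add: sl2_def trace_def mat2_simps algebra_simps flip: distrib_left)

lemma generator_brackets:
  "H_mat ** X_mat - X_mat ** H_mat = mat 2 ** X_mat"
  "H_mat ** Y_mat - Y_mat ** H_mat = mat (-2) ** Y_mat"
  "X_mat ** Y_mat - Y_mat ** X_mat = H_mat"
  by (simp_all add: H_mat_def X_mat_def Y_mat_def mat2_simps)

text \<open>Coordinates with respect to \<open>H_mat\<close>, \<open>X_mat\<close>,
  \<open>Y_mat\<close>. If \<open>h H + x X + y Y\<close> has first row \<open>p, q\<close> and
  lower left entry \<open>r\<close>, then \<open>p = (x + y) / 2\<close>,
  \<open>q - r = - 2 i h\<close> and \<open>q + r = i (x - y)\<close>; these three equations are
  solved for \<open>h\<close>, \<open>x\<close>, \<open>y\<close>.\<close>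

definition H_coeff :: "complex^2^2 \<Rightarrow> complex" where
  "H_coeff Z = \<i> / 2 * (Z $ 1 $ 2 - Z $ 2 $ 1)"

definition X_coeff :: "complex^2^2 \<Rightarrow> complex" where
  "X_coeff Z = Z $ 1 $ 1 - \<i> / 2 * (Z $ 1 $ 2 + Z $ 2 $ 1)"

definition Y_coeff :: "complex^2^2 \<Rightarrow> complex" where
  "Y_coeff Z = Z $ 1 $ 1 + \<i> / 2 * (Z $ 1 $ 2 + Z $ 2 $ 1)"

lemmas coeff_defs = H_coeff_def X_coeff_def Y_coeff_def

lemma sl2_decomposition:
  assumes "Z \<in> sl2"
  shows "Z = mat (H_coeff Z) ** H_mat + mat (X_coeff Z) ** X_mat + mat (Y_coeff Z) ** Y_mat"
proof -
  have "Z $ 2 $ 2 = - Z $ 1 $ 1"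
    using assms by (simp add: sl2_def trace_def sum_2 eq_neg_iff_add_eq_0 add.commute)
  then show ?thesis
    by (simp add: coeff_defs H_mat_def X_mat_def Y_mat_def mat2_simps algebra_simps
        add_divide_distrib diff_divide_distrib)
qed

lemma rot_0: "rot 0 = mat 1"
  by (simp add: rot_def mat2_simps)

lemma rot_add: "rot (a + b) = rot a ** rot b"
  by (simp add: rot_def mat2_simps cos_add sin_add algebra_simps)

lemma rot_in_SO2 [simp]: "rot \<theta> \<in> SO2"
  by (simp add: SO2_def orthogonal_matrix_def rot_def det_2 transpose_def mat2_simps
      power2_eq_square[symmetric] algebra_simps)

lemma SO2_eq_range_rot: "SO2 = range rot"
proof (intro equalityI subsetI)
  fix k assume "k \<in> SO2"
  then have o: "transpose k ** k = mat 1" and d: "det k = 1"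
    by (auto simp: SO2_def orthogonal_matrix_def)
  let ?a = "k $ 1 $ 1" and ?b = "k $ 1 $ 2" and ?c = "k $ 2 $ 1" and ?d = "k $ 2 $ 2"
  have o': "?a^2 + ?c^2 = 1" "?a * ?b + ?c * ?d = 0" "?b^2 + ?d^2 = 1" "?a * ?d - ?b * ?c = 1"
    using o d by (auto simp: transpose_def det_2 mat2_simps power2_eq_square)
  \<comment> \<open>The left side is the sum of the squares of all entries minus twice the
    determinant, that is \<open>2 - 2\<close>.\<close>
  have "(?a - ?d)^2 + (?b + ?c)^2 = 0"
    using o' by (simp add: power2_eq_square algebra_simps)
  then have "?d = ?a" "?c = - ?b"
    by (auto simp: sum_power2_eq_zero_iff)
  moreover have "?a^2 + ?b^2 = 1" using o' calculation by simp
  then obtain \<theta> where "?a = cos \<theta>" "?b = sin \<theta>"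
    using sincos_total_2pi by metis
  ultimately have "k = rot \<theta>" by (simp add: rot_def mat2_simps)
  then show "k \<in> range rot" by blast
qed auto

lemma matrix_inv_rot: "matrix_inv (rot \<theta>) = rot (- \<theta>)"
  unfolding matrix_inv_def
proof (rule some_equality)
  show inv: "rot \<theta> ** rot (- \<theta>) = mat 1 \<and> rot (- \<theta>) ** rot \<theta> = mat 1"
    by (simp flip: rot_add add: rot_0)
  fix A assume "rot \<theta> ** A = mat 1 \<and> A ** rot \<theta> = mat 1"
  then have "A ** (rot \<theta> ** rot (- \<theta>)) = rot (- \<theta>)" by (simp add: matrix_mul_assoc)
  then show "A = rot (- \<theta>)" using inv by simp
qed

text \<open>Since \<open>rot \<theta>\<close> is the exponential of \<open>\<theta>\<close> times
  \<open>i H\<close>, an eigenvector of the bracket with \<open>H\<close> of eigenvalue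
  \<open>j\<close> is multiplied by \<open>exp (i j \<theta>)\<close>; here \<open>j\<close> is 0, 2
  and -2.\<close>

lemma Ad_rot_generators:
  "Ad (rot \<theta>) H_mat = H_mat"
  "Ad (rot \<theta>) X_mat = mat (cis (2 * \<theta>)) ** X_mat"
  "Ad (rot \<theta>) Y_mat = mat (cis (- 2 * \<theta>)) ** Y_mat"
proof -
  define c s :: complex where "c = of_real (cos \<theta>)" and "s = of_real (sin \<theta>)"
  have cs: "c * c + s * s = 1"
    unfolding c_def s_def using sin_cos_squared_add2[of \<theta>]
    by (simp add: power2_eq_square flip: of_real_mult of_real_add)
  have cis: "cis (2 * \<theta>) = c * c - s * s + 2 * \<i> * c * s" "cis (- 2 * \<theta>) = c * c - s * s - 2 * \<i> * c * s"
    by (simp_all add: c_def s_def complex_eq_iff cos_double sin_double power2_eq_square)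
  have rot: "map_matrix of_real (rot \<theta>) = (vector [vector [c, s], vector [- s, c]] :: complex^2^2)"
    "map_matrix of_real (rot (- \<theta>)) = (vector [vector [c, - s], vector [s, c]] :: complex^2^2)"
    by (simp_all add: rot_def map_matrix_def c_def s_def mat2_simps)
  have "\<i> * (c * c) + \<i> * (s * s) = \<i>" using cs by (simp flip: distrib_left)
  then show "Ad (rot \<theta>) H_mat = H_mat"
    unfolding Ad_def matrix_inv_rot rot
    by (simp add: H_mat_def mat2_simps algebra_simps)
  show "Ad (rot \<theta>) X_mat = mat (cis (2 * \<theta>)) ** X_mat"
    "Ad (rot \<theta>) Y_mat = mat (cis (- 2 * \<theta>)) ** Y_mat"
    unfolding Ad_def matrix_inv_rot rot cis
    by (simp_all add: X_mat_def Y_mat_def mat2_simps algebra_simps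
        add_divide_distrib diff_divide_distrib)
qed

lemma coeff_combination:
  "H_coeff (mat a ** H_mat + mat b ** X_mat + mat c ** Y_mat) = a"
  "X_coeff (mat a ** H_mat + mat b ** X_mat + mat c ** Y_mat) = b"
  "Y_coeff (mat a ** H_mat + mat b ** X_mat + mat c ** Y_mat) = c"
  by (simp_all add: coeff_defs H_mat_def X_mat_def Y_mat_def mat2_simps algebra_simps)

lemma coeff_add:
  "H_coeff (Z + Z') = H_coeff Z + H_coeff Z'" "X_coeff (Z + Z') = X_coeff Z + X_coeff Z'"
  "Y_coeff (Z + Z') = Y_coeff Z + Y_coeff Z'"
  by (simp_all add: coeff_defs algebra_simps)

lemma coeff_scale:
  "H_coeff (mat c ** Z) = c * H_coeff Z" "X_coeff (mat c ** Z) = c * X_coeff Z"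
  "Y_coeff (mat c ** Z) = c * Y_coeff Z"
  by (simp_all add: coeff_defs mat2_simps algebra_simps)

lemma coeff_generators [simp]:
  "H_coeff H_mat = 1" "X_coeff H_mat = 0" "Y_coeff H_mat = 0"
  "H_coeff X_mat = 0" "X_coeff X_mat = 1" "Y_coeff X_mat = 0"
  "H_coeff Y_mat = 0" "X_coeff Y_mat = 0" "Y_coeff Y_mat = 1"
  by (simp_all add: coeff_defs H_mat_def X_mat_def Y_mat_def mat2_simps algebra_simps)

text \<open>The structure constants \<open>[H, X] = 2 X\<close>, \<open>[H, Y] = - 2 Y\<close>,
  \<open>[X, Y] = H\<close> in coordinates. They serve to verify the bracket axiom for the
  realization.\<close>

lemma coeff_bracket:
  assumes "Z \<in> sl2" "Z' \<in> sl2"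
  shows "H_coeff (Z ** Z' - Z' ** Z) = X_coeff Z * Y_coeff Z' - Y_coeff Z * X_coeff Z'"
    "X_coeff (Z ** Z' - Z' ** Z) = 2 * (H_coeff Z * X_coeff Z' - X_coeff Z * H_coeff Z')"
    "Y_coeff (Z ** Z' - Z' ** Z) = 2 * (Y_coeff Z * H_coeff Z' - H_coeff Z * Y_coeff Z')"
proof -
  have "Z $ 2 $ 2 = - Z $ 1 $ 1" "Z' $ 2 $ 2 = - Z' $ 1 $ 1"
    using assms by (simp_all add: sl2_def trace_def sum_2 eq_neg_iff_add_eq_0 add.commute)
  then show "H_coeff (Z ** Z' - Z' ** Z) = X_coeff Z * Y_coeff Z' - Y_coeff Z * X_coeff Z'"
    "X_coeff (Z ** Z' - Z' ** Z) = 2 * (H_coeff Z * X_coeff Z' - X_coeff Z * H_coeff Z')"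
    "Y_coeff (Z ** Z' - Z' ** Z) = 2 * (Y_coeff Z * H_coeff Z' - H_coeff Z * Y_coeff Z')"
    by (simp_all add: coeff_defs mat2_simps algebra_simps)
qed

lemma Ad_linear: "Ad k (Z + Z') = Ad k Z + Ad k Z'" "Ad k (mat c ** Z) = mat c ** Ad k Z"
  unfolding Ad_def by (simp_all add: mat2_simps algebra_simps)

lemma Ad_rot_coeff:
  assumes "Z \<in> sl2"
  shows "H_coeff (Ad (rot \<theta>) Z) = H_coeff Z"
    "X_coeff (Ad (rot \<theta>) Z) = cis (2 * \<theta>) * X_coeff Z"
    "Y_coeff (Ad (rot \<theta>) Z) = cis (- 2 * \<theta>) * Y_coeff Z"
proof -
  have "Ad (rot \<theta>) Z = mat (H_coeff Z) ** H_mat + mat (cis (2 * \<theta>) * X_coeff Z) ** X_mat +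
      mat (cis (- 2 * \<theta>) * Y_coeff Z) ** Y_mat"
    by (subst sl2_decomposition[OF assms])
      (simp only: Ad_linear Ad_rot_generators, simp add: mat2_simps algebra_simps)
  then show "H_coeff (Ad (rot \<theta>) Z) = H_coeff Z"
    "X_coeff (Ad (rot \<theta>) Z) = cis (2 * \<theta>) * X_coeff Z"
    "Y_coeff (Ad (rot \<theta>) Z) = cis (- 2 * \<theta>) * Y_coeff Z"
    by (simp_all only: coeff_combination)
qed

text \<open>From \<open>X Y - Y X = H\<close> one gets
  \<open>C + 1 = (H - 1)^2 + 4 X Y = (H + 1)^2 + 4 Y X\<close>. After division by 4,
  \<open>X Y\<close> and \<open>Y X\<close> differ from this operator by the square of a scalar on
  each weight space.\<close>

definition shifted_casimir :: "'u gk_module \<Rightarrow> 'u \<Rightarrow> 'u" where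
  "shifted_casimir M v = (1/4) \<odot>\<^bsub>M\<^esub> (casimir M v \<oplus>\<^bsub>M\<^esub> v)"

section \<open>The Casimir operator, weight vectors and the action of \<open>K\<close> on
  them\<close>

context gk_mod
begin

sublocale complex_space M by (rule complex_space.intro) (rule vs)

abbreviation "H \<equiv> gact M H_mat"
abbreviation "X \<equiv> gact M X_mat"
abbreviation "Y \<equiv> gact M Y_mat"

lemma gact_closed [simp]: "Z \<in> sl2 \<Longrightarrow> v \<in> carrier M \<Longrightarrow> gact M Z v \<in> carrier M"
  by (rule hom_closed[OF gact_linear])

lemma kact_closed [simp]: "k \<in> SO2 \<Longrightarrow> v \<in> carrier M \<Longrightarrow> kact M k v \<in> carrier M"
  by (rule hom_closed[OF kact_linear])

lemma gact_hom:
  assumes "Z \<in> sl2"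
  shows "v \<in> carrier M \<Longrightarrow> w \<in> carrier M \<Longrightarrow> gact M Z (v \<oplus> w) = gact M Z v \<oplus> gact M Z w"
    "v \<in> carrier M \<Longrightarrow> w \<in> carrier M \<Longrightarrow> gact M Z (v \<ominus> w) = gact M Z v \<ominus> gact M Z w"
    "v \<in> carrier M \<Longrightarrow> gact M Z (c \<odot> v) = c \<odot> gact M Z v"
    "gact M Z \<zero> = \<zero>"
  using module_homD[OF gact_linear[OF assms]]
    hom_minus[OF gact_linear[OF assms] complex_space_axioms complex_space_axioms]
    hom_zero[OF gact_linear[OF assms] complex_space_axioms complex_space_axioms] by auto

lemma gact_eq:
  assumes "Z \<in> sl2" "v \<in> carrier M"
  shows "gact M Z v = H_coeff Z \<odot> H v \<oplus> X_coeff Z \<odot> X v \<oplus> Y_coeff Z \<odot> Y v"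
  by (subst sl2_decomposition[OF assms(1)]) (simp add: gact_add gact_scale sl2_closed assms(2))

text \<open>Oriented as rewrite rules that bring words in the generators to the order X, Y, H.
  Relations in the enveloping algebra, such as the centrality of the Casimir element, then follow by
  normalization.\<close>

lemma commutation:
  assumes "v \<in> carrier M"
  shows "H (X v) = X (H v) \<oplus> 2 \<odot> X v" "H (Y v) = Y (H v) \<ominus> 2 \<odot> Y v"
    "Y (X v) = X (Y v) \<ominus> H v"
proof -
  note br = gact_bracket[OF _ _ assms]
  have *: "2 \<odot> X v = H (X v) \<ominus> X (H v)" "(-2) \<odot> Y v = H (Y v) \<ominus> Y (H v)"
    "H v = X (Y v) \<ominus> Y (X v)"
    using br[of H_mat X_mat] br[of H_mat Y_mat] br[of X_mat Y_mat] assms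
    by (simp_all add: generator_brackets gact_scale)
  show "H (X v) = X (H v) \<oplus> 2 \<odot> X v" unfolding *(1)
    by (rule vec_eqI) (simp_all add: assms dual_simps)
  show "Y (X v) = X (Y v) \<ominus> H v" unfolding *(3)
    by (rule vec_eqI) (simp_all add: assms dual_simps)
  have "H (Y v) = Y (H v) \<oplus> (-2) \<odot> Y v" unfolding *(2)
    by (rule vec_eqI) (simp_all add: assms dual_simps)
  also have "\<dots> = Y (H v) \<ominus> 2 \<odot> Y v"
    by (rule vec_eqI) (simp_all add: assms dual_simps)
  finally show "H (Y v) = Y (H v) \<ominus> 2 \<odot> Y v" .
qed

abbreviation "T \<equiv> shifted_casimir M"

lemma T_hom: "T \<in> module_hom complex_field M M"
  unfolding module_hom_iff
proof (intro conjI ballI allI)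
  fix x y c assume [simp]: "x \<in> carrier M" "y \<in> carrier M"
  show "T x \<in> carrier M" by (simp add: shifted_casimir_def casimir_def)
  show "T (x \<oplus> y) = T x \<oplus> T y" "T (c \<odot> x) = c \<odot> T x"
    by (rule vec_eqI; simp add: shifted_casimir_def casimir_def gact_hom dual_simps algebra_simps)+
qed

lemma T_closed [simp]: "v \<in> carrier M \<Longrightarrow> T v \<in> carrier M"
  by (rule hom_closed[OF T_hom])

lemma T_commutes:
  assumes [simp]: "v \<in> carrier M"
  shows "T (H v) = H (T v)" "T (X v) = X (T v)" "T (Y v) = Y (T v)"
  by (rule vec_eqI; simp add: shifted_casimir_def casimir_def gact_hom commutation dual_simps algebra_simps)+

lemma T_gact: "Z \<in> sl2 \<Longrightarrow> v \<in> carrier M \<Longrightarrow> T (gact M Z v) = gact M Z (T v)"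
  by (simp add: gact_eq[of Z v] gact_eq[of Z "T v"] T_commutes module_homD[OF T_hom])

lemma weight_space_iff: "v \<in> weight_space M n \<longleftrightarrow> v \<in> carrier M \<and> H v = of_int n \<odot> v"
  by (simp add: weight_space_def)

lemma weight_closed [simp]: "v \<in> weight_space M n \<Longrightarrow> v \<in> carrier M"
  by (simp add: weight_space_iff)

lemma weight_space_subspace: "complex_subspace (weight_space M n) M"
  unfolding complex_subspace_iff weight_space_iff
proof (intro conjI ballI allI)
  fix x y c assume "x \<in> weight_space M n" "y \<in> weight_space M n"
  then have [simp]: "x \<in> carrier M" "y \<in> carrier M" "H x = of_int n \<odot> x" "H y = of_int n \<odot> y"
    by (auto simp: weight_space_iff)
  show "H (x \<oplus> y) = of_int n \<odot> (x \<oplus> y)" "H (c \<odot> x) = of_int n \<odot> (c \<odot> x)"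
    by (rule vec_eqI; simp add: gact_hom dual_simps algebra_simps)+
qed (auto simp: gact_hom weight_space_iff)

lemma weight_shift:
  assumes "v \<in> weight_space M n"
  shows X_weight: "X v \<in> weight_space M (n + 2)" and Y_weight: "Y v \<in> weight_space M (n - 2)"
    and T_weight: "T v \<in> weight_space M n"
proof -
  from assms have [simp]: "v \<in> carrier M" "H v = of_int n \<odot> v" by (auto simp: weight_space_iff)
  have "H (X v) = of_int (n + 2) \<odot> X v" "H (Y v) = of_int (n - 2) \<odot> Y v"
    by (rule vec_eqI; simp add: commutation gact_hom dual_simps algebra_simps)+
  then show "X v \<in> weight_space M (n + 2)" "Y v \<in> weight_space M (n - 2)"
    by (simp_all add: weight_space_iff)
  show "T v \<in> weight_space M n"
    by (simp add: weight_space_iff flip: T_commutes) (simp add: module_homD[OF T_hom])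
qed

lemma XY_weight:
  assumes "v \<in> weight_space M n"
  shows "X (Y v) = T v \<ominus> ((of_int n - 1) / 2)\<^sup>2 \<odot> v" "Y (X v) = T v \<ominus> ((of_int n + 1) / 2)\<^sup>2 \<odot> v"
proof -
  from assms have [simp]: "v \<in> carrier M" "H v = of_int n \<odot> v" by (auto simp: weight_space_iff)
  show "X (Y v) = T v \<ominus> ((of_int n - 1) / 2)\<^sup>2 \<odot> v" "Y (X v) = T v \<ominus> ((of_int n + 1) / 2)\<^sup>2 \<odot> v"
    by (rule vec_eqI; simp add: shifted_casimir_def casimir_def commutation gact_hom dual_simps
        power2_eq_square algebra_simps add_divide_distrib diff_divide_distrib)+
qed

text \<open>The matrix coefficients of the one-parameter group \<open>rot\<close> on a vector of weight \<open>n\<close> solve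
  \<open>g' = i n g\<close>.\<close>

lemma kact_rot_weight:
  assumes v: "v \<in> weight_space M n"
  shows "kact M (rot \<theta>) v = exp (\<i> * of_int n * of_real \<theta>) \<odot> v"
proof (rule vec_eqI)
  from v have vc [simp]: "v \<in> carrier M" and Hv: "H v = of_int n \<odot> v" by (auto simp: weight_space_iff)
  fix \<phi> assume \<phi>: "\<phi> \<in> dual_space M"
  define g where "g t = \<phi> (kact M (rot t) v)" for t
  have g': "(g has_vector_derivative \<i> * of_int n * g t) (at t)" for t
  proof -
    \<comment> \<open>\<open>differential\<close> describes the derivative at 0 only. Composing the
      functional with \<open>rot t\<close> moves it to \<open>t\<close>, because
      \<open>rot (t + h) = rot t ** rot h\<close>.\<close>
    let ?\<psi> = "\<lambda>x. \<phi> (kact M (rot t) x)"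
    have \<psi>: "?\<psi> \<in> dual_space M" by (rule hom_comp_dual[OF kact_linear \<phi>]) simp
    have "((\<lambda>h. ?\<psi> (kact M (rot h) v)) has_vector_derivative ?\<psi> (gact M (mat \<i> ** H_mat) v)) (at 0)"
      by (rule differential[OF vc \<psi>])
    moreover have "?\<psi> (gact M (mat \<i> ** H_mat) v) = \<i> * of_int n * g t"
      using dual_simps(2)[OF \<psi>] by (simp add: gact_scale Hv g_def)
    moreover have "?\<psi> (kact M (rot h) v) = g (t + h)" for h
      by (simp add: g_def rot_add kact_mult)
    ultimately have "((\<lambda>h. g (t + h)) has_vector_derivative \<i> * of_int n * g t) (at (t - t))" by simp
    then have "((\<lambda>h. g (t + h)) \<circ> (\<lambda>s. s - t) has_vector_derivative 1 *\<^sub>R (\<i> * of_int n * g t)) (at t)"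
      by (intro vector_diff_chain_at) (auto intro!: derivative_eq_intros)
    then show ?thesis by (simp add: o_def)
  qed
  \<comment> \<open>The integrating factor: \<open>g * e\<close> has derivative 0, hence is
    constant.\<close>
  define e where "e t = exp (- (\<i> * of_int n) * of_real t)" for t :: real
  have e': "(e has_vector_derivative - (\<i> * of_int n) * e t) (at t)" for t
    unfolding e_def by (rule has_vector_derivative_real_field) (auto intro!: derivative_eq_intros)
  have "((\<lambda>t. g t * e t) has_vector_derivative 0) (at t within UNIV)" for t
    using has_vector_derivative_mult[OF g' e', of t] by (simp add: algebra_simps)
  note deriv0 = this
  obtain c where c: "\<And>t. g t * e t = c"
  proof (rule has_vector_derivative_zero_constant[OF convex_UNIV])
    fix c assume "\<And>t. t \<in> UNIV \<Longrightarrow> g t * e t = c"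
    then show thesis by (intro that[of c]) simp
  qed (rule deriv0)
  have "g \<theta> * e \<theta> = g 0" using c[of \<theta>] c[of 0] by (simp add: e_def)
  moreover have "g 0 = \<phi> v" by (simp add: g_def rot_0 kact_one)
  moreover have "e \<theta> * exp (\<i> * of_int n * of_real \<theta>) = 1"
    by (simp add: e_def flip: exp_add)
  moreover have "g \<theta> * (e \<theta> * exp (\<i> * of_int n * of_real \<theta>)) = g \<theta> * e \<theta> * exp (\<i> * of_int n * of_real \<theta>)"
    by (rule mult.assoc[symmetric])
  ultimately have "g \<theta> = exp (\<i> * of_int n * of_real \<theta>) * \<phi> v"
    by (simp add: mult.commute)
  then show "\<phi> (kact M (rot \<theta>) v) = \<phi> (exp (\<i> * of_int n * of_real \<theta>) \<odot> v)"
    using \<phi> by (simp add: g_def dual_simps)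
qed (use v in auto)

end

section \<open>Modules over \<open>\<BB>\<close>\<close>

text \<open>If the family is injective, its set of values has more elements than the dimension. If
  not, that set may well be independent, but a repetition \<open>f i = f j\<close> gives the
  coefficients 1 and -1.\<close>

lemma (in complex_space) linearly_dependent_family:
  fixes f :: "nat \<Rightarrow> 'u"
  assumes fd: "finite_dimensional V" and f: "\<And>i. f i \<in> carrier V"
  shows "\<exists>c::nat \<Rightarrow> complex. (\<exists>i\<le>vectorspace.dim complex_field V. c i \<noteq> 0) \<and>
    finsum V (\<lambda>i. c i \<odot> f i) {..vectorspace.dim complex_field V} = \<zero>"
proof -
  interpret vs: complex_vs V by (rule complex_vs)
  let ?d = "vs.dim"
  show ?thesis
  proof (cases "inj_on f {..?d}")
    case False
    then obtain i j where ij: "i \<le> ?d" "j \<le> ?d" "i \<noteq> j" "f i = f j" by (auto simp: inj_on_def)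
    define c where "c k = (if k = i then 1 else if k = j then -1 else (0::complex))" for k
    have "finsum V (\<lambda>k. c k \<odot> f k) {..?d} = \<zero>"
    proof (rule vec_eqI)
      fix \<phi> assume \<phi>: "\<phi> \<in> dual_space V"
      have "(\<Sum>k\<le>?d. c k * \<phi> (f k)) = (\<Sum>k\<in>{i, j}. c k * \<phi> (f k))"
        by (rule sum.mono_neutral_right) (use ij in \<open>auto simp: c_def\<close>)
      also have "\<dots> = 0" using ij by (simp add: c_def)
      finally show "\<phi> (finsum V (\<lambda>k. c k \<odot> f k) {..?d}) = \<phi> \<zero>"
        using \<phi> f by (simp add: dual_finsum dual_simps)
    qed (auto intro!: finsum_closed f)
    moreover have "c i \<noteq> 0" by (simp add: c_def)
    ultimately show ?thesis using ij by (intro exI[of _ c] conjI exI[of _ i])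
  next
    case True
    let ?A = "f ` {..?d}"
    have card: "card ?A = ?d + 1" using True by (simp add: card_image)
    have A: "finite ?A" "?A \<subseteq> carrier V" using f by auto
    have "vs.lin_dep ?A"
      using vs.li_le_dim(2)[OF fd A(2)] card by linarith
    then obtain a v where a: "vs.lincomb a ?A = \<zero>" "v \<in> ?A" "a v \<noteq> 0"
      using vs.finite_lin_dep[OF A(1) _ A(2)] by auto
    have "finsum V (\<lambda>k. a (f k) \<odot> f k) {..?d} = vs.lincomb a ?A"
    proof (rule vec_eqI)
      fix \<phi> assume \<phi>: "\<phi> \<in> dual_space V"
      show "\<phi> (finsum V (\<lambda>k. a (f k) \<odot> f k) {..?d}) = \<phi> (vs.lincomb a ?A)"
        unfolding vs.lincomb_def using \<phi> f A
        by (subst (1 2) dual_finsum) (auto simp: sum.reindex[OF True])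
    qed (use a f in \<open>auto intro!: finsum_closed\<close>)
    then show ?thesis using a by (intro exI[of _ "\<lambda>k. a (f k)"]) auto
  qed
qed

section \<open>The ring \<open>B_ring\<close> and its generators\<close>

lemma mat_fps_simps:
  "mat (p + q) = mat p + (mat q :: B_elem)" "mat (p * q) = mat p ** (mat q :: B_elem)"
  "mat p ** P = (P :: B_elem) ** (mat p :: B_elem)"
  by (simp_all add: mat2_simps mult.commute)

lemma B_ring_simps [simp]:
  "P \<oplus>\<^bsub>B_ring\<^esub> Q = P + Q" "P \<otimes>\<^bsub>B_ring\<^esub> Q = P ** Q" "\<one>\<^bsub>B_ring\<^esub> = mat 1" "\<zero>\<^bsub>B_ring\<^esub> = 0"
  by (simp_all add: B_ring_def)

lemma B_ring_carrier: "P \<in> carrier B_ring \<longleftrightarrow> fps_X dvd P $ 1 $ 2"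
  by (simp add: B_ring_def)

abbreviation E11 :: B_elem where "E11 \<equiv> matrix_unit 1 1"
abbreviation E22 :: B_elem where "E22 \<equiv> matrix_unit 2 2"
abbreviation E21 :: B_elem where "E21 \<equiv> matrix_unit 2 1"
abbreviation tE12 :: B_elem where "tE12 \<equiv> mat fps_X ** matrix_unit 1 2"

lemma B_closed [simp]:
  "mat p \<in> carrier B_ring" "E11 \<in> carrier B_ring" "E22 \<in> carrier B_ring" "E21 \<in> carrier B_ring"
  "tE12 \<in> carrier B_ring" "0 \<in> carrier B_ring"
  "P \<in> carrier B_ring \<Longrightarrow> Q \<in> carrier B_ring \<Longrightarrow> P + Q \<in> carrier B_ring"
  "P \<in> carrier B_ring \<Longrightarrow> Q \<in> carrier B_ring \<Longrightarrow> P - Q \<in> carrier B_ring"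
  "P \<in> carrier B_ring \<Longrightarrow> Q \<in> carrier B_ring \<Longrightarrow> P ** Q \<in> carrier B_ring"
  by (auto simp: B_ring_carrier matrix_unit_def mat2_simps intro: dvd_add dvd_diff)

lemma B_unit_products:
  "E11 ** E11 = E11" "E22 ** E22 = E22" "E11 ** E22 = 0" "E22 ** E11 = 0"
  "E21 ** E11 = E21" "E22 ** E21 = E21" "tE12 ** E22 = tE12" "E11 ** tE12 = tE12"
  "E11 ** E21 = 0" "E21 ** E22 = 0" "E22 ** tE12 = 0" "tE12 ** E11 = 0"
  "E21 ** tE12 = mat fps_X ** E22" "tE12 ** E21 = mat fps_X ** E11" "E11 + E22 = mat 1"
  by (simp_all add: matrix_unit_def mat2_simps)

text \<open>For elements of the ring the upper right entry can be divided by \<open>t\<close>, which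
  is what \<open>fps_shift 1\<close> does. So the two diagonal idempotents and the two arrows
  generate the ring over the scalar power series.\<close>

lemma B_generators:
  assumes "P \<in> carrier B_ring"
  shows "P = mat (P $ 1 $ 1) ** E11 + mat (fps_shift 1 (P $ 1 $ 2)) ** tE12 +
    mat (P $ 2 $ 1) ** E21 + mat (P $ 2 $ 2) ** E22"
proof -
  obtain q where "P $ 1 $ 2 = fps_X * q" using assms by (auto simp: B_ring_carrier)
  then have "fps_shift 1 (P $ 1 $ 2) * fps_X = P $ 1 $ 2"
    by (simp add: mult.commute[of fps_X] del: One_nat_def)
  then show ?thesis by (simp add: matrix_unit_def mat2_simps)
qed

section \<open>Modules over \<open>B_ring\<close> and the nilpotence of \<open>t\<close>\<close>

locale B_module = left_module B_ring V for V :: "(B_elem, 'u) module" (structure)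
begin

lemma act_closed [simp]: "P \<in> carrier B_ring \<Longrightarrow> x \<in> carrier V \<Longrightarrow> P \<odot> x \<in> carrier V"
  by (rule smult_closed)

lemma act_add_left:
  "\<lbrakk>P \<in> carrier B_ring; Q \<in> carrier B_ring; x \<in> carrier V\<rbrakk> \<Longrightarrow> (P + Q) \<odot> x = P \<odot> x \<oplus> Q \<odot> x"
  using smult_l_distr[of P Q x] by simp

lemma act_add_right:
  "\<lbrakk>P \<in> carrier B_ring; x \<in> carrier V; y \<in> carrier V\<rbrakk> \<Longrightarrow> P \<odot> (x \<oplus> y) = P \<odot> x \<oplus> P \<odot> y"
  by (rule smult_r_distr)

lemma act_act:
  "\<lbrakk>P \<in> carrier B_ring; Q \<in> carrier B_ring; x \<in> carrier V\<rbrakk> \<Longrightarrow> P \<odot> (Q \<odot> x) = (P ** Q) \<odot> x"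
  using smult_assoc[of P Q x] by simp

lemma act_one [simp]: "x \<in> carrier V \<Longrightarrow> mat 1 \<odot> x = x"
  using smult_one[of x] by simp

lemma vectorspace_underlying: "complex_vectorspace (underlying_vs V)"
proof -
  have "abelian_group (underlying_vs V)"
  proof (rule abelian_groupI)
    fix x assume "x \<in> carrier (underlying_vs V)"
    then show "\<exists>y\<in>carrier (underlying_vs V). y \<oplus>\<^bsub>underlying_vs V\<^esub> x = \<zero>\<^bsub>underlying_vs V\<^esub>"
      by (intro bexI[of _ "\<ominus> x"]) (simp_all add: underlying_vs_def M.l_neg)
  qed (simp_all add: underlying_vs_def M.a_assoc, simp add: M.a_comm)
  then have "module complex_field (underlying_vs V)"
    by (intro moduleI domain.axioms(1)[OF field.axioms(1)[OF field_complex_field]])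
      (simp_all add: underlying_vs_def act_add_left act_add_right
        act_act mat_fps_simps(1,2) fps_const_add[symmetric] fps_const_mult[symmetric] del: fps_const_add fps_const_mult)
  then show ?thesis by (simp add: vectorspace_def field_complex_field)
qed

lemma underlying_simps:
  "carrier (underlying_vs V) = carrier V" "add (underlying_vs V) = add V"
  "zero (underlying_vs V) = zero V" "c \<odot>\<^bsub>underlying_vs V\<^esub> x = mat (fps_const c) \<odot> x"
  by (simp_all add: underlying_vs_def)

sublocale U: complex_space "underlying_vs V"
  rewrites "carrier (underlying_vs V) = carrier V" and "add (underlying_vs V) = add V"
    and "zero (underlying_vs V) = zero V"
  by (simp_all add: complex_space_def vectorspace_underlying underlying_simps)

lemma act_hom: "P \<in> carrier B_ring \<Longrightarrow> (\<lambda>x. P \<odot> x) \<in> module_hom complex_field (underlying_vs V) (underlying_vs V)"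
  unfolding module_hom_iff underlying_simps
  by (simp add: act_add_right act_act mat_fps_simps(3)[of _ P])

lemma complex_space_underlying: "complex_space (underlying_vs V)"
  by (simp add: complex_space_def vectorspace_underlying)

lemma act_zero [simp]: "P \<in> carrier B_ring \<Longrightarrow> P \<odot> \<zero> = \<zero>"
  using hom_zero[OF act_hom complex_space_underlying complex_space_underlying] by (simp add: underlying_simps)

lemma zero_act [simp]: "x \<in> carrier V \<Longrightarrow> 0 \<odot> x = \<zero>"
proof -
  have "mat (fps_const 0) = (0::B_elem)" by (simp add: mat2_simps)
  then show "x \<in> carrier V \<Longrightarrow> 0 \<odot> x = \<zero>"
    using U.vec_simps(2)[of x] by (simp add: underlying_simps)
qed

text \<open>The vectors \<open>v, tv, \<dots>, t\<^sup>dv\<close> are linearly dependent, so a nonzero power series \<open>p\<close> with a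
  nonzero coefficient of index at most \<open>d\<close> kills \<open>v\<close>; up to a unit, \<open>p\<close> is a power of \<open>t\<close>.\<close>

lemma t_nilpotent:
  assumes fd: "finite_dimensional (underlying_vs V)"
  shows "\<exists>d. \<forall>v\<in>carrier V. mat (fps_X ^ d) \<odot> v = \<zero>"
proof (intro exI ballI)
  \<comment> \<open>The dimension is an exponent that works for all vectors at once.\<close>
  let ?d = "vectorspace.dim complex_field (underlying_vs V)"
  fix v assume v: "v \<in> carrier V"
  obtain c i where c: "i \<le> ?d" "c i \<noteq> 0"
    "finsum (underlying_vs V) (\<lambda>i. c i \<odot>\<^bsub>underlying_vs V\<^esub> (mat (fps_X ^ i) \<odot> v)) {..?d} = \<zero>"
    using U.linearly_dependent_family[OF fd, of "\<lambda>i. mat (fps_X ^ i) \<odot> v"] v by auto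
  define p where "p = (\<Sum>i\<le>?d. fps_const (c i) * fps_X ^ i)"
  have "mat (\<Sum>i\<in>A. fps_const (c i) * fps_X ^ i) \<odot> v =
      finsum (underlying_vs V) (\<lambda>i. c i \<odot>\<^bsub>underlying_vs V\<^esub> (mat (fps_X ^ i) \<odot> v)) A" if "finite A" for A
    using that
  proof induction
    case empty
    interpret vs: complex_vs "underlying_vs V" by (rule U.complex_vs)
    have "mat 0 = (0::B_elem)" by (simp add: mat2_simps)
    then show ?case using v vs.M.finsum_empty by (simp add: underlying_simps)
  next
    case (insert i A)
    interpret vs: complex_vs "underlying_vs V" by (rule U.complex_vs)
    have "finsum (underlying_vs V) (\<lambda>i. c i \<odot>\<^bsub>underlying_vs V\<^esub> (mat (fps_X ^ i) \<odot> v)) (insert i A) =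
      c i \<odot>\<^bsub>underlying_vs V\<^esub> (mat (fps_X ^ i) \<odot> v) \<oplus>\<^bsub>underlying_vs V\<^esub>
      finsum (underlying_vs V) (\<lambda>i. c i \<odot>\<^bsub>underlying_vs V\<^esub> (mat (fps_X ^ i) \<odot> v)) A"
      using insert.hyps v by (intro vs.M.finsum_insert) (auto simp: underlying_simps)
    then show ?case
      using insert v by (simp add: underlying_simps mat_fps_simps(1,2) act_add_left act_act)
  qed
  then have p0: "mat p \<odot> v = \<zero>" using c by (simp add: p_def)
  have "fps_nth p i = c i" using c(1)
    by (simp add: p_def fps_sum_nth fps_X_power_nth if_distrib cong: if_cong)
  then have p: "p \<noteq> 0" "subdegree p \<le> ?d" using c subdegree_leI[of p i] by auto
  define u where "u = unit_factor p"
  have u: "inverse u * u = 1" unfolding u_def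
    by (rule inverse_mult_eq_1) (use fps_unit_factor_nth_0[OF p(1)] in simp)
  have pu: "p = u * fps_X ^ subdegree p" unfolding u_def using subdegree_decompose[of p] by simp
  \<comment> \<open>Writing \<open>p = u t^s\<close> with a unit \<open>u\<close> and
    \<open>s \<le> d\<close> exhibits \<open>t^d\<close> as the multiple
    \<open>t^(d - s) u^(-1) p\<close> of \<open>p\<close>, which kills \<open>v\<close>.\<close>
  have "fps_X ^ ?d = fps_X ^ (?d - subdegree p) * (inverse u * u) * fps_X ^ subdegree p"
    using p(2) by (simp add: u flip: power_add)
  also have "\<dots> = fps_X ^ (?d - subdegree p) * inverse u * p"
    by (subst (3) pu) (simp only: mult.assoc)
  finally have "mat (fps_X ^ ?d) \<odot> v = mat (fps_X ^ (?d - subdegree p) * inverse u) \<odot> (mat p \<odot> v)"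
    using v by (simp add: act_act flip: mat_fps_simps(1,2))
  then show "mat (fps_X ^ ?d) \<odot> v = \<zero>" using p0 by simp
qed

end

text \<open>The identification with nilpotent quiver representations, on the level of morphisms.
  Commuting with the arrows gives commuting with \<open>t\<close>, hence with polynomials in
  \<open>t\<close>; the passage to power series uses that a power of \<open>t\<close> kills both
  modules.\<close>

lemma B_hom_of_quiver_hom:
  assumes V: "left_module B_ring V" "finite_dimensional (underlying_vs V)"
    and W: "left_module B_ring W" "finite_dimensional (underlying_vs W)"
    and g: "g \<in> module_hom complex_field (underlying_vs V) (underlying_vs W)"
    and comm: "\<And>v. v \<in> carrier V \<Longrightarrow> g (E11 \<odot>\<^bsub>V\<^esub> v) = E11 \<odot>\<^bsub>W\<^esub> g v"
      "\<And>v. v \<in> carrier V \<Longrightarrow> g (E22 \<odot>\<^bsub>V\<^esub> v) = E22 \<odot>\<^bsub>W\<^esub> g v"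
      "\<And>v. v \<in> carrier V \<Longrightarrow> g (E21 \<odot>\<^bsub>V\<^esub> v) = E21 \<odot>\<^bsub>W\<^esub> g v"
      "\<And>v. v \<in> carrier V \<Longrightarrow> g (tE12 \<odot>\<^bsub>V\<^esub> v) = tE12 \<odot>\<^bsub>W\<^esub> g v"
  shows "g \<in> module_hom B_ring V W"
proof -
  interpret V: B_module V by (simp add: B_module_def V)
  interpret W: B_module W by (simp add: B_module_def W)
  have g_closed [simp]: "g v \<in> carrier W" if "v \<in> carrier V" for v
    using hom_closed[OF g] that by (simp add: V.underlying_simps W.underlying_simps)
  have g_add: "g (v \<oplus>\<^bsub>V\<^esub> w) = g v \<oplus>\<^bsub>W\<^esub> g w" if "v \<in> carrier V" "w \<in> carrier V" for v w
    using hom_add[OF g] that by (simp add: V.underlying_simps W.underlying_simps)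
  have g_scalar: "g (mat (fps_const c) \<odot>\<^bsub>V\<^esub> v) = mat (fps_const c) \<odot>\<^bsub>W\<^esub> g v" if "v \<in> carrier V" for c v
    using hom_smult[OF g, of v c] that by (simp add: V.underlying_simps W.underlying_simps)
  have g_t: "g (mat fps_X \<odot>\<^bsub>V\<^esub> v) = mat fps_X \<odot>\<^bsub>W\<^esub> g v" if v: "v \<in> carrier V" for v
  proof -
    \<comment> \<open>The two paths of length two are \<open>t E22\<close> and \<open>t E11\<close>,
      so their sum is \<open>t\<close>.\<close>
    have t: "E21 ** tE12 + tE12 ** E21 = mat fps_X"
      by (simp add: matrix_unit_def mat2_simps)
    have "g ((E21 ** tE12 + tE12 ** E21) \<odot>\<^bsub>V\<^esub> v) = (E21 ** tE12 + tE12 ** E21) \<odot>\<^bsub>W\<^esub> g v"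
      using v by (simp only: V.act_add_left W.act_add_left V.act_act[symmetric] W.act_act[symmetric]
        B_closed g_closed V.act_closed W.act_closed g_add comm)
    then show ?thesis unfolding t .
  qed
  have g_t_pow: "g (mat (fps_X ^ k) \<odot>\<^bsub>V\<^esub> v) = mat (fps_X ^ k) \<odot>\<^bsub>W\<^esub> g v" if v: "v \<in> carrier V" for k v
  proof (induction k)
    case (Suc k)
    have "mat (fps_X ^ Suc k) = mat fps_X ** (mat (fps_X ^ k) :: B_elem)"
      by (simp flip: mat_fps_simps(1,2))
    then show ?case using v Suc by (simp add: g_t flip: V.act_act W.act_act)
  qed (use v in simp)
  have g_cutoff: "g (mat (fps_cutoff k p) \<odot>\<^bsub>V\<^esub> v) = mat (fps_cutoff k p) \<odot>\<^bsub>W\<^esub> g v" if v: "v \<in> carrier V" for k p v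
  proof (induction k)
    case 0
    have "mat 0 = (0::B_elem)" by (simp add: mat2_simps)
    moreover have "g \<zero>\<^bsub>V\<^esub> = \<zero>\<^bsub>W\<^esub>"
      using hom_zero[OF g V.complex_space_underlying W.complex_space_underlying]
      by (simp add: V.underlying_simps W.underlying_simps)
    ultimately show ?case using v by simp
  next
    case (Suc k)
    have "fps_cutoff (Suc k) p = fps_cutoff k p + fps_const (fps_nth p k) * fps_X ^ k"
      by (rule fps_ext) (auto simp: fps_X_power_nth less_Suc_eq)
    then show ?case
      using v Suc by (simp add: mat_fps_simps(1,2) V.act_add_left W.act_add_left g_add g_t_pow g_scalar
          flip: V.act_act W.act_act)
  qed
  obtain d d' where d: "\<forall>v\<in>carrier V. mat (fps_X ^ d) \<odot>\<^bsub>V\<^esub> v = \<zero>\<^bsub>V\<^esub>"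
    and d': "\<forall>v\<in>carrier W. mat (fps_X ^ d') \<odot>\<^bsub>W\<^esub> v = \<zero>\<^bsub>W\<^esub>"
    using V.t_nilpotent[OF V(2)] W.t_nilpotent[OF W(2)] by blast
  define k where "k = d + d'"
  \<comment> \<open>As \<open>t^k\<close> kills both modules, the first summand acts as zero and
    only the polynomial \<open>fps_cutoff k p\<close> remains.\<close>
  have cutoff: "mat p = mat (fps_shift k p) ** mat (fps_X ^ k) + (mat (fps_cutoff k p) :: B_elem)" for p
    by (simp add: fps_shift_cutoff flip: mat_fps_simps(1,2))
  have "mat (fps_X ^ k) \<odot>\<^bsub>V\<^esub> v = \<zero>\<^bsub>V\<^esub>" if "v \<in> carrier V" for v
    using d that unfolding k_def power_add mat_fps_simps(2) mat_fps_simps(3)[of "fps_X ^ d"]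
    by (simp flip: V.act_act)
  moreover have "mat (fps_X ^ k) \<odot>\<^bsub>W\<^esub> v = \<zero>\<^bsub>W\<^esub>" if "v \<in> carrier W" for v
    using d' that unfolding k_def power_add mat_fps_simps(2)
    by (simp flip: W.act_act)
  ultimately have g_series: "g (mat p \<odot>\<^bsub>V\<^esub> v) = mat p \<odot>\<^bsub>W\<^esub> g v" if "v \<in> carrier V" for p v
    using that by (simp add: cutoff[of p] V.act_add_left W.act_add_left g_cutoff flip: V.act_act W.act_act)
  have "g (P \<odot>\<^bsub>V\<^esub> v) = P \<odot>\<^bsub>W\<^esub> g v" if P: "P \<in> carrier B_ring" and v: "v \<in> carrier V" for P v
  proof -
    define Q where "Q = mat (P $ 1 $ 1) ** E11 + mat (fps_shift 1 (P $ 1 $ 2)) ** tE12 +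
      mat (P $ 2 $ 1) ** E21 + mat (P $ 2 $ 2) ** E22"
    have "g (Q \<odot>\<^bsub>V\<^esub> v) = Q \<odot>\<^bsub>W\<^esub> g v"
      unfolding Q_def using v
      by (simp only: V.act_add_left W.act_add_left V.act_act[symmetric] W.act_act[symmetric] B_closed
        g_closed V.act_closed W.act_closed V.U.vec_closed W.U.vec_closed g_add g_series comm)
    then show ?thesis unfolding Q_def B_generators[OF P, symmetric] .
  qed
  then show ?thesis unfolding module_hom_def using g_add by auto
qed

section \<open>The functor\<close>

text \<open>On the carrier the projections are determined by the weight spaces; the choice makes
  them a function of \<open>M\<close>, as the definition of the functor on objects requires.\<close>

definition weight_proj :: "'u gk_module \<Rightarrow> int \<Rightarrow> 'u \<Rightarrow> 'u" where
  "weight_proj M = (SOME \<pi>. graded_space M {n. odd n} (weight_space M) \<pi>)"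

definition nil_exp :: "'u gk_module \<Rightarrow> nat" where
  "nil_exp M = (SOME m. \<forall>v\<in>carrier M. (shifted_casimir M ^^ m) v = \<zero>\<^bsub>M\<^esub>)"

text \<open>The power series \<open>p(T)\<close> may be truncated at the nilpotency exponent of \<open>T\<close>.\<close>

definition series_act :: "'u gk_module \<Rightarrow> complex fps \<Rightarrow> 'u \<Rightarrow> 'u" where
  "series_act M p v = finsum M (\<lambda>i. fps_nth p i \<odot>\<^bsub>M\<^esub> (shifted_casimir M ^^ i) v) {..<nil_exp M}"

text \<open>The matrix \<open>P\<close> applied to the column of the components of weights -1 and 1.
  An upper right entry \<open>t q\<close> acts as \<open>q(T) Y\<close>, hence the shift, and a
  lower left entry \<open>p\<close> acts as \<open>p(T) X\<close>. The bracketing separates the part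
  of weight -1 of the result from the part of weight 1.\<close>

definition B_act :: "'u gk_module \<Rightarrow> B_elem \<Rightarrow> 'u \<Rightarrow> 'u" where
  "B_act M P v =
     series_act M (P $ 1 $ 1) (weight_proj M (-1) v) \<oplus>\<^bsub>M\<^esub>
     series_act M (fps_shift 1 (P $ 1 $ 2)) (gact M Y_mat (weight_proj M 1 v)) \<oplus>\<^bsub>M\<^esub>
     (series_act M (P $ 2 $ 1) (gact M X_mat (weight_proj M (-1) v)) \<oplus>\<^bsub>M\<^esub>
      series_act M (P $ 2 $ 2) (weight_proj M 1 v))"

text \<open>The subspace \<open>M\<^sub>-\<^sub>1 \<oplus> M\<^sub>1\<close>.\<close>

definition core :: "'u gk_module \<Rightarrow> 'u set" where
  "core M = {v \<in> carrier M. \<forall>n. n \<noteq> -1 \<and> n \<noteq> 1 \<longrightarrow> weight_proj M n v = \<zero>\<^bsub>M\<^esub>}"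

definition HC0_to_RepB :: "'u gk_module \<Rightarrow> (B_elem, 'u) module" where
  "HC0_to_RepB M = \<lparr>carrier = core M, monoid.mult = add M, one = \<zero>\<^bsub>M\<^esub>, zero = \<zero>\<^bsub>M\<^esub>, add = add M, smult = B_act M\<rparr>"

section \<open>Power series in \<open>T\<close> and the action of \<open>B_ring\<close> on the
  core\<close>

locale HC0_module =
  fixes M :: "'u gk_module" (structure)
  assumes HC0: "M \<in> Ob HC0"
begin

sublocale gk_mod M
  using HC0 by (simp add: HC0_def HC_def harish_chandra_def)

sublocale graded_space M "{n. odd n}" "weight_space M" "weight_proj M"
proof -
  have "\<exists>\<pi>. graded_space M {n. odd n} (weight_space M) \<pi>"
    using HC0 by (intro graded_space_of_internal_direct_sum complex_space_axioms) (simp add: HC0_def)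
  then show "graded_space M {n. odd n} (weight_space M) (weight_proj M)"
    unfolding weight_proj_def by (rule someI_ex)
qed

lemma weight_finite_dimensional: "finite_dimensional (M\<lparr>carrier := weight_space M n\<rparr>)"
  using HC0 by (simp add: HC0_def HC_def harish_chandra_def)

lemma nilpotent:
  assumes "v \<in> carrier M"
  shows "(T ^^ nil_exp M) v = \<zero>"
proof -
  obtain m where m: "\<forall>v \<in> carrier M. ((\<lambda>w. casimir M w \<oplus> w) ^^ m) v = \<zero>"
    using HC0 by (auto simp: HC0_def)
  \<comment> \<open>\<open>HC0\<close> speaks of powers of \<open>C + 1 = 4 T\<close>, and the
    factor \<open>4 ^ k\<close> is invertible.\<close>
  have "((\<lambda>w. casimir M w \<oplus> w) ^^ k) v = 4 ^ k \<odot> (T ^^ k) v" if v: "v \<in> carrier M" for k v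
  proof (induction k)
    case (Suc k)
    have Tk: "(T ^^ k) v \<in> carrier M" using hom_closed[OF hom_funpow[OF T_hom] v] .
    have "casimir M w \<oplus> w = 4 \<odot> T w" if "w \<in> carrier M" for w
      by (rule vec_eqI) (use that in \<open>simp_all add: shifted_casimir_def dual_simps casimir_def\<close>)
    then have "((\<lambda>w. casimir M w \<oplus> w) ^^ Suc k) v = 4 \<odot> T (4 ^ k \<odot> (T ^^ k) v)"
      using Tk by (simp add: Suc.IH)
    also have "\<dots> = 4 ^ Suc k \<odot> T ((T ^^ k) v)"
      by (rule vec_eqI) (use Tk in \<open>simp_all add: dual_simps hom_smult[OF T_hom]\<close>)
    finally show ?case by simp
  qed (use v in simp)
  then have *: "4 ^ m \<odot> (T ^^ m) v = \<zero>" if "v \<in> carrier M" for v using m that by simp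
  have "(T ^^ m) v = \<zero>" if v: "v \<in> carrier M" for v
  proof (rule vec_eqI)
    fix \<phi> assume \<phi>: "\<phi> \<in> dual_space M"
    have Tm: "(T ^^ m) v \<in> carrier M" using hom_closed[OF hom_funpow[OF T_hom] v] .
    have "\<phi> (4 ^ m \<odot> (T ^^ m) v) = 0" using *[OF v] \<phi> by (simp add: dual_simps)
    then show "\<phi> ((T ^^ m) v) = \<phi> \<zero>" using \<phi> Tm by (simp add: dual_simps)
  qed (use hom_closed[OF hom_funpow[OF T_hom] v] in auto)
  then have "\<forall>v\<in>carrier M. (T ^^ m) v = \<zero>" by simp
  then have "\<forall>v\<in>carrier M. (T ^^ nil_exp M) v = \<zero>"
    unfolding nil_exp_def by (rule someI[of "\<lambda>m. \<forall>v\<in>carrier M. (T ^^ m) v = \<zero>" m])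
  then show ?thesis using assms by simp
qed

lemma T_pow_hom: "(T ^^ k) \<in> module_hom complex_field M M"
  by (rule hom_funpow[OF T_hom])

lemma T_pow_closed [simp]: "v \<in> carrier M \<Longrightarrow> (T ^^ k) v \<in> carrier M"
  by (rule hom_closed[OF T_pow_hom])

lemma T_pow_zero: "v \<in> carrier M \<Longrightarrow> nil_exp M \<le> k \<Longrightarrow> (T ^^ k) v = \<zero>"
  using hom_zero[OF T_pow_hom complex_space_axioms complex_space_axioms, of "k - nil_exp M"]
    nilpotent[of v] funpow_add[of "k - nil_exp M" "nil_exp M" T] by simp

abbreviation "ev \<equiv> series_act M"

lemma ev_closed [simp]: "v \<in> carrier M \<Longrightarrow> ev p v \<in> carrier M"
  unfolding series_act_def by (rule finsum_closed) simp

text \<open>The truncation may be placed at any \<open>k\<close> from \<open>nil_exp M\<close> on,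
  since the added powers of \<open>T\<close> vanish. Evaluations of explicit series choose it so
  large that the relevant coefficients are present.\<close>

lemma dual_ev:
  assumes "\<phi> \<in> dual_space M" "v \<in> carrier M" "nil_exp M \<le> k"
  shows "\<phi> (ev p v) = (\<Sum>i<k. fps_nth p i * \<phi> ((T ^^ i) v))"
proof -
  have "\<phi> (ev p v) = (\<Sum>i<nil_exp M. fps_nth p i * \<phi> ((T ^^ i) v))"
    unfolding series_act_def using assms by (simp add: dual_finsum dual_simps)
  also have "\<dots> = (\<Sum>i<k. fps_nth p i * \<phi> ((T ^^ i) v))"
    using assms by (intro sum.mono_neutral_left) (auto simp: T_pow_zero dual_simps)
  finally show ?thesis .
qed

lemma ev_hom: "ev p \<in> module_hom complex_field M M"
  unfolding module_hom_iff
proof (intro conjI ballI allI)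
  fix x y c assume xy: "x \<in> carrier M" "y \<in> carrier M"
  show "ev p (x \<oplus> y) = ev p x \<oplus> ev p y" "ev p (c \<odot> x) = c \<odot> ev p x"
    by (rule vec_eqI; use xy in \<open>simp add: dual_ev[OF _ _ order_refl] dual_simps module_homD[OF T_pow_hom]
      distrib_left sum.distrib sum_distrib_left mult.left_commute\<close>)+
qed simp

lemmas ev_linear = module_homD[OF ev_hom]

lemma ev_add: "v \<in> carrier M \<Longrightarrow> ev (p + q) v = ev p v \<oplus> ev q v"
  by (rule vec_eqI)
    (simp_all add: dual_ev[OF _ _ order_refl] dual_simps distrib_right sum.distrib)

lemma ev_const: "v \<in> carrier M \<Longrightarrow> ev (fps_const c) v = c \<odot> v"
proof (rule vec_eqI)
  fix \<phi> assume \<phi>: "\<phi> \<in> dual_space M" and v: "v \<in> carrier M"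
  \<comment> \<open>One term beyond \<open>nil_exp M\<close>, so that the constant coefficient
    occurs even if \<open>nil_exp M\<close> is 0.\<close>
  have "\<phi> (ev (fps_const c) v) = (\<Sum>i<Suc (nil_exp M). fps_nth (fps_const c) i * \<phi> ((T ^^ i) v))"
    using \<phi> v by (intro dual_ev) auto
  also have "\<dots> = c * \<phi> v" by (subst sum.lessThan_Suc_shift) simp
  finally show "\<phi> (ev (fps_const c) v) = \<phi> (c \<odot> v)" using \<phi> v by (simp add: dual_simps)
qed auto

lemma ev_one [simp]: "v \<in> carrier M \<Longrightarrow> ev 1 v = v"
  using ev_const[of v 1] by simp

lemma ev_zero [simp]: "v \<in> carrier M \<Longrightarrow> ev 0 v = \<zero>"
  using ev_const[of v 0] by simp

lemma ev_X: "v \<in> carrier M \<Longrightarrow> ev fps_X v = T v"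
proof (rule vec_eqI)
  fix \<phi> assume \<phi>: "\<phi> \<in> dual_space M" and v: "v \<in> carrier M"
  \<comment> \<open>Two terms beyond, so that the coefficient of index 1 occurs in any case.\<close>
  have "\<phi> (ev fps_X v) = (\<Sum>i<Suc (Suc (nil_exp M)). fps_nth fps_X i * \<phi> ((T ^^ i) v))"
    using \<phi> v by (intro dual_ev) auto
  also have "\<dots> = \<phi> (T v)" by (subst sum.lessThan_Suc_shift, subst sum.lessThan_Suc_shift) simp
  finally show "\<phi> (ev fps_X v) = \<phi> (T v)" .
qed auto

lemma ev_mult:
  assumes v: "v \<in> carrier M"
  shows "ev (p * q) v = ev p (ev q v)"
proof (rule vec_eqI)
  fix \<phi> assume \<phi>: "\<phi> \<in> dual_space M"
  let ?k = "nil_exp M"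
  let ?a = "\<lambda>i. \<phi> ((T ^^ i) v)"
  have T_pow_ev: "\<phi> ((T ^^ i) (ev q v)) = (\<Sum>j<?k. fps_nth q j * ?a (i + j))" for i
  proof -
    have "\<phi> ((T ^^ i) (ev q v)) = (\<Sum>j<?k. fps_nth q j * \<phi> ((T ^^ i) ((T ^^ j) v)))"
      using dual_ev[OF hom_comp_dual[OF T_pow_hom \<phi>] v order_refl] .
    then show ?thesis by (simp add: funpow_add)
  qed
  have "\<phi> (ev p (ev q v)) = (\<Sum>i<?k. \<Sum>j<?k. fps_nth p i * fps_nth q j * ?a (i + j))"
    using \<phi> v by (simp add: dual_ev[OF _ _ order_refl] T_pow_ev sum_distrib_left mult.assoc)
  also have "\<dots> = (\<Sum>(i, j)\<in>{..<?k} \<times> {..<?k}. fps_nth p i * fps_nth q j * ?a (i + j))"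
    by (simp add: sum.cartesian_product)
  \<comment> \<open>Terms with \<open>i + j\<close> at least \<open>nil_exp M\<close> vanish, which
    cuts the square of indices down to the triangle of the Cauchy product.\<close>
  also have "\<dots> = (\<Sum>(i, j)\<in>{(i, j). i + j < ?k}. fps_nth p i * fps_nth q j * ?a (i + j))"
  proof (rule sum.mono_neutral_right)
    have "?a n = 0" if "\<not> n < ?k" for n
      using v \<phi> that by (simp add: T_pow_zero dual_simps)
    then show "\<forall>x\<in>{..<?k} \<times> {..<?k} - {(i, j). i + j < ?k}.
        (case x of (i, j) \<Rightarrow> fps_nth p i * fps_nth q j * ?a (i + j)) = 0"
      by (simp add: split_beta)
  qed auto
  also have "\<dots> = (\<Sum>n<?k. \<Sum>i\<le>n. fps_nth p i * fps_nth q (n - i) * ?a n)"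
    by (subst sum.triangle_reindex) (intro sum.cong; simp)
  also have "\<dots> = \<phi> (ev (p * q) v)"
    using \<phi> v by (simp add: dual_ev[OF _ _ order_refl] fps_mult_nth sum_distrib_right atLeast0AtMost)
  finally show "\<phi> (ev (p * q) v) = \<phi> (ev p (ev q v))" ..
qed (use v in auto)

lemma ev_commutes:
  assumes Z: "Z \<in> module_hom complex_field M M" and comm: "\<And>v. v \<in> carrier M \<Longrightarrow> T (Z v) = Z (T v)"
    and v: "v \<in> carrier M"
  shows "Z (ev p v) = ev p (Z v)"
proof (rule vec_eqI)
  note [simp] = hom_closed[OF Z]
  fix \<phi> assume \<phi>: "\<phi> \<in> dual_space M"
  have pow: "(T ^^ i) (Z v) = Z ((T ^^ i) v)" for i
    by (induction i) (simp_all add: comm v)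
  show "\<phi> (Z (ev p v)) = \<phi> (ev p (Z v))"
    using dual_ev[OF hom_comp_dual[OF Z \<phi>] v order_refl] \<phi> v
    by (simp add: dual_ev[OF _ _ order_refl] pow)
qed (use v hom_closed[OF Z] in auto)

lemma ev_gact: "Z \<in> sl2 \<Longrightarrow> v \<in> carrier M \<Longrightarrow> gact M Z (ev p v) = ev p (gact M Z v)"
  by (rule ev_commutes) (simp_all add: gact_linear T_gact)

lemma ev_weight: "v \<in> weight_space M n \<Longrightarrow> ev p v \<in> weight_space M n"
  by (simp add: weight_space_iff ev_gact ev_linear)

abbreviation "\<pi> \<equiv> weight_proj M"

lemma core_iff: "v \<in> core M \<longleftrightarrow> v \<in> carrier M \<and> (\<forall>n. n \<noteq> -1 \<and> n \<noteq> 1 \<longrightarrow> \<pi> n v = \<zero>)"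
  by (simp add: core_def)

lemma core_closed [simp]: "v \<in> core M \<Longrightarrow> v \<in> carrier M"
  by (simp add: core_iff)

lemma proj_weight:
  assumes "v \<in> carrier M"
  shows "\<pi> (-1) v \<in> weight_space M (-1)" "\<pi> 1 v \<in> weight_space M 1"
  using proj_in[OF _ assms] by auto

lemma proj_zero [simp]: "\<pi> n \<zero> = \<zero>"
  by (rule hom_zero[OF proj_hom complex_space_axioms complex_space_axioms])

lemma core_subspace: "complex_subspace (core M) M"
  unfolding complex_subspace_iff core_iff by (auto simp: core_iff module_homD[OF proj_hom])

lemma core_sum:
  assumes "v \<in> core M"
  shows "\<pi> (-1) v \<oplus> \<pi> 1 v = v"
proof -
  have v: "v \<in> carrier M" using assms by simp
  interpret vs: complex_vs M by (rule complex_vs)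
  have "v = finsum M (\<lambda>n. \<pi> n v) {-1, 1}"
    by (rule proj_sum'[symmetric]) (use assms in \<open>auto simp: core_iff\<close>)
  also have "\<dots> = \<pi> (-1) v \<oplus> \<pi> 1 v"
    using v by (subst vs.M.finsum_insert) auto
  finally show ?thesis by simp
qed

lemma core_add:
  assumes "a \<in> weight_space M (-1)" "b \<in> weight_space M 1"
  shows "a \<oplus> b \<in> core M" "\<pi> (-1) (a \<oplus> b) = a" "\<pi> 1 (a \<oplus> b) = b"
proof -
  have ab: "a \<in> carrier M" "b \<in> carrier M" using assms by simp_all
  have p: "\<pi> m a = (if m = -1 then a else \<zero>)" "\<pi> m b = (if m = 1 then b else \<zero>)" for m
    using proj_homogeneous[of "-1" a m] proj_homogeneous[of 1 b m] assms by simp_all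
  show "a \<oplus> b \<in> core M" "\<pi> (-1) (a \<oplus> b) = a" "\<pi> 1 (a \<oplus> b) = b"
    using ab by (simp_all add: core_iff hom_add[OF proj_hom] p)
qed

lemma weight_in_core:
  assumes "a \<in> weight_space M (-1) \<or> a \<in> weight_space M 1"
  shows "a \<in> core M"
proof -
  note z = subspace_closed(1)[OF weight_space_subspace]
  from assms show ?thesis
  proof
    assume a: "a \<in> weight_space M (-1)"
    then show ?thesis using core_add(1)[OF a z] by simp
  next
    assume a: "a \<in> weight_space M 1"
    then show ?thesis using core_add(1)[OF z a] by simp
  qed
qed

lemma core_eqI:
  assumes "v \<in> core M" "w \<in> core M" "\<pi> (-1) v = \<pi> (-1) w" "\<pi> 1 v = \<pi> 1 w"
  shows "v = w"
proof -
  have "v = \<pi> (-1) v \<oplus> \<pi> 1 v" by (rule core_sum[OF assms(1), symmetric])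
  also have "\<dots> = w" unfolding assms(3,4) by (rule core_sum[OF assms(2)])
  finally show ?thesis .
qed

lemma B_act_components:
  assumes v: "v \<in> carrier M"
  shows B_act_core: "B_act M P v \<in> core M"
    and proj_minus_B_act: "\<pi> (-1) (B_act M P v) =
      ev (P $ 1 $ 1) (\<pi> (-1) v) \<oplus> ev (fps_shift 1 (P $ 1 $ 2)) (Y (\<pi> 1 v))"
    and proj_plus_B_act: "\<pi> 1 (B_act M P v) = ev (P $ 2 $ 1) (X (\<pi> (-1) v)) \<oplus> ev (P $ 2 $ 2) (\<pi> 1 v)"
proof -
  have "X (\<pi> (-1) v) \<in> weight_space M 1" "Y (\<pi> 1 v) \<in> weight_space M (-1)"
    using X_weight[OF proj_weight(1)[OF v]] Y_weight[OF proj_weight(2)[OF v]] by simp_all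
  then have "ev (P $ 1 $ 1) (\<pi> (-1) v) \<oplus> ev (fps_shift 1 (P $ 1 $ 2)) (Y (\<pi> 1 v)) \<in> weight_space M (-1)"
    "ev (P $ 2 $ 1) (X (\<pi> (-1) v)) \<oplus> ev (P $ 2 $ 2) (\<pi> 1 v) \<in> weight_space M 1"
    using proj_weight[OF v] by (auto intro!: subspace_closed(3)[OF weight_space_subspace] ev_weight)
  note * = core_add[OF this, folded B_act_def]
  show "B_act M P v \<in> core M"
    "\<pi> (-1) (B_act M P v) = ev (P $ 1 $ 1) (\<pi> (-1) v) \<oplus> ev (fps_shift 1 (P $ 1 $ 2)) (Y (\<pi> 1 v))"
    "\<pi> 1 (B_act M P v) = ev (P $ 2 $ 1) (X (\<pi> (-1) v)) \<oplus> ev (P $ 2 $ 2) (\<pi> 1 v)"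
    by (rule *)+
qed

lemma YX_minus: "a \<in> weight_space M (-1) \<Longrightarrow> Y (X a) = T a"
  by (simp add: XY_weight(2)) (rule vec_eqI, simp_all add: dual_simps)

lemma XY_plus: "b \<in> weight_space M 1 \<Longrightarrow> X (Y b) = T b"
  by (simp add: XY_weight(1)) (rule vec_eqI, simp_all add: dual_simps)

text \<open>In a diagonal entry of the product, the path through both off-diagonal entries
  contributes a factor \<open>t\<close>. On the module side this path is \<open>Y X\<close> at
  weight -1 or \<open>X Y\<close> at weight 1, and both are \<open>T\<close>.\<close>

lemma B_act_mult:
  assumes P: "P \<in> carrier B_ring" and Q: "Q \<in> carrier B_ring" and v: "v \<in> carrier M"
  shows "B_act M (P ** Q) v = B_act M P (B_act M Q v)"
proof (rule core_eqI)
  let ?a = "\<pi> (-1) v" and ?b = "\<pi> 1 v"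
  obtain p where p: "P $ 1 $ 2 = p * fps_X" using P by (auto simp: B_ring_carrier mult.commute elim: dvdE)
  obtain q where q: "Q $ 1 $ 2 = q * fps_X" using Q by (auto simp: B_ring_carrier mult.commute elim: dvdE)
  have shift: "fps_shift 1 (P $ 1 $ 2) = p" "fps_shift 1 (Q $ 1 $ 2) = q"
    by (simp_all only: p q fps_shift_times_fps_X')
  have entries: "(P ** Q) $ 1 $ 1 = P $ 1 $ 1 * Q $ 1 $ 1 + p * Q $ 2 $ 1 * fps_X"
    "(P ** Q) $ 1 $ 2 = (P $ 1 $ 1 * q + p * Q $ 2 $ 2) * fps_X"
    "(P ** Q) $ 2 $ 1 = P $ 2 $ 1 * Q $ 1 $ 1 + P $ 2 $ 2 * Q $ 2 $ 1"
    "(P ** Q) $ 2 $ 2 = P $ 2 $ 1 * q * fps_X + P $ 2 $ 2 * Q $ 2 $ 2"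
    by (simp_all add: matrix_matrix_mult_def sum_2 p q algebra_simps)
  have shift': "fps_shift 1 ((P ** Q) $ 1 $ 2) = P $ 1 $ 1 * q + p * Q $ 2 $ 2"
    by (simp only: entries fps_shift_times_fps_X')
  note a = proj_weight(1)[OF v] and b = proj_weight(2)[OF v]
  have [simp]: "?a \<in> carrier M" "?b \<in> carrier M" using v by simp_all
  note Qv = core_closed[OF B_act_core[OF v, of Q]]
  show "B_act M (P ** Q) v \<in> core M" "B_act M P (B_act M Q v) \<in> core M"
    using v Qv by (simp_all add: B_act_core)
  show "\<pi> (-1) (B_act M (P ** Q) v) = \<pi> (-1) (B_act M P (B_act M Q v))"
    unfolding proj_minus_B_act[OF v] proj_minus_B_act[OF Qv] proj_plus_B_act[OF v] shift shift'
    unfolding entries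
    by (rule vec_eqI) (simp_all add: ev_add ev_mult ev_linear gact_hom ev_gact YX_minus[OF a] ev_X dual_simps)
  show "\<pi> 1 (B_act M (P ** Q) v) = \<pi> 1 (B_act M P (B_act M Q v))"
    unfolding proj_minus_B_act[OF v] proj_plus_B_act[OF Qv] proj_plus_B_act[OF v] shift shift'
    unfolding entries
    by (rule vec_eqI) (simp_all add: ev_add ev_mult ev_linear gact_hom ev_gact XY_plus[OF b] ev_X dual_simps)
qed

lemma B_act_add_left:
  assumes v: "v \<in> carrier M"
  shows "B_act M (P + Q) v = B_act M P v \<oplus> B_act M Q v"
  unfolding B_act_def
  by (rule vec_eqI) (use v in \<open>simp_all add: ev_add fps_shift_add dual_simps\<close>)

lemma B_act_linear:
  assumes "v \<in> carrier M"
  shows "w \<in> carrier M \<Longrightarrow> B_act M P (v \<oplus> w) = B_act M P v \<oplus> B_act M P w"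
    "B_act M P (c \<odot> v) = c \<odot> B_act M P v"
  unfolding B_act_def
  by (rule vec_eqI; use assms in \<open>simp add: ev_linear gact_hom module_homD[OF proj_hom] dual_simps algebra_simps\<close>)+

lemma B_act_scalar:
  assumes v: "v \<in> core M"
  shows "B_act M (mat (fps_const c)) v = c \<odot> v"
proof (rule core_eqI)
  show "B_act M (mat (fps_const c)) v \<in> core M" "c \<odot> v \<in> core M"
    using v by (auto intro: B_act_core subspace_closed(4)[OF core_subspace])
  show "\<pi> (-1) (B_act M (mat (fps_const c)) v) = \<pi> (-1) (c \<odot> v)"
    "\<pi> 1 (B_act M (mat (fps_const c)) v) = \<pi> 1 (c \<odot> v)"
    using v by (simp_all add: proj_minus_B_act proj_plus_B_act mat_def ev_const hom_smult[OF proj_hom])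
qed

lemma B_act_units:
  assumes v: "v \<in> carrier M"
  shows "B_act M E11 v = \<pi> (-1) v" "B_act M E22 v = \<pi> 1 v" "B_act M E21 v = X (\<pi> (-1) v)"
    "B_act M tE12 v = Y (\<pi> 1 v)"
proof -
  have "fps_shift 1 (fps_X :: complex fps) = 1" by simp
  then show "B_act M E11 v = \<pi> (-1) v" "B_act M E22 v = \<pi> 1 v" "B_act M E21 v = X (\<pi> (-1) v)"
    "B_act M tE12 v = Y (\<pi> 1 v)"
    unfolding B_act_def using v
    by (simp_all add: matrix_unit_def matrix_matrix_mult_def mat_def sum_2 del: One_nat_def)
qed

lemma left_module: "left_module B_ring (HC0_to_RepB M)"
proof (intro left_module.intro left_module_axioms.intro)
  show "ring B_ring" by (rule ring_B_ring)
  show "abelian_group (HC0_to_RepB M)"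
  proof (rule abelian_groupI)
    fix x assume x: "x \<in> carrier (HC0_to_RepB M)"
    then have "(-1) \<odot> x \<oplus> x = \<zero>"
      by (intro vec_eqI) (simp_all add: HC0_to_RepB_def dual_simps)
    then show "\<exists>y\<in>carrier (HC0_to_RepB M). y \<oplus>\<^bsub>HC0_to_RepB M\<^esub> x = \<zero>\<^bsub>HC0_to_RepB M\<^esub>"
      using x subspace_closed(4)[OF core_subspace, of x "-1"]
      by (intro bexI[of _ "(-1) \<odot> x"]) (simp_all add: HC0_to_RepB_def)
  next
    fix x y z assume "x \<in> carrier (HC0_to_RepB M)" "y \<in> carrier (HC0_to_RepB M)" "z \<in> carrier (HC0_to_RepB M)"
    then show "x \<oplus>\<^bsub>HC0_to_RepB M\<^esub> y \<oplus>\<^bsub>HC0_to_RepB M\<^esub> z = x \<oplus>\<^bsub>HC0_to_RepB M\<^esub> (y \<oplus>\<^bsub>HC0_to_RepB M\<^esub> z)"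
      by (intro vec_eqI) (simp_all add: HC0_to_RepB_def dual_simps)
  next
    fix x y assume "x \<in> carrier (HC0_to_RepB M)" "y \<in> carrier (HC0_to_RepB M)"
    then show "x \<oplus>\<^bsub>HC0_to_RepB M\<^esub> y = y \<oplus>\<^bsub>HC0_to_RepB M\<^esub> x"
      by (intro vec_eqI) (simp_all add: HC0_to_RepB_def dual_simps)
  qed (simp_all add: HC0_to_RepB_def subspace_closed[OF core_subspace])
qed (simp_all add: HC0_to_RepB_def B_act_core B_act_add_left B_act_linear B_act_mult,
    simp add: B_act_scalar[of _ 1, simplified])

lemma HC0_to_RepB_finite_dimensional: "finite_dimensional (underlying_vs (HC0_to_RepB M))"
proof -
  interpret B: B_module "HC0_to_RepB M" by (simp add: B_module_def left_module)
  have "\<forall>n. \<exists>A. finite A \<and> A \<subseteq> weight_space M n \<and>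
      (\<forall>S. complex_subspace S M \<and> A \<subseteq> S \<longrightarrow> weight_space M n \<subseteq> S)"
    using weight_finite_dimensional finite_dimensional_subspace_iff[OF weight_space_subspace] by simp
  from choice[OF this] obtain A where A': "\<forall>n. finite (A n) \<and> A n \<subseteq> weight_space M n \<and>
      (\<forall>S. complex_subspace S M \<and> A n \<subseteq> S \<longrightarrow> weight_space M n \<subseteq> S)" ..
  have A: "finite (A n)" "A n \<subseteq> weight_space M n"
    "complex_subspace S M \<Longrightarrow> A n \<subseteq> S \<Longrightarrow> weight_space M n \<subseteq> S" for n S
    using A'[rule_format, of n] by simp_all
  show ?thesis
    unfolding B.U.finite_dimensional_iff
  proof (intro exI[of _ "A (-1) \<union> A 1"] conjI allI impI)
    show "finite (A (-1) \<union> A 1)" using A by simp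
    show "A (-1) \<union> A 1 \<subseteq> carrier (HC0_to_RepB M)"
      using A(2)[of "-1"] A(2)[of 1] weight_in_core by (auto simp: HC0_to_RepB_def)
    fix S assume S: "complex_subspace S (underlying_vs (HC0_to_RepB M)) \<and> A (-1) \<union> A 1 \<subseteq> S"
    then have Sc: "S \<subseteq> core M" and S0: "\<zero> \<in> S" and S_add: "\<And>x y. x \<in> S \<Longrightarrow> y \<in> S \<Longrightarrow> x \<oplus> y \<in> S"
      and S_smult: "\<And>c x. x \<in> S \<Longrightarrow> B_act M (mat (fps_const c)) x \<in> S"
      unfolding B.U.complex_subspace_iff B.underlying_simps by (auto simp: HC0_to_RepB_def)
    \<comment> \<open>Scalar matrices act on the core as the scalars of \<open>M\<close>, so a
      subspace for one structure is a subspace for the other.\<close>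
    have "complex_subspace S M"
      unfolding complex_subspace_iff
    proof (intro conjI ballI allI)
      fix c x assume x: "x \<in> S"
      then show "c \<odot> x \<in> S" using S_smult[OF x, of c] B_act_scalar[of x c] Sc by auto
    qed (use Sc S0 S_add in auto)
    then have "weight_space M (-1) \<subseteq> S" "weight_space M 1 \<subseteq> S"
      using A(3)[of S "-1"] A(3)[of S 1] S by simp_all
    then have "v \<in> S" if "v \<in> core M" for v
      using S_add[of "\<pi> (-1) v" "\<pi> 1 v"] core_sum[OF that] proj_weight[OF core_closed[OF that]]
      by auto
    then show "S = carrier (HC0_to_RepB M)"
      using Sc by (auto simp: HC0_to_RepB_def)
  qed
qed

lemma HC0_to_RepB_in_Ob: "HC0_to_RepB M \<in> Ob RepB"
  by (simp add: RepB_def left_module HC0_to_RepB_finite_dimensional)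

lemma HC0_to_RepB_quiver:
  "same_quiver_rep (quiver_rep_of_B_module (HC0_to_RepB M)) (quiver_rep_of_gk_module M)"
proof -
  have minus: "{B_act M E11 v | v. v \<in> core M} = weight_space M (-1)"
  proof (intro equalityI subsetI)
    fix a assume a: "a \<in> weight_space M (-1)"
    then have "a = B_act M E11 a"
      using core_add(2)[OF a subspace_closed(1)[OF weight_space_subspace]] by (simp add: B_act_units)
    then show "a \<in> {B_act M E11 v | v. v \<in> core M}" using weight_in_core[OF disjI1[OF a]] by (intro CollectI exI[of _ a] conjI)
  qed (auto simp: B_act_units proj_weight)
  have plus: "{B_act M E22 v | v. v \<in> core M} = weight_space M 1"
  proof (intro equalityI subsetI)
    fix a assume a: "a \<in> weight_space M 1"
    then have "a = B_act M E22 a"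
      using core_add(3)[OF subspace_closed(1)[OF weight_space_subspace] a] by (simp add: B_act_units)
    then show "a \<in> {B_act M E22 v | v. v \<in> core M}" using weight_in_core[OF disjI2[OF a]] by (intro CollectI exI[of _ a] conjI)
  qed (auto simp: B_act_units proj_weight)
  have "\<pi> (-1) a = a" if "a \<in> weight_space M (-1)" for a
    using core_add(2)[OF that subspace_closed(1)[OF weight_space_subspace]] that by simp
  moreover have "\<pi> 1 a = a" if "a \<in> weight_space M 1" for a
    using core_add(3)[OF subspace_closed(1)[OF weight_space_subspace] that] that by simp
  ultimately show ?thesis
    using minus plus
    by (simp add: same_quiver_rep_def quiver_rep_of_B_module_def quiver_rep_of_gk_module_def same_vs_def
        HC0_to_RepB_def underlying_vs_def module.defs B_act_units B_act_scalar weight_in_core)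
qed

end

section \<open>Extending morphisms along weights\<close>

text \<open>One half of the odd weights, starting at 1 or at -1: \<open>P\<close> leads away from
  the start and \<open>Q\<close> back. At rung \<open>k\<close> the weight is \<open>1 + 2 k\<close>
  or \<open>- 1 - 2 k\<close>; in both cases the square in question is
  \<open>(k + 1)\<^sup>2\<close>, which is never zero.\<close>

locale ladder = complex_space V for V :: "(complex, 'u, 'x) module_scheme" (structure) +
  fixes A :: "nat \<Rightarrow> 'u set" and P Q T :: "'u \<Rightarrow> 'u" and m :: nat
  assumes A_subspace: "complex_subspace (A k) V"
    and P_hom: "P \<in> module_hom complex_field V V"
    and Q_hom: "Q \<in> module_hom complex_field V V"
    and T_hom: "T \<in> module_hom complex_field V V"
    and P_A: "v \<in> A k \<Longrightarrow> P v \<in> A (Suc k)"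
    and Q_A: "v \<in> A (Suc k) \<Longrightarrow> Q v \<in> A k"
    and T_A: "v \<in> A k \<Longrightarrow> T v \<in> A k"
    and T_nilpotent: "v \<in> carrier V \<Longrightarrow> (T ^^ m) v = \<zero>"
    and T_P: "v \<in> carrier V \<Longrightarrow> T (P v) = P (T v)"
    and Q_P: "v \<in> A k \<Longrightarrow> Q (P v) = T v \<ominus> (of_nat k + 1)\<^sup>2 \<odot> v"
    and P_Q: "v \<in> A (Suc k) \<Longrightarrow> P (Q v) = T v \<ominus> (of_nat k + 1)\<^sup>2 \<odot> v"
begin

lemma A_closed: "v \<in> A k \<Longrightarrow> v \<in> carrier V"
  by (rule subspace_closed(2)[OF A_subspace])

lemma T_eigenvector_zero:
  assumes u: "u \<in> carrier V" and c: "c \<noteq> 0" and eq: "T u = c \<odot> u"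
  shows "u = \<zero>"
proof (rule vec_eqI)
  have pow: "(T ^^ k) u = c ^ k \<odot> u" for k
  proof (induction k)
    case (Suc k)
    have "(T ^^ Suc k) u = c ^ k \<odot> (c \<odot> u)" using Suc u by (simp add: hom_smult[OF T_hom] eq)
    also have "\<dots> = c ^ Suc k \<odot> u" by (rule vec_eqI) (use u in \<open>simp_all add: dual_simps\<close>)
    finally show ?case .
  qed (use u in simp)
  fix \<phi> assume \<phi>: "\<phi> \<in> dual_space V"
  have "c ^ m * \<phi> u = 0"
    using T_nilpotent[OF u] \<phi> u by (simp add: pow flip: dual_simps(2)) (simp add: dual_simps)
  then show "\<phi> u = \<phi> \<zero>" using c \<phi> by (simp add: dual_simps)
qed (use u in auto)

text \<open>Induction on the power of \<open>T\<close> that kills \<open>v\<close>, in place of the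
  finite geometric series for the inverse of \<open>T - c\<close>: the vector \<open>T v\<close> is
  killed one power earlier, and if \<open>u\<close> solves the equation for \<open>T v\<close>, then
  \<open>(u - v) / c\<close> solves it for \<open>v\<close>.\<close>

lemma T_minus_scalar_surj:
  assumes v: "v \<in> A k" and c: "c \<noteq> 0"
  shows "\<exists>u\<in>A k. T u \<ominus> c \<odot> u = v"
proof -
  have "\<exists>u\<in>A k. T u \<ominus> c \<odot> u = v" if "v \<in> A k" "(T ^^ j) v = \<zero>" for j v
    using that
  proof (induction j arbitrary: v)
    case 0
    then show ?case
      using subspace_closed(1)[OF A_subspace] hom_zero[OF T_hom complex_space_axioms complex_space_axioms]
      by (intro bexI[of _ \<zero>]) (auto intro!: vec_eqI simp: dual_simps)
  next
    case (Suc j)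
    have vc: "v \<in> carrier V" using A_closed Suc.prems by simp
    have "(T ^^ j) (T v) = \<zero>" using Suc.prems(2) by (simp add: funpow_swap1)
    then obtain u where u: "u \<in> A k" "T u \<ominus> c \<odot> u = T v" using Suc.IH T_A[OF Suc.prems(1)] by auto
    have uc: "u \<in> carrier V" using A_closed u by simp
    have "(1 / c) \<odot> (u \<ominus> v) \<in> A k"
      using u Suc.prems by (intro subspace_closed(4)[OF A_subspace] subspace_minus[OF A_subspace])
    moreover have "T ((1 / c) \<odot> (u \<ominus> v)) \<ominus> c \<odot> ((1 / c) \<odot> (u \<ominus> v)) = v"
    proof (rule vec_eqI)
      fix \<phi> assume \<phi>: "\<phi> \<in> dual_space V"
      have "\<phi> (T u) = c * \<phi> u + \<phi> (T v)"
        unfolding u(2)[symmetric] using \<phi> uc hom_closed[OF T_hom] by (simp add: dual_simps)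
      then show "\<phi> (T ((1 / c) \<odot> (u \<ominus> v)) \<ominus> c \<odot> ((1 / c) \<odot> (u \<ominus> v))) = \<phi> v"
        using \<phi> uc vc hom_closed[OF T_hom] c
        by (simp add: dual_simps hom_smult[OF T_hom] hom_minus[OF T_hom complex_space_axioms complex_space_axioms]
            add_divide_distrib diff_divide_distrib right_diff_distrib)
    qed (use uc vc hom_closed[OF T_hom] in auto)
    ultimately show ?case by blast
  qed
  then show ?thesis using v T_nilpotent[OF A_closed[OF v]] by blast
qed

text \<open>\<open>Q P\<close> and \<open>P Q\<close> are both \<open>T\<close> minus a nonzero
  scalar. Since a nilpotent operator has no nonzero eigenvalue, \<open>Q P\<close> is injective and
  so is \<open>P\<close>; the same nilpotence makes \<open>P Q\<close>, hence \<open>P\<close>,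
  surjective.\<close>

lemma P_bij: "bij_betw P (A k) (A (Suc k))"
proof (rule bij_betwI')
  fix v w assume vw: "v \<in> A k" "w \<in> A k"
  then have c: "v \<in> carrier V" "w \<in> carrier V" "P v \<in> carrier V" "P w \<in> carrier V"
    using A_closed hom_closed[OF P_hom] by auto
  have "v = w" if "P v = P w"
  proof -
    have u: "v \<ominus> w \<in> A k" using vw by (rule subspace_minus[OF A_subspace])
    have uc: "v \<ominus> w \<in> carrier V" using A_closed[OF u] .
    have "P (v \<ominus> w) = \<zero>"
      using c that by (simp add: hom_minus[OF P_hom complex_space_axioms complex_space_axioms])
        (rule vec_eqI, simp_all add: dual_simps)
    then have Q0: "T (v \<ominus> w) \<ominus> (of_nat k + 1)\<^sup>2 \<odot> (v \<ominus> w) = \<zero>"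
      using Q_P[OF u] hom_zero[OF Q_hom complex_space_axioms complex_space_axioms] by simp
    have "T (v \<ominus> w) = (of_nat k + 1)\<^sup>2 \<odot> (v \<ominus> w)"
    proof (rule vec_eqI)
      fix \<phi> assume \<phi>: "\<phi> \<in> dual_space V"
      have "\<phi> (T (v \<ominus> w) \<ominus> (of_nat k + 1)\<^sup>2 \<odot> (v \<ominus> w)) = 0"
        unfolding Q0 using \<phi> by (simp add: dual_simps)
      moreover have "\<phi> (T (v \<ominus> w) \<ominus> (of_nat k + 1)\<^sup>2 \<odot> (v \<ominus> w)) =
          \<phi> (T (v \<ominus> w)) - \<phi> ((of_nat k + 1)\<^sup>2 \<odot> (v \<ominus> w))"
        using \<phi> uc hom_closed[OF T_hom uc] by (intro dual_simps(4)) simp_all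
      ultimately show "\<phi> (T (v \<ominus> w)) = \<phi> ((of_nat k + 1)\<^sup>2 \<odot> (v \<ominus> w))" by simp
    qed (use uc hom_closed[OF T_hom uc] in simp_all)
    moreover have "(of_nat k + 1 :: complex)\<^sup>2 \<noteq> 0"
      using of_nat_neq_0[of k, where 'a=complex] by (simp add: add.commute)
    ultimately have "v \<ominus> w = \<zero>" by (intro T_eigenvector_zero[OF uc, of "(of_nat k + 1)\<^sup>2"])
    show "v = w"
    proof (rule vec_eqI)
      fix \<phi> assume \<phi>: "\<phi> \<in> dual_space V"
      have "\<phi> (v \<ominus> w) = 0" unfolding \<open>v \<ominus> w = \<zero>\<close> using \<phi> by (simp add: dual_simps)
      then show "\<phi> v = \<phi> w" using \<phi> c by (simp add: dual_simps)
    qed (use c in auto)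
  qed
  then show "(P v = P w) = (v = w)" by blast
next
  fix w assume w: "w \<in> A (Suc k)"
  have "(of_nat k + 1 :: complex)\<^sup>2 \<noteq> 0"
    using of_nat_neq_0[of k, where 'a=complex] by (simp add: add.commute)
  then obtain u where u: "u \<in> A (Suc k)" "T u \<ominus> (of_nat k + 1)\<^sup>2 \<odot> u = w"
    using T_minus_scalar_surj[OF w] by blast
  show "\<exists>v\<in>A k. w = P v"
    using P_Q[OF u(1)] u(2) Q_A[OF u(1)] by (intro bexI[of _ "Q u"]) simp_all
qed (rule P_A)

definition P_inv :: "nat \<Rightarrow> 'u \<Rightarrow> 'u" where
  "P_inv k = inv_into (A k) P"

lemma P_inv:
  assumes "w \<in> A (Suc k)"
  shows "P_inv k w \<in> A k" "P (P_inv k w) = w"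
  using assms P_bij[of k] unfolding P_inv_def bij_betw_def
  by (auto intro: inv_into_into f_inv_into_f)

lemma P_inv_P: "v \<in> A k \<Longrightarrow> P_inv k (P v) = v"
  using P_bij[of k] unfolding P_inv_def bij_betw_def by (auto intro: inv_into_f_f)

end

text \<open>The map \<open>g\<close> matters on the bottom rung only, where it is compatible with
  \<open>T\<close>. It is carried upwards by \<open>P\<close>, which is invertible between the rungs
  of the source.\<close>

locale ladder_pair = M: ladder V A P Q T m + N: ladder V' A' P' Q' T' m'
  for V :: "(complex, 'u, 'x) module_scheme" and A P Q T m
  and V' :: "(complex, 'v, 'y) module_scheme" and A' P' Q' T' m' +
  fixes g :: "'u \<Rightarrow> 'v"
  assumes g_A: "v \<in> A 0 \<Longrightarrow> g v \<in> A' 0"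
    and g_add: "v \<in> A 0 \<Longrightarrow> w \<in> A 0 \<Longrightarrow> g (v \<oplus>\<^bsub>V\<^esub> w) = g v \<oplus>\<^bsub>V'\<^esub> g w"
    and g_smult: "v \<in> A 0 \<Longrightarrow> g (c \<odot>\<^bsub>V\<^esub> v) = c \<odot>\<^bsub>V'\<^esub> g v"
    and g_T: "v \<in> A 0 \<Longrightarrow> g (T v) = T' (g v)"
begin

primrec F :: "nat \<Rightarrow> 'u \<Rightarrow> 'v" where
  "F 0 = g" | "F (Suc k) = (\<lambda>w. P' (F k (M.P_inv k w)))"

lemma F_P: "v \<in> A k \<Longrightarrow> F (Suc k) (P v) = P' (F k v)"
  by (simp add: M.P_inv_P)

lemma F_A: "v \<in> A k \<Longrightarrow> F k v \<in> A' k"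
proof (induction k arbitrary: v)
  case (Suc k)
  then show ?case using M.P_inv(1)[OF Suc.prems] N.P_A by simp
qed (simp add: g_A)

lemma F_linear:
  "v \<in> A k \<Longrightarrow> w \<in> A k \<Longrightarrow> F k (v \<oplus>\<^bsub>V\<^esub> w) = F k v \<oplus>\<^bsub>V'\<^esub> F k w"
  "v \<in> A k \<Longrightarrow> F k (c \<odot>\<^bsub>V\<^esub> v) = c \<odot>\<^bsub>V'\<^esub> F k v"
proof (induction k arbitrary: v w)
  case (Suc k)
  {
    case 1
    let ?v = "M.P_inv k v" and ?w = "M.P_inv k w"
    note v = M.P_inv[OF 1(1)] and w = M.P_inv[OF 1(2)]
    have "F (Suc k) (P (?v \<oplus>\<^bsub>V\<^esub> ?w)) = P' (F k (?v \<oplus>\<^bsub>V\<^esub> ?w))"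
      by (rule F_P) (use v w M.subspace_closed(3)[OF M.A_subspace] in auto)
    also have "\<dots> = P' (F k ?v) \<oplus>\<^bsub>V'\<^esub> P' (F k ?w)"
      using Suc.IH(1)[OF v(1) w(1)] hom_add[OF N.P_hom] N.A_closed[OF F_A] v(1) w(1) by simp
    also have "P (?v \<oplus>\<^bsub>V\<^esub> ?w) = v \<oplus>\<^bsub>V\<^esub> w"
      using v w hom_add[OF M.P_hom] M.A_closed by simp
    finally show ?case by simp
  next
    case 2
    let ?v = "M.P_inv k v"
    note v = M.P_inv[OF 2]
    have "F (Suc k) (P (c \<odot>\<^bsub>V\<^esub> ?v)) = P' (F k (c \<odot>\<^bsub>V\<^esub> ?v))"
      by (rule F_P) (use v M.subspace_closed(4)[OF M.A_subspace] in auto)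
    also have "\<dots> = c \<odot>\<^bsub>V'\<^esub> P' (F k ?v)"
      using Suc.IH(2)[OF v(1)] hom_smult[OF N.P_hom] N.A_closed[OF F_A] v(1) by simp
    also have "P (c \<odot>\<^bsub>V\<^esub> ?v) = c \<odot>\<^bsub>V\<^esub> v"
      using v hom_smult[OF M.P_hom] M.A_closed by simp
    finally show ?case by simp
  }
qed (simp_all add: g_add g_smult)

lemma F_T: "v \<in> A k \<Longrightarrow> F k (T v) = T' (F k v)"
proof (induction k arbitrary: v)
  case (Suc k)
  let ?v = "M.P_inv k v"
  note v = M.P_inv[OF Suc.prems]
  have "F (Suc k) (P (T ?v)) = P' (F k (T ?v))" by (rule F_P) (use v M.T_A in simp)
  also have "\<dots> = T' (P' (F k ?v))"
    using Suc.IH[OF v(1)] N.T_P[OF N.A_closed[OF F_A[OF v(1)]]] by simp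
  also have "P (T ?v) = T v" using M.T_P[OF M.A_closed[OF v(1)]] v(2) by simp
  finally show ?case by simp
qed (simp add: g_T)

text \<open>The recursion enforces compatibility with \<open>P\<close> alone. For \<open>Q\<close>
  it follows because \<open>Q P\<close> is \<open>T - (k + 1)\<^sup>2\<close> on both ladders and
  \<open>F k\<close> commutes with \<open>T\<close>.\<close>

lemma F_Q:
  assumes w: "w \<in> A (Suc k)"
  shows "Q' (F (Suc k) w) = F k (Q w)"
proof -
  let ?v = "M.P_inv k w"
  note v = M.P_inv[OF w]
  have "Q' (F (Suc k) w) = T' (F k ?v) \<ominus>\<^bsub>V'\<^esub> (of_nat k + 1)\<^sup>2 \<odot>\<^bsub>V'\<^esub> F k ?v"
    using N.Q_P[OF F_A[OF v(1)]] by simp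
  also have "\<dots> = F k (T ?v) \<oplus>\<^bsub>V'\<^esub> (- ((of_nat k + 1)\<^sup>2)) \<odot>\<^bsub>V'\<^esub> F k ?v"
    unfolding F_T[OF v(1)] using N.A_closed[OF F_A[OF v(1)]] hom_closed[OF N.T_hom]
    by (intro N.vec_eqI) (simp_all add: N.dual_simps)
  also have "\<dots> = F k (T ?v \<oplus>\<^bsub>V\<^esub> (- ((of_nat k + 1)\<^sup>2)) \<odot>\<^bsub>V\<^esub> ?v)"
    using F_linear M.T_A[OF v(1)] v(1) M.subspace_closed(4)[OF M.A_subspace] by simp
  also have "T ?v \<oplus>\<^bsub>V\<^esub> (- ((of_nat k + 1)\<^sup>2)) \<odot>\<^bsub>V\<^esub> ?v = Q (P ?v)"
    unfolding M.Q_P[OF v(1)] using M.A_closed[OF v(1)] hom_closed[OF M.T_hom]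
    by (intro M.vec_eqI) (simp_all add: M.dual_simps)
  finally show ?thesis using v(2) by simp
qed

end

section \<open>The two ladders of odd weights\<close>

context HC0_module
begin

lemma ladder_plus: "ladder M (\<lambda>k. weight_space M (1 + 2 * int k)) X Y T (nil_exp M)"
proof (intro ladder.intro ladder_axioms.intro complex_space_axioms weight_space_subspace
    gact_linear generators_in_sl2 T_hom nilpotent T_weight)
  fix k v
  show "X v \<in> weight_space M (1 + 2 * int (Suc k))" if "v \<in> weight_space M (1 + 2 * int k)"
    using X_weight[OF that] by (simp add: algebra_simps)
  show "Y v \<in> weight_space M (1 + 2 * int k)" if "v \<in> weight_space M (1 + 2 * int (Suc k))"
    using Y_weight[OF that] by (simp add: algebra_simps)
  have eq: "((of_int (1 + 2 * int k) + 1) / 2 :: complex) = of_nat k + 1"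
    "((of_int (1 + 2 * int (Suc k)) - 1) / 2 :: complex) = of_nat k + 1"
    by simp_all
  show "Y (X v) = T v \<ominus> (of_nat k + 1)\<^sup>2 \<odot> v" if "v \<in> weight_space M (1 + 2 * int k)"
    using XY_weight(2)[OF that] unfolding eq .
  show "X (Y v) = T v \<ominus> (of_nat k + 1)\<^sup>2 \<odot> v" if "v \<in> weight_space M (1 + 2 * int (Suc k))"
    using XY_weight(1)[OF that] unfolding eq .
qed (simp_all add: T_commutes)

lemma ladder_minus: "ladder M (\<lambda>k. weight_space M (- 1 - 2 * int k)) Y X T (nil_exp M)"
proof (intro ladder.intro ladder_axioms.intro complex_space_axioms weight_space_subspace
    gact_linear generators_in_sl2 T_hom nilpotent T_weight)
  fix k v
  show "Y v \<in> weight_space M (- 1 - 2 * int (Suc k))" if "v \<in> weight_space M (- 1 - 2 * int k)"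
    using Y_weight[OF that] by (simp add: algebra_simps)
  show "X v \<in> weight_space M (- 1 - 2 * int k)" if "v \<in> weight_space M (- 1 - 2 * int (Suc k))"
    using X_weight[OF that] by (simp add: algebra_simps)
  have eq: "((of_int (- 1 - 2 * int k) - 1) / 2 :: complex) = - (of_nat k + 1)"
    "((of_int (- 1 - 2 * int (Suc k)) + 1) / 2 :: complex) = - (of_nat k + 1)"
    by simp_all
  show "X (Y v) = T v \<ominus> (of_nat k + 1)\<^sup>2 \<odot> v" if "v \<in> weight_space M (- 1 - 2 * int k)"
    using XY_weight(1)[OF that] unfolding eq power2_minus .
  show "Y (X v) = T v \<ominus> (of_nat k + 1)\<^sup>2 \<odot> v" if "v \<in> weight_space M (- 1 - 2 * int (Suc k))"
    using XY_weight(2)[OF that] unfolding eq power2_minus .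
qed (simp_all add: T_commutes)

lemma odd_weight_cases:
  assumes "odd (n::int)"
  obtains (plus) k where "n = 1 + 2 * int k" | (minus) k where "n = - 1 - 2 * int k"
proof -
  obtain j where j: "n = 2 * j + 1" using assms by (elim oddE)
  show thesis
  proof (cases "j \<ge> 0")
    case True
    then show thesis using j by (intro plus[of "nat j"]) simp
  next
    case False
    then show thesis using j by (intro minus[of "nat (- j - 1)"]) simp
  qed
qed

end

section \<open>Restriction of morphisms to the core; faithfulness\<close>

lemma gk_homD:
  assumes "f \<in> gk_hom M N"
  shows "f \<in> extensional (carrier M)" "f \<in> module_hom complex_field M N"
    "\<And>Z v. Z \<in> sl2 \<Longrightarrow> v \<in> carrier M \<Longrightarrow> f (gact M Z v) = gact N Z (f v)"
    "\<And>k v. k \<in> SO2 \<Longrightarrow> v \<in> carrier M \<Longrightarrow> f (kact M k v) = kact N k (f v)"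
  using assms unfolding gk_hom_def by auto

locale HC0_pair = M: HC0_module M + N: HC0_module N for M N :: "'u gk_module"
begin

lemma intertwiner_weight:
  assumes f: "f \<in> module_hom complex_field M N"
    and H: "\<And>v. v \<in> carrier M \<Longrightarrow> f (gact M H_mat v) = gact N H_mat (f v)"
    and v: "v \<in> weight_space M n"
  shows "f v \<in> weight_space N n"
  using v H[of v] hom_closed[OF f, of v] by (simp add: M.weight_space_iff N.weight_space_iff hom_smult[OF f])

context
  fixes f assumes f: "f \<in> gk_hom M N"
begin

lemmas f_hom = gk_homD(2)[OF f]
lemmas f_gact = gk_homD(3)[OF f]

lemma f_closed: "v \<in> carrier M \<Longrightarrow> f v \<in> carrier N"
  by (rule hom_closed[OF f_hom])

lemma f_weight: "v \<in> weight_space M n \<Longrightarrow> f v \<in> weight_space N n"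
  by (rule intertwiner_weight[OF f_hom]) (simp_all add: f_gact)

lemma f_zero: "f \<zero>\<^bsub>M\<^esub> = \<zero>\<^bsub>N\<^esub>"
  by (rule hom_zero[OF f_hom M.complex_space_axioms N.complex_space_axioms])

lemma f_proj: "v \<in> carrier M \<Longrightarrow> f (weight_proj M n v) = weight_proj N n (f v)"
proof (rule M.hom_eqI[OF hom_comp[OF f_hom M.proj_hom] hom_comp[OF N.proj_hom f_hom] N.complex_space_axioms])
  fix k v assume kv: "k \<in> {n. odd n}" "v \<in> weight_space M k"
  show "f (weight_proj M n v) = weight_proj N n (f v)"
    using M.proj_homogeneous[OF kv] N.proj_homogeneous[OF kv(1) f_weight[OF kv(2)]] by (simp add: f_zero)
qed

lemma f_core: "v \<in> core M \<Longrightarrow> f v \<in> core N"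
  by (simp add: M.core_iff N.core_iff f_closed f_zero flip: f_proj)

lemma restrict_B_hom: "restrict f (core M) \<in> B_hom (HC0_to_RepB M) (HC0_to_RepB N)"
proof -
  interpret BM: B_module "HC0_to_RepB M" by (simp add: B_module_def M.left_module)
  interpret BN: B_module "HC0_to_RepB N" by (simp add: B_module_def N.left_module)
  have carrier: "carrier (HC0_to_RepB M) = core M" "carrier (HC0_to_RepB N) = core N"
    by (simp_all add: HC0_to_RepB_def)
  have "restrict f (core M) \<in> module_hom B_ring (HC0_to_RepB M) (HC0_to_RepB N)"
  proof (rule B_hom_of_quiver_hom)
    show "restrict f (core M) \<in> module_hom complex_field (underlying_vs (HC0_to_RepB M)) (underlying_vs (HC0_to_RepB N))"
      unfolding module_hom_iff BM.underlying_simps BN.underlying_simps carrier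
      by (simp add: HC0_to_RepB_def M.B_act_scalar N.B_act_scalar f_core M.B_act_core module_homD[OF f_hom]
        M.subspace_closed[OF M.core_subspace])
    fix v assume "v \<in> carrier (HC0_to_RepB M)"
    then have v: "v \<in> core M" "v \<in> carrier M" by (simp_all add: HC0_to_RepB_def)
    have r: "restrict f (core M) (B_act M P v) = f (B_act M P v)" "restrict f (core M) v = f v" for P
      using v M.B_act_core[OF v(2)] by simp_all
    have act: "P \<odot>\<^bsub>HC0_to_RepB M\<^esub> w = B_act M P w" "P \<odot>\<^bsub>HC0_to_RepB N\<^esub> w = B_act N P w" for P w
      by (simp_all add: HC0_to_RepB_def)
    show "restrict f (core M) (E11 \<odot>\<^bsub>HC0_to_RepB M\<^esub> v) = E11 \<odot>\<^bsub>HC0_to_RepB N\<^esub> restrict f (core M) v"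
      "restrict f (core M) (E22 \<odot>\<^bsub>HC0_to_RepB M\<^esub> v) = E22 \<odot>\<^bsub>HC0_to_RepB N\<^esub> restrict f (core M) v"
      "restrict f (core M) (E21 \<odot>\<^bsub>HC0_to_RepB M\<^esub> v) = E21 \<odot>\<^bsub>HC0_to_RepB N\<^esub> restrict f (core M) v"
      "restrict f (core M) (tE12 \<odot>\<^bsub>HC0_to_RepB M\<^esub> v) = tE12 \<odot>\<^bsub>HC0_to_RepB N\<^esub> restrict f (core M) v"
      unfolding act r using v(2) f_closed[OF v(2)]
      by (simp_all only: M.B_act_units N.B_act_units f_gact f_proj generators_in_sl2 M.proj_closed)
  qed (simp_all add: M.left_module N.left_module M.HC0_to_RepB_finite_dimensional N.HC0_to_RepB_finite_dimensional)
  then show ?thesis by (simp add: B_hom_def carrier)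
qed

end

text \<open>By surjectivity along the ladders, powers of \<open>X\<close> applied to weight 1 and
  powers of \<open>Y\<close> applied to weight -1 reach every odd weight, and \<open>f\<close> and
  \<open>f'\<close> commute with both operators.\<close>

lemma gk_hom_eqI:
  assumes f: "f \<in> gk_hom M N" and f': "f' \<in> gk_hom M N" and eq: "\<And>v. v \<in> core M \<Longrightarrow> f v = f' v"
  shows "f = f'"
proof (rule extensionalityI[OF gk_homD(1)[OF f] gk_homD(1)[OF f']])
  interpret plus: ladder M "\<lambda>k. weight_space M (1 + 2 * int k)" "gact M X_mat" "gact M Y_mat"
    "shifted_casimir M" "nil_exp M" by (rule M.ladder_plus)
  interpret minus: ladder M "\<lambda>k. weight_space M (- 1 - 2 * int k)" "gact M Y_mat" "gact M X_mat"
    "shifted_casimir M" "nil_exp M" by (rule M.ladder_minus)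
  have P: "f v = f' v" if "v \<in> weight_space M (1 + 2 * int k)" for k v
    using that
  proof (induction k arbitrary: v)
    case 0
    then show ?case using eq[of v] M.weight_in_core[of v] by simp
  next
    case (Suc k)
    note w = plus.P_inv[OF Suc.prems]
    show ?case
      using Suc.IH[OF w(1)] gk_homD(3)[OF f, of X_mat "plus.P_inv k v"] gk_homD(3)[OF f', of X_mat "plus.P_inv k v"] w by simp
  qed
  have Q: "f v = f' v" if "v \<in> weight_space M (- 1 - 2 * int k)" for k v
    using that
  proof (induction k arbitrary: v)
    case 0
    then show ?case using eq[of v] M.weight_in_core[of v] by simp
  next
    case (Suc k)
    note w = minus.P_inv[OF Suc.prems]
    show ?case
      using Suc.IH[OF w(1)] gk_homD(3)[OF f, of Y_mat "minus.P_inv k v"] gk_homD(3)[OF f', of Y_mat "minus.P_inv k v"] w by simp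
  qed
  fix v assume "v \<in> carrier M"
  then show "f v = f' v"
  proof (rule M.hom_eqI[OF gk_homD(2)[OF f] gk_homD(2)[OF f'] N.complex_space_axioms, rotated])
    fix n v assume n: "n \<in> {n. odd n}" and v: "v \<in> weight_space M n"
    from n have "odd n" by simp
    then show "f v = f' v"
      by (rule M.odd_weight_cases) (use v P Q in auto)
  qed
qed

section \<open>Extension of a map given on the core; fullness\<close>

context
  fixes g assumes g: "g \<in> B_hom (HC0_to_RepB M) (HC0_to_RepB N)"
begin

lemma g_extensional: "g \<in> extensional (core M)"
  using g by (simp add: B_hom_def HC0_to_RepB_def)

lemma g_core: "v \<in> core M \<Longrightarrow> g v \<in> core N"
  using g by (auto simp: B_hom_def HC0_to_RepB_def module_hom_def)

lemma g_add: "\<lbrakk>v \<in> core M; w \<in> core M\<rbrakk> \<Longrightarrow> g (v \<oplus>\<^bsub>M\<^esub> w) = g v \<oplus>\<^bsub>N\<^esub> g w"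
  using g by (auto simp: B_hom_def HC0_to_RepB_def module_hom_def)

lemma g_act: "\<lbrakk>v \<in> core M; P \<in> carrier B_ring\<rbrakk> \<Longrightarrow> g (B_act M P v) = B_act N P (g v)"
  using g by (auto simp: B_hom_def HC0_to_RepB_def module_hom_def)

lemma g_smult: "v \<in> core M \<Longrightarrow> g (c \<odot>\<^bsub>M\<^esub> v) = c \<odot>\<^bsub>N\<^esub> g v"
  using g_act[of v "mat (fps_const c)"] by (simp add: M.B_act_scalar N.B_act_scalar g_core)

lemma g_proj: "v \<in> core M \<Longrightarrow> g (weight_proj M (-1) v) = weight_proj N (-1) (g v)"
    "v \<in> core M \<Longrightarrow> g (weight_proj M 1 v) = weight_proj N 1 (g v)"
  using g_act[of v E11] g_act[of v E22] g_core[of v] by (simp_all add: M.B_act_units N.B_act_units)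

lemma g_weight:
  "v \<in> weight_space M (-1) \<Longrightarrow> g v \<in> weight_space N (-1)"
  "v \<in> weight_space M 1 \<Longrightarrow> g v \<in> weight_space N 1"
  using g_proj[of v] M.proj_homogeneous[of "-1" v "-1"] M.proj_homogeneous[of 1 v 1] M.weight_in_core[of v]
    N.proj_weight[of "g v"] g_core[of v] by auto

lemma g_X: "v \<in> weight_space M (-1) \<Longrightarrow> g (gact M X_mat v) = gact N X_mat (g v)"
  using g_act[of v E21] M.weight_in_core[of v] g_core[of v] g_weight(1)[of v]
    M.proj_homogeneous[of "-1" v "-1"] N.proj_homogeneous[of "-1" "g v" "-1"]
  by (simp add: M.B_act_units N.B_act_units)

lemma g_Y: "v \<in> weight_space M 1 \<Longrightarrow> g (gact M Y_mat v) = gact N Y_mat (g v)"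
  using g_act[of v tE12] M.weight_in_core[of v] g_core[of v] g_weight(2)[of v]
    M.proj_homogeneous[of 1 v 1] N.proj_homogeneous[of 1 "g v" 1]
  by (simp add: M.B_act_units N.B_act_units)

text \<open>Supplies the hypothesis on \<open>T\<close> that the ladders ask for: at weights -1 and
  1 the operator \<open>T\<close> is a composite of the two arrows, \<open>Y X\<close> and
  \<open>X Y\<close>.\<close>

lemma g_T:
  "v \<in> weight_space M (-1) \<Longrightarrow> g (shifted_casimir M v) = shifted_casimir N (g v)"
  "v \<in> weight_space M 1 \<Longrightarrow> g (shifted_casimir M v) = shifted_casimir N (g v)"
  using M.X_weight[of v "-1"] M.Y_weight[of v 1]
  by (simp_all add: M.YX_minus[symmetric] N.YX_minus[symmetric] M.XY_plus[symmetric] N.XY_plus[symmetric]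
      g_weight g_X g_Y)

lemma ladder_pair_plus: "ladder_pair M (\<lambda>k. weight_space M (1 + 2 * int k)) (gact M X_mat) (gact M Y_mat)
    (shifted_casimir M) (nil_exp M)
    N (\<lambda>k. weight_space N (1 + 2 * int k)) (gact N X_mat) (gact N Y_mat) (shifted_casimir N) (nil_exp N) g"
  by (intro ladder_pair.intro ladder_pair_axioms.intro M.ladder_plus N.ladder_plus)
    (simp_all add: g_weight g_add g_smult g_T M.weight_in_core)

lemma ladder_pair_minus: "ladder_pair M (\<lambda>k. weight_space M (- 1 - 2 * int k)) (gact M Y_mat) (gact M X_mat)
    (shifted_casimir M) (nil_exp M)
    N (\<lambda>k. weight_space N (- 1 - 2 * int k)) (gact N Y_mat) (gact N X_mat) (shifted_casimir N) (nil_exp N) g"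
  by (intro ladder_pair.intro ladder_pair_axioms.intro M.ladder_minus N.ladder_minus)
    (simp_all add: g_weight g_add g_smult g_T M.weight_in_core)

interpretation plus: ladder_pair M "\<lambda>k. weight_space M (1 + 2 * int k)" "gact M X_mat" "gact M Y_mat"
    "shifted_casimir M" "nil_exp M"
    N "\<lambda>k. weight_space N (1 + 2 * int k)" "gact N X_mat" "gact N Y_mat" "shifted_casimir N" "nil_exp N" g
  by (rule ladder_pair_plus)

interpretation minus: ladder_pair M "\<lambda>k. weight_space M (- 1 - 2 * int k)" "gact M Y_mat" "gact M X_mat"
    "shifted_casimir M" "nil_exp M"
    N "\<lambda>k. weight_space N (- 1 - 2 * int k)" "gact N Y_mat" "gact N X_mat" "shifted_casimir N" "nil_exp N" g
  by (rule ladder_pair_minus)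

text \<open>\<open>(n - 1) div 2\<close> and \<open>(- n - 1) div 2\<close> recover the rung from
  the weights \<open>n = 1 + 2 k\<close> and \<open>n = - 1 - 2 k\<close>.\<close>

definition ext_weight :: "int \<Rightarrow> 'u \<Rightarrow> 'u" where
  "ext_weight n = (if n > 0 then plus.F (nat ((n - 1) div 2)) else minus.F (nat ((- n - 1) div 2)))"

lemma ext_weight_simps:
  "ext_weight (1 + 2 * int k) = plus.F k" "ext_weight (- 1 - 2 * int k) = minus.F k"
  by (simp_all add: ext_weight_def)

lemma ext_weight_in: "odd n \<Longrightarrow> v \<in> weight_space M n \<Longrightarrow> ext_weight n v \<in> weight_space N n"
  by (erule M.odd_weight_cases) (simp_all add: ext_weight_simps plus.F_A minus.F_A)

lemma ext_weight_linear:
  assumes "odd n" "v \<in> weight_space M n"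
  shows "w \<in> weight_space M n \<Longrightarrow> ext_weight n (v \<oplus>\<^bsub>M\<^esub> w) = ext_weight n v \<oplus>\<^bsub>N\<^esub> ext_weight n w"
    "ext_weight n (c \<odot>\<^bsub>M\<^esub> v) = c \<odot>\<^bsub>N\<^esub> ext_weight n v"
  by (rule M.odd_weight_cases[OF assms(1)];
      use assms(2) in \<open>simp add: ext_weight_simps plus.F_linear minus.F_linear\<close>)+

lemma ext_weight_zero: "odd n \<Longrightarrow> ext_weight n \<zero>\<^bsub>M\<^esub> = \<zero>\<^bsub>N\<^esub>"
proof -
  assume n: "odd n"
  have z: "\<zero>\<^bsub>M\<^esub> \<in> weight_space M n" by (rule M.subspace_closed(1)[OF M.weight_space_subspace])
  have "ext_weight n (0 \<odot>\<^bsub>M\<^esub> \<zero>\<^bsub>M\<^esub>) = 0 \<odot>\<^bsub>N\<^esub> ext_weight n \<zero>\<^bsub>M\<^esub>"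
    by (rule ext_weight_linear(2)[OF n z])
  then show ?thesis using N.weight_closed[OF ext_weight_in[OF n z]] by simp
qed

text \<open>On positive weights \<open>X\<close> is the map \<open>P\<close> of the recursion; below
  -1 it is the return map \<open>Q\<close>, so that \<open>F_Q\<close> is needed. From -1 to 1 it
  crosses from one ladder to the other, and there it is an arrow preserved by \<open>g\<close>. For
  \<open>Y\<close> the roles of the ladders are exchanged.\<close>

lemma ext_weight_X:
  assumes n: "odd n" and v: "v \<in> weight_space M n"
  shows "ext_weight (n + 2) (gact M X_mat v) = gact N X_mat (ext_weight n v)"
  using n
proof (cases rule: M.odd_weight_cases)
  case (plus k)
  have "n + 2 = 1 + 2 * int (Suc k)" using plus by simp
  then show ?thesis using plus v plus.F_P[of v k] by (simp only: ext_weight_simps)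
next
  case (minus k)
  show ?thesis
  proof (cases k)
    case 0
    then have "n + 2 = 1 + 2 * int 0" "n = - 1 - 2 * int 0" using minus by simp_all
    then show ?thesis using v g_X[of v] by (simp only: ext_weight_simps plus.F.simps minus.F.simps) simp
  next
    case (Suc j)
    then have "n + 2 = - 1 - 2 * int j" "n = - 1 - 2 * int (Suc j)" using minus by simp_all
    then show ?thesis using v minus.F_Q[of v j] by (simp only: ext_weight_simps)
  qed
qed

lemma ext_weight_Y:
  assumes n: "odd n" and v: "v \<in> weight_space M n"
  shows "ext_weight (n - 2) (gact M Y_mat v) = gact N Y_mat (ext_weight n v)"
  using n
proof (cases rule: M.odd_weight_cases)
  case (minus k)
  have "n - 2 = - 1 - 2 * int (Suc k)" using minus by simp
  then show ?thesis using minus v minus.F_P[of v k] by (simp only: ext_weight_simps)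
next
  case (plus k)
  show ?thesis
  proof (cases k)
    case 0
    then have "n - 2 = - 1 - 2 * int 0" "n = 1 + 2 * int 0" using plus by simp_all
    then show ?thesis using v g_Y[of v] by (simp only: ext_weight_simps plus.F.simps minus.F.simps) simp
  next
    case (Suc j)
    then have "n - 2 = 1 + 2 * int j" "n = 1 + 2 * int (Suc j)" using plus by simp_all
    then show ?thesis using v plus.F_Q[of v j] by (simp only: ext_weight_simps)
  qed
qed

definition extension :: "'u \<Rightarrow> 'u" where
  "extension v = finsum N (\<lambda>n. ext_weight n (weight_proj M n v)) {n. weight_proj M n v \<noteq> \<zero>\<^bsub>M\<^esub>}"

lemma ext_summand: "odd n \<Longrightarrow> v \<in> carrier M \<Longrightarrow> ext_weight n (weight_proj M n v) \<in> carrier N"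
  using ext_weight_in[of n "weight_proj M n v"] M.proj_in[of n v] by simp

lemma support_odd: "v \<in> carrier M \<Longrightarrow> n \<in> {n. weight_proj M n v \<noteq> \<zero>\<^bsub>M\<^esub>} \<Longrightarrow> odd n"
  using M.proj_outside[of n v] by auto

text \<open>Comparing \<open>extension\<close> at \<open>x\<close>, \<open>y\<close> and their sum
  requires a common range of summation, as the supports differ; the additional terms are
  zero.\<close>

lemma ext_finsum:
  assumes v: "v \<in> carrier M" and A: "finite A" "{n. weight_proj M n v \<noteq> \<zero>\<^bsub>M\<^esub>} \<subseteq> A" "\<And>n. n \<in> A \<Longrightarrow> odd n"
  shows "extension v = finsum N (\<lambda>n. ext_weight n (weight_proj M n v)) A"
  unfolding extension_def
  by (rule N.finsum_mono_neutral[symmetric]) (use A v in \<open>auto simp: ext_summand ext_weight_zero\<close>)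

lemma ext_closed: "v \<in> carrier M \<Longrightarrow> extension v \<in> carrier N"
  unfolding extension_def by (rule N.finsum_closed) (rule ext_summand[OF support_odd])

lemma dual_ext:
  assumes "\<phi> \<in> dual_space N" "v \<in> carrier M" "finite A" "{n. weight_proj M n v \<noteq> \<zero>\<^bsub>M\<^esub>} \<subseteq> A" "\<And>n. n \<in> A \<Longrightarrow> odd n"
  shows "\<phi> (extension v) = (\<Sum>n\<in>A. \<phi> (ext_weight n (weight_proj M n v)))"
  using N.dual_finsum[OF assms(1), of A "\<lambda>n. ext_weight n (weight_proj M n v)"]
    ext_summand[OF assms(5,2)] ext_finsum[OF assms(2,3,4,5)] by simp

lemma ext_hom: "extension \<in> module_hom complex_field M N"
  unfolding module_hom_iff
proof (intro conjI ballI allI)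
  fix x y c assume x: "x \<in> carrier M" and y: "y \<in> carrier M"
  let ?S = "\<lambda>x. {n. weight_proj M n x \<noteq> \<zero>\<^bsub>M\<^esub>}"
  note po = M.proj_in[OF CollectI]
  have odd: "odd n" if "n \<in> ?S x \<union> ?S y" for n using that support_odd[OF x] support_odd[OF y] by blast
  have fin: "finite (?S x \<union> ?S y)" using M.finite_support x y by simp
  show "extension (x \<oplus>\<^bsub>M\<^esub> y) = extension x \<oplus>\<^bsub>N\<^esub> extension y"
  proof (rule N.vec_eqI)
    fix \<phi> assume \<phi>: "\<phi> \<in> dual_space N"
    have S: "?S (x \<oplus>\<^bsub>M\<^esub> y) \<subseteq> ?S x \<union> ?S y" using x y by (auto simp: hom_add[OF M.proj_hom])
    have "\<phi> (extension (x \<oplus>\<^bsub>M\<^esub> y)) = (\<Sum>n\<in>?S x \<union> ?S y. \<phi> (ext_weight n (weight_proj M n (x \<oplus>\<^bsub>M\<^esub> y))))"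
      by (rule dual_ext[OF \<phi> _ fin S odd]) (simp_all add: x y)
    also have "\<dots> = (\<Sum>n\<in>?S x \<union> ?S y. \<phi> (ext_weight n (weight_proj M n x)) + \<phi> (ext_weight n (weight_proj M n y)))"
    proof (rule sum.cong[OF refl])
      fix n assume "n \<in> ?S x \<union> ?S y"
      note n = odd[OF this]
      show "\<phi> (ext_weight n (weight_proj M n (x \<oplus>\<^bsub>M\<^esub> y))) =
          \<phi> (ext_weight n (weight_proj M n x)) + \<phi> (ext_weight n (weight_proj M n y))"
        using \<phi> x y ext_weight_linear(1)[OF n po[OF n x] po[OF n y]] ext_summand[OF n x] ext_summand[OF n y]
        by (simp add: hom_add[OF M.proj_hom] N.dual_simps)
    qed
    also have "\<dots> = \<phi> (extension x) + \<phi> (extension y)"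
      using dual_ext[OF \<phi> x fin _ odd] dual_ext[OF \<phi> y fin _ odd] by (simp add: sum.distrib)
    finally show "\<phi> (extension (x \<oplus>\<^bsub>M\<^esub> y)) = \<phi> (extension x \<oplus>\<^bsub>N\<^esub> extension y)"
      using \<phi> ext_closed x y by (simp add: N.dual_simps)
  qed (use x y ext_closed in auto)
  show "extension (c \<odot>\<^bsub>M\<^esub> x) = c \<odot>\<^bsub>N\<^esub> extension x"
  proof (rule N.vec_eqI)
    fix \<phi> assume \<phi>: "\<phi> \<in> dual_space N"
    have S: "?S (c \<odot>\<^bsub>M\<^esub> x) \<subseteq> ?S x" using x by (auto simp: hom_smult[OF M.proj_hom])
    have fin: "finite (?S x)" using M.finite_support x by simp
    have "\<phi> (extension (c \<odot>\<^bsub>M\<^esub> x)) = (\<Sum>n\<in>?S x. \<phi> (ext_weight n (weight_proj M n (c \<odot>\<^bsub>M\<^esub> x))))"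
      by (rule dual_ext[OF \<phi> _ fin S support_odd[OF x]]) (simp_all add: x)
    also have "\<dots> = (\<Sum>n\<in>?S x. c * \<phi> (ext_weight n (weight_proj M n x)))"
    proof (rule sum.cong[OF refl])
      fix n assume "n \<in> ?S x"
      note n = support_odd[OF x this]
      show "\<phi> (ext_weight n (weight_proj M n (c \<odot>\<^bsub>M\<^esub> x))) = c * \<phi> (ext_weight n (weight_proj M n x))"
        using \<phi> x ext_weight_linear(2)[OF n po[OF n x]] ext_summand[OF n x]
        by (simp add: hom_smult[OF M.proj_hom] N.dual_simps)
    qed
    also have "\<dots> = c * \<phi> (extension x)"
      using dual_ext[OF \<phi> x fin order_refl support_odd[OF x]] by (simp add: sum_distrib_left)
    finally show "\<phi> (extension (c \<odot>\<^bsub>M\<^esub> x)) = \<phi> (c \<odot>\<^bsub>N\<^esub> extension x)"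
      using \<phi> ext_closed x by (simp add: N.dual_simps)
  qed (use x ext_closed in auto)
qed (rule ext_closed)

lemma ext_on_weight:
  assumes n: "odd n" and v: "v \<in> weight_space M n"
  shows "extension v = ext_weight n v"
proof (rule N.vec_eqI)
  have p: "weight_proj M m v = (if m = n then v else \<zero>\<^bsub>M\<^esub>)" for m
    using M.proj_homogeneous[of n v m] n v by simp
  fix \<phi> assume \<phi>: "\<phi> \<in> dual_space N"
  have "\<phi> (extension v) = (\<Sum>m\<in>{n}. \<phi> (ext_weight m (weight_proj M m v)))"
    by (rule dual_ext[OF \<phi>]) (use n v in \<open>auto simp: p\<close>)
  then show "\<phi> (extension v) = \<phi> (ext_weight n v)" by (simp add: p)
qed (use n v ext_closed ext_weight_in[OF n v] in auto)

lemma ext_gact: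
  assumes Z: "Z \<in> sl2" and v: "v \<in> carrier M"
  shows "extension (gact M Z v) = gact N Z (extension v)"
proof -
  \<comment> \<open>Both sides are linear in \<open>v\<close> and the weight spaces span, so each
    generator need only be tested on weight vectors.\<close>
  have comm: "extension (gact M Z v) = gact N Z (extension v)"
    if Z: "Z \<in> sl2" and w: "\<And>n w. odd n \<Longrightarrow> w \<in> weight_space M n \<Longrightarrow> extension (gact M Z w) = gact N Z (extension w)" for Z
    using v by (rule M.hom_eqI[OF hom_comp[OF ext_hom M.gact_linear[OF Z]] hom_comp[OF N.gact_linear[OF Z] ext_hom]
      N.complex_space_axioms, rotated]) (rule w, simp_all)
  have H: "extension (gact M H_mat v) = gact N H_mat (extension v)"
  proof (rule comm)
    fix n w assume n: "odd n" and w: "w \<in> weight_space M n"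
    have "gact M H_mat w = of_int n \<odot>\<^bsub>M\<^esub> w" "w \<in> carrier M" using w by (simp_all add: M.weight_space_iff)
    moreover have "gact N H_mat (extension w) = of_int n \<odot>\<^bsub>N\<^esub> extension w"
      using ext_weight_in[OF n w] ext_on_weight[OF n w] by (simp add: N.weight_space_iff)
    ultimately show "extension (gact M H_mat w) = gact N H_mat (extension w)" by (simp add: hom_smult[OF ext_hom])
  qed simp
  have X: "extension (gact M X_mat v) = gact N X_mat (extension v)"
  proof (rule comm)
    fix n w assume n: "odd n" and w: "w \<in> weight_space M n"
    show "extension (gact M X_mat w) = gact N X_mat (extension w)"
      using n ext_on_weight[OF n w] ext_on_weight[OF _ M.X_weight[OF w]] ext_weight_X[OF n w] by simp
  qed simp
  have Y: "extension (gact M Y_mat v) = gact N Y_mat (extension v)"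
  proof (rule comm)
    fix n w assume n: "odd n" and w: "w \<in> weight_space M n"
    show "extension (gact M Y_mat w) = gact N Y_mat (extension w)"
      using n ext_on_weight[OF n w] ext_on_weight[OF _ M.Y_weight[OF w]] ext_weight_Y[OF n w] by simp
  qed simp
  show ?thesis
    unfolding M.gact_eq[OF Z v] N.gact_eq[OF Z ext_closed[OF v]]
    using v by (simp add: module_homD[OF ext_hom] H X Y)
qed

lemma ext_kact:
  assumes k: "k \<in> SO2" and v: "v \<in> carrier M"
  shows "extension (kact M k v) = kact N k (extension v)"
  using v
proof (rule M.hom_eqI[OF hom_comp[OF ext_hom M.kact_linear[OF k]] hom_comp[OF N.kact_linear[OF k] ext_hom]
      N.complex_space_axioms, rotated])
  fix n w assume "n \<in> {n. odd n}" and w: "w \<in> weight_space M n"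
  then have n: "odd n" by simp
  obtain \<theta> where \<theta>: "k = rot \<theta>" using k unfolding SO2_eq_range_rot by auto
  show "extension (kact M k w) = kact N k (extension w)"
    unfolding \<theta> M.kact_rot_weight[OF w] ext_on_weight[OF n w]
      N.kact_rot_weight[OF ext_weight_in[OF n w]]
    using w by (simp add: hom_smult[OF ext_hom] ext_on_weight[OF n w])
qed

lemma ext_on_core: "v \<in> core M \<Longrightarrow> extension v = g v"
proof -
  assume v: "v \<in> core M"
  then have vc: "v \<in> carrier M" by simp
  note p = M.proj_weight[OF vc]
  have "extension v = extension (weight_proj M (-1) v) \<oplus>\<^bsub>N\<^esub> extension (weight_proj M 1 v)"
    using vc by (simp add: M.core_sum[OF v] flip: hom_add[OF ext_hom])
  also have "\<dots> = g (weight_proj M (-1) v) \<oplus>\<^bsub>N\<^esub> g (weight_proj M 1 v)"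
    using ext_on_weight[OF _ p(1)] ext_on_weight[OF _ p(2)] ext_weight_simps[of 0] by simp
  also have "\<dots> = g v"
    using p by (simp add: M.weight_in_core M.core_sum[OF v] flip: g_add)
  finally show "extension v = g v" .
qed

lemma exists_extension: "\<exists>f \<in> gk_hom M N. restrict f (core M) = g"
proof (intro bexI)
  show "restrict (restrict extension (carrier M)) (core M) = g"
    by (rule extensionalityI[OF _ g_extensional]) (auto simp: ext_on_core)
  show "restrict extension (carrier M) \<in> gk_hom M N"
    using module_homD[OF ext_hom] by (simp add: gk_hom_def module_hom_iff ext_gact ext_kact)
qed

end

end

section \<open>Realizing a \<open>\<BB>\<close>-module\<close>

text \<open>The component of weight \<open>n\<close> of the realization is to be the image of this
  idempotent. Since \<open>X\<close> and \<open>Y\<close> are also given by elements of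
  \<open>B_ring\<close>, the relations between them become identities in the ring.\<close>

definition idem :: "int \<Rightarrow> B_elem" where
  "idem n = (if even n then 0 else if n > 0 then E22 else E11)"

definition shifted_t :: "complex \<Rightarrow> B_elem" where
  "shifted_t c = mat (fps_X - fps_const (c\<^sup>2))"

text \<open>The action of \<open>X\<close> and \<open>Y\<close> on weight \<open>n\<close>, normalised so that \<open>X\<close> is the identity for \<open>n > 0\<close>
  and \<open>Y\<close> for \<open>n < 0\<close>; the remaining values are forced by \<open>X Y = T - ((n - 1) / 2)\<^sup>2\<close>.\<close>

definition raise :: "int \<Rightarrow> B_elem" where
  "raise n = (if even n then 0 else if n > 0 then E22 else if n = -1 then E21
     else shifted_t ((of_int n + 1) / 2) ** E11)"

definition lower :: "int \<Rightarrow> B_elem" where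
  "lower n = (if even n then 0 else if n < 0 then E11 else if n = 1 then tE12
     else shifted_t ((of_int n - 1) / 2) ** E22)"

lemma matrix_mult_zero [simp]: "(0 :: B_elem) ** P = 0" "P ** (0 :: B_elem) = 0"
  by (simp_all add: mat2_simps)

lemma ops_closed [simp]:
  "idem n \<in> carrier B_ring" "shifted_t c \<in> carrier B_ring" "raise n \<in> carrier B_ring" "lower n \<in> carrier B_ring"
proof -
  show st: "shifted_t c \<in> carrier B_ring" for c by (simp add: shifted_t_def)
  show "idem n \<in> carrier B_ring" "raise n \<in> carrier B_ring" "lower n \<in> carrier B_ring"
    using st by (simp_all add: idem_def raise_def lower_def)
qed

lemma shifted_t_commute: "shifted_t c ** P = P ** shifted_t c"
  unfolding shifted_t_def by (rule mat_fps_simps(3))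

lemma idem_products:
  "idem n ** idem n = idem n" "idem (n + 2) ** raise n = raise n" "idem (n - 2) ** lower n = lower n"
proof -
  have s: "P ** (shifted_t c ** Q) = shifted_t c ** (P ** Q)" for P Q c
    by (simp add: matrix_mul_assoc shifted_t_commute)
  show "idem n ** idem n = idem n" by (simp add: idem_def B_unit_products)
  have "n + 2 < 0 \<or> n = -1 \<or> n > 0" if "odd n" using that by presburger
  then show "idem (n + 2) ** raise n = raise n"
    by (auto simp: idem_def raise_def B_unit_products s)
  have "n < 0 \<or> n = 1 \<or> n - 2 > 0" if "odd n" using that by presburger
  then show "idem (n - 2) ** lower n = lower n"
    by (auto simp: idem_def lower_def B_unit_products s)
qed

text \<open>Inside either half, one factor is an idempotent and the other carries the whole factor
  \<open>t - c^2\<close>. On the step between -1 and 1 one has \<open>c = 0\<close>, and the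
  required factor \<open>t\<close> is the product of the two arrows.\<close>

lemma raise_lower:
  "raise (n - 2) ** lower n = shifted_t ((of_int n - 1) / 2) ** idem n"
  "lower (n + 2) ** raise n = shifted_t ((of_int n + 1) / 2) ** idem n"
proof -
  have s: "P ** (shifted_t c ** Q) = shifted_t c ** (P ** Q)" for P Q c
    by (simp add: matrix_mul_assoc shifted_t_commute)
  have a: "(shifted_t c ** P) ** Q = shifted_t c ** (P ** Q)" for P Q c
    by (simp add: matrix_mul_assoc)
  have z: "shifted_t 0 = mat fps_X" by (simp add: shifted_t_def)
  note simps = idem_def raise_def lower_def B_unit_products s a z
  have "even n \<or> odd n \<and> n < 0 \<or> odd n \<and> n = 1 \<or> odd n \<and> n - 2 > 0" by presburger
  then consider "even n" | "odd n" "n < 0" | "odd n" "n = 1" | "odd n" "n - 2 > 0" by blast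
  then show "raise (n - 2) ** lower n = shifted_t ((of_int n - 1) / 2) ** idem n"
  proof cases
    case 2
    then have "n - 2 < 0" "n - 2 \<noteq> -1" by auto
    then show ?thesis using 2 by (auto simp: simps)
  qed (auto simp: simps)
  have "even n \<or> odd n \<and> n + 2 < 0 \<or> odd n \<and> n = -1 \<or> odd n \<and> n > 0" by presburger
  then consider "even n" | "odd n" "n + 2 < 0" | "odd n" "n = -1" | "odd n" "n > 0" by blast
  then show "lower (n + 2) ** raise n = shifted_t ((of_int n + 1) / 2) ** idem n"
  proof cases
    case 2
    then show ?thesis by (auto simp: simps)
  next
    case 4
    then have "n + 2 > 0" "n + 2 \<noteq> 1" by auto
    then show ?thesis using 4 by (auto simp: simps add.commute)
  qed (auto simp: simps)
qed

section \<open>Finitely supported families and the operators on them\<close>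

definition graded_seqs :: "(B_elem, 'u) module \<Rightarrow> (int \<Rightarrow> 'u) set" where
  "graded_seqs V = {x. (\<forall>n. x n \<in> carrier V \<and> idem n \<odot>\<^bsub>V\<^esub> x n = x n) \<and> finite {n. x n \<noteq> \<zero>\<^bsub>V\<^esub>}}"

definition seq_gact :: "(B_elem, 'u) module \<Rightarrow> complex^2^2 \<Rightarrow> (int \<Rightarrow> 'u) \<Rightarrow> int \<Rightarrow> 'u" where
  "seq_gact V Z x n =
     (H_coeff Z * of_int n) \<odot>\<^bsub>underlying_vs V\<^esub> x n \<oplus>\<^bsub>V\<^esub>
     X_coeff Z \<odot>\<^bsub>underlying_vs V\<^esub> (raise (n - 2) \<odot>\<^bsub>V\<^esub> x (n - 2)) \<oplus>\<^bsub>V\<^esub>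
     Y_coeff Z \<odot>\<^bsub>underlying_vs V\<^esub> (lower (n + 2) \<odot>\<^bsub>V\<^esub> x (n + 2))"

text \<open>The character \<open>rot \<theta> \<mapsto> e\<^sup>i\<^sup>\<theta>\<close> of \<open>SO\<^sub>2\<close>.\<close>

definition SO2_char :: "real^2^2 \<Rightarrow> complex" where
  "SO2_char k = Complex (k $ 1 $ 1) (k $ 1 $ 2)"

definition seq_kact :: "(B_elem, 'u) module \<Rightarrow> real^2^2 \<Rightarrow> (int \<Rightarrow> 'u) \<Rightarrow> int \<Rightarrow> 'u" where
  "seq_kact V k x n = (SO2_char k powi n) \<odot>\<^bsub>underlying_vs V\<^esub> x n"

text \<open>The map \<open>\<iota>\<close> encodes finitely supported sequences as elements of the universe \<open>'u\<close>.\<close>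

definition decode :: "(B_elem, 'u) module \<Rightarrow> ((int \<Rightarrow> 'u) \<Rightarrow> 'u) \<Rightarrow> 'u \<Rightarrow> int \<Rightarrow> 'u" where
  "decode V \<iota> = inv_into (graded_seqs V) \<iota>"

definition realization :: "(B_elem, 'u) module \<Rightarrow> ((int \<Rightarrow> 'u) \<Rightarrow> 'u) \<Rightarrow> 'u gk_module" where
  "realization V \<iota> = \<lparr>carrier = \<iota> ` graded_seqs V, monoid.mult = undefined, one = undefined,
     zero = \<iota> (\<lambda>_. \<zero>\<^bsub>V\<^esub>),
     add = (\<lambda>u w. \<iota> (\<lambda>n. decode V \<iota> u n \<oplus>\<^bsub>V\<^esub> decode V \<iota> w n)),
     smult = (\<lambda>c u. \<iota> (\<lambda>n. c \<odot>\<^bsub>underlying_vs V\<^esub> decode V \<iota> u n)),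
     gact = (\<lambda>Z u. \<iota> (seq_gact V Z (decode V \<iota> u))),
     kact = (\<lambda>k u. \<iota> (seq_kact V k (decode V \<iota> u)))\<rparr>"

lemma SO2_char_rot: "SO2_char (rot \<theta>) powi n = exp (\<i> * of_int n * of_real \<theta>)"
proof -
  have "SO2_char (rot \<theta>) = cis \<theta>"
    by (simp add: SO2_char_def rot_def complex_eq_iff)
  then show ?thesis
    using cis_conv_exp[of "of_int n * \<theta>"] by (simp add: cis_power_int mult.assoc)
qed

section \<open>The realization as a vector space\<close>

locale graded_realization = B_module V for V :: "(B_elem, 'u) module" (structure) +
  fixes \<iota> :: "(int \<Rightarrow> 'u) \<Rightarrow> 'u"
  assumes fd: "finite_dimensional (underlying_vs V)"
    and inj: "inj_on \<iota> (graded_seqs V)"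
begin

abbreviation "N \<equiv> realization V \<iota>"
abbreviation "co \<equiv> decode V \<iota>"
abbreviation "UV \<equiv> underlying_vs V"

lemma act_smult: "P \<in> carrier B_ring \<Longrightarrow> x \<in> carrier V \<Longrightarrow> P \<odot> (c \<odot>\<^bsub>UV\<^esub> x) = c \<odot>\<^bsub>UV\<^esub> (P \<odot> x)"
  using hom_smult[OF act_hom, of P x c] by (simp add: underlying_simps)

lemma graded_seqsI:
  "\<lbrakk>\<And>n. x n \<in> carrier V; \<And>n. idem n \<odot> x n = x n; finite {n. x n \<noteq> \<zero>}\<rbrakk> \<Longrightarrow> x \<in> graded_seqs V"
  by (simp add: graded_seqs_def)

lemma seqD:
  assumes "x \<in> graded_seqs V"
  shows "x n \<in> carrier V" "idem n \<odot> x n = x n" "finite {n. x n \<noteq> \<zero>}"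
  using assms by (simp_all add: graded_seqs_def)

lemma encode_decode:
  "x \<in> graded_seqs V \<Longrightarrow> co (\<iota> x) = x"
  "x \<in> graded_seqs V \<Longrightarrow> \<iota> x \<in> carrier N"
  "u \<in> carrier N \<Longrightarrow> co u \<in> graded_seqs V"
  "u \<in> carrier N \<Longrightarrow> \<iota> (co u) = u"
  using inj by (auto simp: decode_def realization_def intro: inv_into_into f_inv_into_f)

lemma co_closed [simp]: "u \<in> carrier N \<Longrightarrow> co u n \<in> carrier V"
  by (rule seqD(1)[OF encode_decode(3)])

lemma co_idem: "u \<in> carrier N \<Longrightarrow> idem n \<odot> co u n = co u n"
  by (rule seqD(2)[OF encode_decode(3)])

lemma co_finite: "u \<in> carrier N \<Longrightarrow> finite {n. co u n \<noteq> \<zero>}"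
  by (rule seqD(3)[OF encode_decode(3)])

lemma co_even: "u \<in> carrier N \<Longrightarrow> even n \<Longrightarrow> co u n = \<zero>"
  using co_idem[of u n] by (simp add: idem_def)

lemma realization_eqI:
  assumes "u \<in> carrier N" "w \<in> carrier N" "\<And>n. co u n = co w n"
  shows "u = w"
proof -
  have "co u = co w" using assms(3) by (rule ext)
  then have "\<iota> (co u) = \<iota> (co w)" by (rule arg_cong)
  then show ?thesis unfolding encode_decode(4)[OF assms(1)] encode_decode(4)[OF assms(2)] .
qed

text \<open>Vectors of the realization are compared by functionals of \<open>V\<close> on each
  component, which again leaves identities of complex numbers.\<close>

lemma realization_vec_eqI:
  assumes "u \<in> carrier N" "w \<in> carrier N"
    "\<And>n \<phi>. \<phi> \<in> dual_space UV \<Longrightarrow> \<phi> (co u n) = \<phi> (co w n)"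
  shows "u = w"
  by (rule realization_eqI[OF assms(1,2)], rule U.vec_eqI) (simp_all add: assms)

lemma seq_zero: "(\<lambda>_. \<zero>) \<in> graded_seqs V"
  by (rule graded_seqsI) simp_all

lemma seq_add: "x \<in> graded_seqs V \<Longrightarrow> y \<in> graded_seqs V \<Longrightarrow> (\<lambda>n. x n \<oplus> y n) \<in> graded_seqs V"
proof (rule graded_seqsI)
  assume x: "x \<in> graded_seqs V" and y: "y \<in> graded_seqs V"
  note * = seqD[OF x] seqD[OF y]
  show "finite {n. x n \<oplus> y n \<noteq> \<zero>}"
  proof (rule finite_subset)
    show "{n. x n \<oplus> y n \<noteq> \<zero>} \<subseteq> {n. x n \<noteq> \<zero>} \<union> {n. y n \<noteq> \<zero>}"
      by (rule subsetI, rule ccontr) simp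
    show "finite ({n. x n \<noteq> \<zero>} \<union> {n. y n \<noteq> \<zero>})" using * by simp
  qed
  fix n show "x n \<oplus> y n \<in> carrier V" "idem n \<odot> (x n \<oplus> y n) = x n \<oplus> y n"
    using * by (simp_all add: act_add_right)
qed

lemma seq_smult: "x \<in> graded_seqs V \<Longrightarrow> (\<lambda>n. c n \<odot>\<^bsub>UV\<^esub> x n) \<in> graded_seqs V"
proof (rule graded_seqsI)
  assume x: "x \<in> graded_seqs V"
  note * = seqD[OF x]
  show "finite {n. c n \<odot>\<^bsub>UV\<^esub> x n \<noteq> \<zero>}"
    by (rule finite_subset[OF _ *(3)]) auto
  fix n show "c n \<odot>\<^bsub>UV\<^esub> x n \<in> carrier V" "idem n \<odot> (c n \<odot>\<^bsub>UV\<^esub> x n) = c n \<odot>\<^bsub>UV\<^esub> x n"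
    using * by (simp_all add: act_smult)
qed

lemma seq_shift:
  assumes x: "x \<in> graded_seqs V" and P: "\<And>n. P n \<in> carrier B_ring" "\<And>n. idem n ** P n = P n"
  shows "(\<lambda>n. P n \<odot> x (n + k)) \<in> graded_seqs V"
proof (rule graded_seqsI)
  note * = seqD[OF x]
  show "finite {n. P n \<odot> x (n + k) \<noteq> \<zero>}"
  proof (rule finite_subset)
    show "{n. P n \<odot> x (n + k) \<noteq> \<zero>} \<subseteq> (\<lambda>n. n - k) ` {n. x n \<noteq> \<zero>}"
    proof
      fix n assume "n \<in> {n. P n \<odot> x (n + k) \<noteq> \<zero>}"
      then have "n + k \<in> {n. x n \<noteq> \<zero>}" using P(1)[of n] by auto
      then show "n \<in> (\<lambda>n. n - k) ` {n. x n \<noteq> \<zero>}" by (intro image_eqI[of _ _ "n + k"]) simp_all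
    qed
  qed (use * in simp)
  fix n show "P n \<odot> x (n + k) \<in> carrier V" "idem n \<odot> (P n \<odot> x (n + k)) = P n \<odot> x (n + k)"
    using * P[of n] by (simp_all add: act_act)
qed

lemma seq_raise: "x \<in> graded_seqs V \<Longrightarrow> (\<lambda>n. raise (n - 2) \<odot> x (n - 2)) \<in> graded_seqs V"
  using seq_shift[of x "\<lambda>n. raise (n - 2)" "-2"] idem_products(2)[of "n - 2" for n] by simp

lemma seq_lower: "x \<in> graded_seqs V \<Longrightarrow> (\<lambda>n. lower (n + 2) \<odot> x (n + 2)) \<in> graded_seqs V"
  using seq_shift[of x "\<lambda>n. lower (n + 2)" 2] idem_products(3)[of "n + 2" for n] by simp

lemma seq_gact: "x \<in> graded_seqs V \<Longrightarrow> seq_gact V Z x \<in> graded_seqs V"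
  using seq_add[OF seq_add[OF seq_smult[of x "\<lambda>n. H_coeff Z * of_int n"]
      seq_smult[OF seq_raise[of x], of "\<lambda>_. X_coeff Z"]]
      seq_smult[OF seq_lower[of x], of "\<lambda>_. Y_coeff Z"]]
  unfolding seq_gact_def[abs_def] by simp

lemma seq_kact: "x \<in> graded_seqs V \<Longrightarrow> seq_kact V k x \<in> graded_seqs V"
  unfolding seq_kact_def[abs_def] by (rule seq_smult)

lemma co_zero: "\<zero>\<^bsub>N\<^esub> \<in> carrier N" "co \<zero>\<^bsub>N\<^esub> n = \<zero>"
  using encode_decode(1,2)[OF seq_zero] by (simp_all add: realization_def)

lemma co_add:
  assumes "u \<in> carrier N" "w \<in> carrier N"
  shows "u \<oplus>\<^bsub>N\<^esub> w \<in> carrier N" "co (u \<oplus>\<^bsub>N\<^esub> w) n = co u n \<oplus> co w n"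
  using encode_decode(1,2)[OF seq_add[OF encode_decode(3)[OF assms(1)] encode_decode(3)[OF assms(2)]]]
  by (simp_all add: realization_def)

lemma co_smult:
  assumes "u \<in> carrier N"
  shows "c \<odot>\<^bsub>N\<^esub> u \<in> carrier N" "co (c \<odot>\<^bsub>N\<^esub> u) n = c \<odot>\<^bsub>UV\<^esub> co u n"
  using encode_decode(1,2)[OF seq_smult[OF encode_decode(3)[OF assms], of "\<lambda>_. c"]]
  by (simp_all add: realization_def)

lemma co_gact:
  assumes "u \<in> carrier N"
  shows "gact N Z u \<in> carrier N" "co (gact N Z u) n = seq_gact V Z (co u) n"
  using encode_decode(1,2)[OF seq_gact[OF encode_decode(3)[OF assms], of Z]]
  by (simp_all add: realization_def)

lemma co_kact:
  assumes "u \<in> carrier N"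
  shows "kact N k u \<in> carrier N" "co (kact N k u) n = (SO2_char k powi n) \<odot>\<^bsub>UV\<^esub> co u n"
  using encode_decode(1,2)[OF seq_kact[OF encode_decode(3)[OF assms], of k]]
  by (simp_all add: realization_def seq_kact_def)

lemma vectorspace_realization: "complex_vectorspace N"
proof -
  note c [simp] = co_zero co_add co_smult
  have "abelian_group N"
  proof (rule abelian_groupI)
    fix x y z assume xyz: "x \<in> carrier N" "y \<in> carrier N" "z \<in> carrier N"
    show "x \<oplus>\<^bsub>N\<^esub> y \<oplus>\<^bsub>N\<^esub> z = x \<oplus>\<^bsub>N\<^esub> (y \<oplus>\<^bsub>N\<^esub> z)"
      by (rule realization_eqI) (use xyz in \<open>simp_all add: M.a_assoc\<close>)
  next
    fix x y assume xyz: "x \<in> carrier N" "y \<in> carrier N"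
    show "x \<oplus>\<^bsub>N\<^esub> y = y \<oplus>\<^bsub>N\<^esub> x"
      by (rule realization_eqI) (use xyz M.a_comm in simp_all)
  next
    fix x assume x: "x \<in> carrier N"
    show "\<zero>\<^bsub>N\<^esub> \<oplus>\<^bsub>N\<^esub> x = x"
      by (rule realization_eqI) (use x in simp_all)
    have "(-1) \<odot>\<^bsub>N\<^esub> x \<oplus>\<^bsub>N\<^esub> x = \<zero>\<^bsub>N\<^esub>"
      by (rule realization_vec_eqI) (use x in \<open>simp_all add: U.dual_simps\<close>)
    then show "\<exists>y\<in>carrier N. y \<oplus>\<^bsub>N\<^esub> x = \<zero>\<^bsub>N\<^esub>"
      using x by (intro bexI[of _ "(-1) \<odot>\<^bsub>N\<^esub> x"]) simp_all
  qed simp_all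
  then have "module complex_field N"
  proof (intro moduleI domain.axioms(1)[OF field.axioms(1)[OF field_complex_field]])
    fix a b x y assume xy: "x \<in> carrier N" "y \<in> carrier N"
    show "(a \<oplus>\<^bsub>complex_field\<^esub> b) \<odot>\<^bsub>N\<^esub> x = a \<odot>\<^bsub>N\<^esub> x \<oplus>\<^bsub>N\<^esub> b \<odot>\<^bsub>N\<^esub> x"
      by (rule realization_vec_eqI) (use xy in \<open>simp_all add: U.dual_simps distrib_right\<close>)
    show "a \<odot>\<^bsub>N\<^esub> (x \<oplus>\<^bsub>N\<^esub> y) = a \<odot>\<^bsub>N\<^esub> x \<oplus>\<^bsub>N\<^esub> a \<odot>\<^bsub>N\<^esub> y"
      by (rule realization_vec_eqI) (use xy in \<open>simp_all add: U.dual_simps distrib_left\<close>)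
    show "(a \<otimes>\<^bsub>complex_field\<^esub> b) \<odot>\<^bsub>N\<^esub> x = a \<odot>\<^bsub>N\<^esub> (b \<odot>\<^bsub>N\<^esub> x)"
      by (rule realization_vec_eqI) (use xy in \<open>simp_all add: U.dual_simps\<close>)
  next
    fix x assume x: "x \<in> carrier N"
    show "\<one>\<^bsub>complex_field\<^esub> \<odot>\<^bsub>N\<^esub> x = x"
      by (rule realization_eqI) (use x in simp_all)
  qed simp_all
  then show ?thesis by (simp add: vectorspace_def field_complex_field)
qed

sublocale N: complex_space N
  by (rule complex_space.intro) (rule vectorspace_realization)

lemma co_hom: "(\<lambda>u. co u n) \<in> module_hom complex_field N UV"
  unfolding module_hom_iff underlying_simps(1-3) by (simp add: co_add co_smult)

end

text \<open>A functional along an orbit of \<open>K\<close> in the realization is a finite sum of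
  this kind, see \<open>dual_kact_rot\<close>. Iterating the formula gives smoothness, and its value
  at 0 gives the differential of the action.\<close>

lemma has_vector_derivative_exp_sum:
  "((\<lambda>t. \<Sum>n\<in>S. b n * exp (\<i> * of_int n * of_real t)) has_vector_derivative
    (\<Sum>n\<in>S. (b n * (\<i> * of_int n)) * exp (\<i> * of_int n * of_real t))) (at t)"
proof -
  have "((\<lambda>t. exp (\<i> * of_int n * of_real t)) has_vector_derivative
      \<i> * of_int n * exp (\<i> * of_int n * of_real t)) (at t)" for n
    by (rule has_vector_derivative_real_field) (auto intro!: derivative_eq_intros)
  then have "((\<lambda>t. \<Sum>n\<in>S. b n * exp (\<i> * of_int n * of_real t)) has_vector_derivative
    (\<Sum>n\<in>S. b n * (\<i> * of_int n * exp (\<i> * of_int n * of_real t)))) (at t)"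
    by (intro has_vector_derivative_sum has_vector_derivative_mult_right)
  then show ?thesis by (simp add: mult.assoc)
qed

lemma smooth_curve_exp_sum: "smooth_curve (\<lambda>t. \<Sum>n\<in>S. b n * exp (\<i> * of_int n * of_real t))"
  unfolding smooth_curve_def
proof (intro exI[of _ "\<lambda>k t. \<Sum>n\<in>S. (b n * (\<i> * of_int n) ^ k) * exp (\<i> * of_int n * of_real t)"] conjI allI)
  fix k t
  show "((\<lambda>t. \<Sum>n\<in>S. (b n * (\<i> * of_int n) ^ k) * exp (\<i> * of_int n * of_real t)) has_vector_derivative
    (\<Sum>n\<in>S. (b n * (\<i> * of_int n) ^ Suc k) * exp (\<i> * of_int n * of_real t))) (at t)"
    using has_vector_derivative_exp_sum[of "\<lambda>n. b n * (\<i> * of_int n) ^ k" S t]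
    by (simp only: power_Suc2 mult.assoc)
qed simp

section \<open>Weights of the realization and the axioms of a
  \<open>(\<gg>, K)\<close>-module\<close>

context graded_realization
begin

definition hvec :: "int \<Rightarrow> 'u \<Rightarrow> 'u" where
  "hvec n x = \<iota> (\<lambda>m. if m = n then x else \<zero>)"

lemma hvec:
  assumes "x \<in> carrier V" "idem n \<odot> x = x"
  shows "hvec n x \<in> carrier N" "co (hvec n x) m = (if m = n then x else \<zero>)"
proof -
  have "(\<lambda>m. if m = n then x else \<zero>) \<in> graded_seqs V"
    by (rule graded_seqsI) (use assms in \<open>auto intro: finite_subset[of _ "{n}"]\<close>)
  from encode_decode(1,2)[OF this] show "hvec n x \<in> carrier N" "co (hvec n x) m = (if m = n then x else \<zero>)"
    by (simp_all add: hvec_def)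
qed

definition pr :: "int \<Rightarrow> 'u \<Rightarrow> 'u" where
  "pr n u = hvec n (co u n)"

lemma co_pr:
  assumes "u \<in> carrier N"
  shows "pr n u \<in> carrier N" "co (pr n u) m = (if m = n then co u n else \<zero>)"
  unfolding pr_def using assms by (simp_all add: hvec co_idem)

lemma pr_hom: "pr n \<in> module_hom complex_field N N"
  unfolding module_hom_iff
proof (intro conjI ballI allI)
  fix u w c assume [simp]: "u \<in> carrier N" "w \<in> carrier N"
  show "pr n u \<in> carrier N" by (simp add: co_pr)
  show "pr n (u \<oplus>\<^bsub>N\<^esub> w) = pr n u \<oplus>\<^bsub>N\<^esub> pr n w" "pr n (c \<odot>\<^bsub>N\<^esub> u) = c \<odot>\<^bsub>N\<^esub> pr n u"
    by (rule realization_eqI; simp add: co_pr co_add co_smult)+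
qed

lemma co_H: "u \<in> carrier N \<Longrightarrow> co (gact N H_mat u) n = of_int n \<odot>\<^bsub>UV\<^esub> co u n"
  by (simp add: co_gact seq_gact_def)

lemma co_X: "u \<in> carrier N \<Longrightarrow> co (gact N X_mat u) n = raise (n - 2) \<odot> co u (n - 2)"
  by (simp add: co_gact seq_gact_def)

lemma co_Y: "u \<in> carrier N \<Longrightarrow> co (gact N Y_mat u) n = lower (n + 2) \<odot> co u (n + 2)"
  by (simp add: co_gact seq_gact_def)

lemma smult_cancel:
  assumes "x \<in> carrier V" "c \<odot>\<^bsub>UV\<^esub> x = d \<odot>\<^bsub>UV\<^esub> x" "c \<noteq> d"
  shows "x = \<zero>"
proof (rule U.vec_eqI)
  fix \<phi> assume \<phi>: "\<phi> \<in> dual_space UV"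
  have "c * \<phi> x = d * \<phi> x"
    using arg_cong[OF assms(2), of \<phi>] \<phi> assms(1) by (simp add: U.dual_simps)
  then show "\<phi> x = \<phi> \<zero>" using assms(3) \<phi> by (simp add: U.dual_simps)
qed (use assms in simp_all)

text \<open>\<open>H\<close> multiplies the component of index \<open>m\<close> by \<open>m\<close>.
  These scalars are distinct, so an eigenvector for \<open>n\<close> has no other nonzero
  component.\<close>

lemma weight_space_realization:
  "u \<in> weight_space N n \<longleftrightarrow> u \<in> carrier N \<and> (\<forall>m. m \<noteq> n \<longrightarrow> co u m = \<zero>)"
proof (intro iffI conjI allI impI)
  fix m assume "u \<in> weight_space N n" and m: "m \<noteq> n"
  then have u: "u \<in> carrier N" "gact N H_mat u = of_int n \<odot>\<^bsub>N\<^esub> u" by (simp_all add: weight_space_def)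
  have "of_int m \<odot>\<^bsub>UV\<^esub> co u m = of_int n \<odot>\<^bsub>UV\<^esub> co u m"
    using co_H[OF u(1), of m] u by (simp add: co_smult)
  then show "co u m = \<zero>" by (rule smult_cancel[rotated]) (use u m in simp_all)
next
  assume u: "u \<in> carrier N \<and> (\<forall>m. m \<noteq> n \<longrightarrow> co u m = \<zero>)"
  have "gact N H_mat u = of_int n \<odot>\<^bsub>N\<^esub> u"
  proof (rule realization_eqI)
    fix m show "co (gact N H_mat u) m = co (of_int n \<odot>\<^bsub>N\<^esub> u) m"
      using u by (cases "m = n") (simp_all add: co_H co_smult)
  qed (use u in \<open>simp_all add: co_gact co_smult\<close>)
  then show "u \<in> weight_space N n" using u by (simp add: weight_space_def)
qed (simp add: weight_space_def)

lemma pr_eq_zero_iff: "u \<in> carrier N \<Longrightarrow> pr n u = \<zero>\<^bsub>N\<^esub> \<longleftrightarrow> co u n = \<zero>"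
proof
  assume u: "u \<in> carrier N" and 0: "pr n u = \<zero>\<^bsub>N\<^esub>"
  have "co u n = co (pr n u) n" using u by (simp add: co_pr)
  then show "co u n = \<zero>" unfolding 0 by (simp add: co_zero)
next
  assume u: "u \<in> carrier N" and 0: "co u n = \<zero>"
  show "pr n u = \<zero>\<^bsub>N\<^esub>"
    by (rule realization_eqI) (use u 0 in \<open>simp_all add: co_pr co_zero\<close>)
qed

text \<open>Stated for every index set containing the odd integers, because
  \<open>harish_chandra\<close> asks for the sum over all weights and \<open>HC0\<close> for the sum
  over the odd ones; the even components vanish.\<close>

lemma graded_realization:
  assumes I: "{n. odd n} \<subseteq> I"
  shows "graded_space N I (weight_space N) pr"
proof (intro graded_space.intro graded_space_axioms.intro N.complex_space_axioms pr_hom)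
  fix n
  show "complex_subspace (weight_space N n) N"
    unfolding N.complex_subspace_iff weight_space_realization
    by (simp add: subset_iff weight_space_realization co_zero co_add co_smult)
next
  fix n v assume v: "v \<in> carrier N"
  show "pr n v \<in> weight_space N n"
    using v by (simp add: weight_space_realization co_pr)
  have supp: "{n. pr n v \<noteq> \<zero>\<^bsub>N\<^esub>} = {n. co v n \<noteq> \<zero>}"
    using v by (simp add: pr_eq_zero_iff)
  then show fin: "finite {n. pr n v \<noteq> \<zero>\<^bsub>N\<^esub>}" using co_finite[OF v] by simp
  show "finsum N (\<lambda>n. pr n v) {n. pr n v \<noteq> \<zero>\<^bsub>N\<^esub>} = v"
  proof (rule realization_eqI)
    have prc: "\<And>n. pr n v \<in> carrier N" using v by (simp add: co_pr)
    show "finsum N (\<lambda>n. pr n v) {n. pr n v \<noteq> \<zero>\<^bsub>N\<^esub>} \<in> carrier N"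
      by (rule N.finsum_closed) (rule prc)
    fix m
    have "co (finsum N (\<lambda>n. pr n v) {n. pr n v \<noteq> \<zero>\<^bsub>N\<^esub>}) m =
        finsum UV (\<lambda>n. co (pr n v) m) {n. pr n v \<noteq> \<zero>\<^bsub>N\<^esub>}"
      by (rule hom_finsum[OF co_hom N.complex_space_axioms complex_space_underlying]) (rule prc)
    also have "\<dots> = co v m"
    proof (rule U.vec_eqI)
      fix \<phi> assume \<phi>: "\<phi> \<in> dual_space UV"
      have "\<phi> (finsum UV (\<lambda>n. co (pr n v) m) {n. pr n v \<noteq> \<zero>\<^bsub>N\<^esub>}) =
          (\<Sum>n\<in>{n. pr n v \<noteq> \<zero>\<^bsub>N\<^esub>}. \<phi> (co (pr n v) m))"
        by (rule U.dual_finsum[OF \<phi>]) (simp add: prc)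
      also have "\<dots> = (\<Sum>n\<in>{n. pr n v \<noteq> \<zero>\<^bsub>N\<^esub>}. if m = n then \<phi> (co v m) else 0)"
        using v \<phi> by (intro sum.cong) (simp_all add: co_pr U.dual_simps)
      also have "\<dots> = \<phi> (co v m)"
        using fin v \<phi> by (simp add: sum.delta pr_eq_zero_iff U.dual_simps)
      finally show "\<phi> (finsum UV (\<lambda>n. co (pr n v) m) {n. pr n v \<noteq> \<zero>\<^bsub>N\<^esub>}) = \<phi> (co v m)" .
    next
      show "finsum UV (\<lambda>n. co (pr n v) m) {n. pr n v \<noteq> \<zero>\<^bsub>N\<^esub>} \<in> carrier V"
        by (rule U.finsum_closed) (simp add: prc)
    qed (use v in simp)
    finally show "co (finsum N (\<lambda>n. pr n v) {n. pr n v \<noteq> \<zero>\<^bsub>N\<^esub>}) m = co v m" .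
  qed (rule v)
  assume "n \<notin> I"
  then have "even n" using I by auto
  then show "pr n v = \<zero>\<^bsub>N\<^esub>" using v co_even[OF v] by (simp add: pr_eq_zero_iff)
next
  fix n m v assume v: "v \<in> weight_space N n"
  then have vc: "v \<in> carrier N" and v0: "\<And>k. k \<noteq> n \<Longrightarrow> co v k = \<zero>" by (simp_all add: weight_space_realization)
  show "pr m v = (if m = n then v else \<zero>\<^bsub>N\<^esub>)"
    by (rule realization_eqI) (use vc v0 in \<open>simp_all add: co_pr co_zero\<close>)
qed

sublocale graded: graded_space N "{n. odd n}" "weight_space N" pr
  by (rule graded_realization) simp

lemma dual_decompose:
  assumes "\<phi> \<in> dual_space N" "u \<in> carrier N" "finite S" "{n. co u n \<noteq> \<zero>} \<subseteq> S"
  shows "\<phi> u = (\<Sum>n\<in>S. \<phi> (pr n u))"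
proof -
  have "finsum N (\<lambda>n. pr n u) S = u"
    by (rule graded.proj_sum') (use assms in \<open>simp_all add: pr_eq_zero_iff\<close>)
  then show ?thesis using N.dual_finsum[OF assms(1), of S "\<lambda>n. pr n u"] assms(2) by simp
qed

lemma pr_kact_rot:
  "u \<in> carrier N \<Longrightarrow> pr n (kact N (rot \<theta>) u) = exp (\<i> * of_int n * of_real \<theta>) \<odot>\<^bsub>N\<^esub> pr n u"
  by (rule realization_eqI) (simp_all add: co_pr co_kact co_smult SO2_char_rot)

lemma dual_kact_rot:
  assumes \<phi>: "\<phi> \<in> dual_space N" and u: "u \<in> carrier N"
  shows "\<phi> (kact N (rot \<theta>) u) =
    (\<Sum>n\<in>{n. co u n \<noteq> \<zero>}. \<phi> (pr n u) * exp (\<i> * of_int n * of_real \<theta>))"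
proof -
  have "\<phi> (kact N (rot \<theta>) u) = (\<Sum>n\<in>{n. co u n \<noteq> \<zero>}. \<phi> (pr n (kact N (rot \<theta>) u)))"
    by (rule dual_decompose[OF \<phi>]) (use u co_finite[OF u] in \<open>auto simp: co_kact\<close>)
  then show ?thesis using \<phi> u by (simp add: pr_kact_rot N.dual_simps co_pr mult.commute)
qed

lemma shifted_t_act:
  "x \<in> carrier V \<Longrightarrow> shifted_t c \<odot> x = mat fps_X \<odot> x \<ominus>\<^bsub>UV\<^esub> c\<^sup>2 \<odot>\<^bsub>UV\<^esub> x"
proof -
  assume x: "x \<in> carrier V"
  have "fps_X - fps_const (c\<^sup>2) = fps_X + fps_const (- c\<^sup>2)" by (simp flip: fps_const_neg)
  then have "shifted_t c = mat fps_X + mat (fps_const (- c\<^sup>2))"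
    by (simp only: shifted_t_def mat_fps_simps(1))
  then have "shifted_t c \<odot> x = mat fps_X \<odot> x \<oplus> (- c\<^sup>2) \<odot>\<^bsub>UV\<^esub> x"
    using x by (simp add: act_add_left underlying_simps)
  also have "\<dots> = mat fps_X \<odot> x \<ominus>\<^bsub>UV\<^esub> c\<^sup>2 \<odot>\<^bsub>UV\<^esub> x"
    by (rule U.vec_eqI) (use x in \<open>simp_all add: U.dual_simps\<close>)
  finally show ?thesis .
qed

lemma raise_lower_act:
  assumes "u \<in> carrier N"
  shows "raise (n - 2) \<odot> (lower n \<odot> co u n) =
      mat fps_X \<odot> co u n \<ominus>\<^bsub>UV\<^esub> ((of_int n - 1) / 2)\<^sup>2 \<odot>\<^bsub>UV\<^esub> co u n"
    "lower (n + 2) \<odot> (raise n \<odot> co u n) =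
      mat fps_X \<odot> co u n \<ominus>\<^bsub>UV\<^esub> ((of_int n + 1) / 2)\<^sup>2 \<odot>\<^bsub>UV\<^esub> co u n"
  using assms co_idem[OF assms, of n]
  by (simp_all add: act_act raise_lower shifted_t_act flip: act_act[of "shifted_t _" "idem n"])

text \<open>Two steps in the same direction cancel by symmetry in \<open>Z\<close> and
  \<open>Z'\<close>. For the mixed terms, the relation \<open>[X, Y] = H\<close> at weight
  \<open>n\<close> amounts to \<open>((n + 1) / 2)^2 - ((n - 1) / 2)^2 = n\<close>.\<close>

lemma gact_bracket:
  assumes Z: "Z \<in> sl2" "Z' \<in> sl2" and u: "u \<in> carrier N"
  shows "gact N (Z ** Z' - Z' ** Z) u = gact N Z (gact N Z' u) \<ominus>\<^bsub>N\<^esub> gact N Z' (gact N Z u)"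
proof (rule realization_eqI)
  fix n
  have co_minus: "co (a \<ominus>\<^bsub>N\<^esub> b) n = co a n \<ominus>\<^bsub>UV\<^esub> co b n" if "a \<in> carrier N" "b \<in> carrier N" for a b
    using hom_minus[OF co_hom N.complex_space_axioms complex_space_underlying that] .
  show "co (gact N (Z ** Z' - Z' ** Z) u) n = co (gact N Z (gact N Z' u) \<ominus>\<^bsub>N\<^esub> gact N Z' (gact N Z u)) n"
    unfolding co_minus[OF co_gact(1)[OF co_gact(1)[OF u]] co_gact(1)[OF co_gact(1)[OF u]]]
  proof (rule U.vec_eqI)
    fix \<phi> assume \<phi>: "\<phi> \<in> dual_space UV"
    show "\<phi> (co (gact N (Z ** Z' - Z' ** Z) u) n) =
        \<phi> (co (gact N Z (gact N Z' u)) n \<ominus>\<^bsub>UV\<^esub> co (gact N Z' (gact N Z u)) n)"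
      using \<phi> u
      by (simp add: co_gact seq_gact_def coeff_bracket[OF Z] U.dual_simps act_add_right act_smult
          raise_lower_act[OF u] power2_eq_square algebra_simps add_divide_distrib diff_divide_distrib)
  qed (use u in \<open>simp_all add: co_gact(1)\<close>)
qed (use u in \<open>simp_all add: co_gact(1)\<close>)

text \<open>\<open>X\<close> takes the component \<open>n - 2\<close> to the component
  \<open>n\<close>, so conjugation by \<open>rot \<theta>\<close> leaves the factor \<open>exp (i n
  \<theta>) exp (- i (n - 2) \<theta>) = exp (2 i \<theta>)\<close>, the one by which
  \<open>Ad\<close> multiplies \<open>X\<close>. The factors for \<open>H\<close> and
  \<open>Y\<close> arise in the same way.\<close>

lemma Ad_compat:
  assumes Z: "Z \<in> sl2" and u: "u \<in> carrier N"
  shows "gact N (Ad (rot \<theta>) Z) u = kact N (rot \<theta>) (gact N Z (kact N (rot (- \<theta>)) u))"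
proof (rule realization_eqI)
  fix n
  define e where "e k t = exp (\<i> * of_int k * of_real t)" for k :: int and t :: real
  have e: "e n \<theta> * e n (- \<theta>) = 1" "e n \<theta> * e (n - 2) (- \<theta>) = cis (2 * \<theta>)"
    "e n \<theta> * e (n + 2) (- \<theta>) = cis (- 2 * \<theta>)"
    unfolding e_def cis_conv_exp by (simp_all add: algebra_simps flip: exp_add)
  have e': "e n \<theta> * (z * (e n (- \<theta>) * x)) = z * x" "e n \<theta> * (z * (e (n - 2) (- \<theta>) * x)) = cis (2 * \<theta>) * (z * x)"
    "e n \<theta> * (z * (e (n + 2) (- \<theta>) * x)) = cis (- 2 * \<theta>) * (z * x)" for z x
  proof -
    have "e n \<theta> * (z * (y * x)) = (e n \<theta> * y) * (z * x)" for y by (simp only: mult_ac)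
    then show "e n \<theta> * (z * (e n (- \<theta>) * x)) = z * x" "e n \<theta> * (z * (e (n - 2) (- \<theta>) * x)) = cis (2 * \<theta>) * (z * x)"
      "e n \<theta> * (z * (e (n + 2) (- \<theta>) * x)) = cis (- 2 * \<theta>) * (z * x)" by (simp_all only: e mult_1)
  qed
  show "co (gact N (Ad (rot \<theta>) Z) u) n = co (kact N (rot \<theta>) (gact N Z (kact N (rot (- \<theta>)) u))) n"
  proof (rule U.vec_eqI)
    fix \<phi> assume \<phi>: "\<phi> \<in> dual_space UV"
    have L: "\<phi> (co (gact N (Ad (rot \<theta>) Z) u) n) = H_coeff Z * (of_int n * \<phi> (co u n)) +
        cis (2 * \<theta>) * (X_coeff Z * \<phi> (raise (n - 2) \<odot> co u (n - 2))) +
        cis (- 2 * \<theta>) * (Y_coeff Z * \<phi> (lower (n + 2) \<odot> co u (n + 2)))"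
      using \<phi> u by (simp add: co_gact seq_gact_def Ad_rot_coeff[OF Z] U.dual_simps mult.assoc)
    have "\<phi> (co (kact N (rot \<theta>) (gact N Z (kact N (rot (- \<theta>)) u))) n) =
        e n \<theta> * ((H_coeff Z * of_int n) * (e n (- \<theta>) * \<phi> (co u n))) +
        e n \<theta> * (X_coeff Z * (e (n - 2) (- \<theta>) * \<phi> (raise (n - 2) \<odot> co u (n - 2)))) +
        e n \<theta> * (Y_coeff Z * (e (n + 2) (- \<theta>) * \<phi> (lower (n + 2) \<odot> co u (n + 2))))"
      using \<phi> u by (simp add: co_gact co_kact seq_gact_def act_smult U.dual_simps SO2_char_rot e_def distrib_left)
    then show "\<phi> (co (gact N (Ad (rot \<theta>) Z) u) n) =
        \<phi> (co (kact N (rot \<theta>) (gact N Z (kact N (rot (- \<theta>)) u))) n)"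
      unfolding L e' by (simp add: mult.assoc)
  qed (use u in \<open>simp_all add: co_gact(1) co_kact(1)\<close>)
qed (use u in \<open>simp_all add: co_gact(1) co_kact(1)\<close>)

lemma gact_realization_hom: "gact N Z \<in> module_hom complex_field N N"
  unfolding module_hom_iff
proof (intro conjI ballI allI)
  fix u w c assume u [simp]: "u \<in> carrier N" and w [simp]: "w \<in> carrier N"
  show "gact N Z u \<in> carrier N" by (simp add: co_gact)
  show "gact N Z (u \<oplus>\<^bsub>N\<^esub> w) = gact N Z u \<oplus>\<^bsub>N\<^esub> gact N Z w"
    by (rule realization_vec_eqI) (simp_all add: co_gact co_add seq_gact_def act_add_right U.dual_simps distrib_left)
  show "gact N Z (c \<odot>\<^bsub>N\<^esub> u) = c \<odot>\<^bsub>N\<^esub> gact N Z u"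
    by (rule realization_vec_eqI) (simp_all add: co_gact co_smult seq_gact_def act_smult U.dual_simps algebra_simps)
qed

lemma kact_realization_hom: "kact N k \<in> module_hom complex_field N N"
  unfolding module_hom_iff
proof (intro conjI ballI allI)
  fix u w c assume u [simp]: "u \<in> carrier N" and w [simp]: "w \<in> carrier N"
  show "kact N k u \<in> carrier N" by (simp add: co_kact)
  show "kact N k (u \<oplus>\<^bsub>N\<^esub> w) = kact N k u \<oplus>\<^bsub>N\<^esub> kact N k w"
    by (rule realization_vec_eqI) (simp_all add: co_kact co_add U.dual_simps distrib_left)
  show "kact N k (c \<odot>\<^bsub>N\<^esub> u) = c \<odot>\<^bsub>N\<^esub> kact N k u"
    by (rule realization_vec_eqI) (simp_all add: co_kact co_smult U.dual_simps)
qed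

lemma realization_locally_finite:
  assumes v: "v \<in> carrier N"
  shows "\<exists>W. complex_subspace W N \<and> finite_dimensional (N\<lparr>carrier := W\<rparr>) \<and> v \<in> W \<and>
    (\<forall>k\<in>SO2. \<forall>w\<in>W. kact N k w \<in> W)"
proof -
  \<comment> \<open>The span of the finitely many homogeneous components of \<open>v\<close>,
    described by coordinates so that stability is visible: \<open>K\<close> only scales each
    component.\<close>
  define W where "W = {w \<in> carrier N. \<forall>n. \<exists>c. pr n w = c \<odot>\<^bsub>N\<^esub> pr n v}"
  have W: "complex_subspace W N"
    unfolding N.complex_subspace_iff
  proof (intro conjI ballI allI)
    show "W \<subseteq> carrier N" by (auto simp: W_def)
    have "pr n \<zero>\<^bsub>N\<^esub> = 0 \<odot>\<^bsub>N\<^esub> pr n v" for n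
      using v by (simp add: hom_zero[OF pr_hom N.complex_space_axioms N.complex_space_axioms] co_pr)
    then show "\<zero>\<^bsub>N\<^esub> \<in> W" unfolding W_def by (intro CollectI conjI allI exI[of _ 0]) simp_all
  next
    fix x y assume x: "x \<in> W" and y: "y \<in> W"
    then have xy: "x \<in> carrier N" "y \<in> carrier N" by (simp_all add: W_def)
    have "\<exists>c. pr n (x \<oplus>\<^bsub>N\<^esub> y) = c \<odot>\<^bsub>N\<^esub> pr n v" for n
    proof -
      obtain a where a: "pr n x = a \<odot>\<^bsub>N\<^esub> pr n v" using x unfolding W_def by auto
      obtain b where b: "pr n y = b \<odot>\<^bsub>N\<^esub> pr n v" using y unfolding W_def by auto
      have "a \<odot>\<^bsub>N\<^esub> pr n v \<oplus>\<^bsub>N\<^esub> b \<odot>\<^bsub>N\<^esub> pr n v = (a + b) \<odot>\<^bsub>N\<^esub> pr n v"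
        by (rule N.vec_eqI) (use v in \<open>simp_all add: co_pr N.dual_simps distrib_right\<close>)
      then show ?thesis using xy by (intro exI[of _ "a + b"]) (simp add: hom_add[OF pr_hom] a b)
    qed
    then show "x \<oplus>\<^bsub>N\<^esub> y \<in> W" using xy unfolding W_def by simp
  next
    fix c x assume x: "x \<in> W"
    then have xc: "x \<in> carrier N" by (simp add: W_def)
    have "\<exists>d. pr n (c \<odot>\<^bsub>N\<^esub> x) = d \<odot>\<^bsub>N\<^esub> pr n v" for n
    proof -
      obtain a where a: "pr n x = a \<odot>\<^bsub>N\<^esub> pr n v" using x unfolding W_def by auto
      have "c \<odot>\<^bsub>N\<^esub> (a \<odot>\<^bsub>N\<^esub> pr n v) = (c * a) \<odot>\<^bsub>N\<^esub> pr n v"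
        by (rule N.vec_eqI) (use v in \<open>simp_all add: co_pr N.dual_simps\<close>)
      then show ?thesis using xc by (intro exI[of _ "c * a"]) (simp add: hom_smult[OF pr_hom] a)
    qed
    then show "c \<odot>\<^bsub>N\<^esub> x \<in> W" using xc unfolding W_def by simp
  qed
  have "\<exists>A. finite A \<and> A \<subseteq> W \<and> (\<forall>S. complex_subspace S N \<and> A \<subseteq> S \<longrightarrow> W \<subseteq> S)"
  proof (intro exI[of _ "(\<lambda>n. pr n v) ` {n. pr n v \<noteq> \<zero>\<^bsub>N\<^esub>}"] conjI allI impI subsetI)
    show "finite ((\<lambda>n. pr n v) ` {n. pr n v \<noteq> \<zero>\<^bsub>N\<^esub>})" using graded.finite_support[OF v] by simp
  next
    fix x assume "x \<in> (\<lambda>n. pr n v) ` {n. pr n v \<noteq> \<zero>\<^bsub>N\<^esub>}"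
    then obtain n where x: "x = pr n v" by auto
    have "\<exists>c. pr m x = c \<odot>\<^bsub>N\<^esub> pr m v" for m
    proof (cases "m = n")
      case True
      have "pr m x = 1 \<odot>\<^bsub>N\<^esub> pr m v"
        unfolding x True by (rule realization_eqI) (use v in \<open>simp_all add: co_pr\<close>)
      then show ?thesis by (rule exI)
    next
      case False
      have "pr m x = 0 \<odot>\<^bsub>N\<^esub> pr m v"
        unfolding x by (rule realization_eqI) (use v False in \<open>simp_all add: co_pr co_zero\<close>)
      then show ?thesis by (rule exI)
    qed
    then show "x \<in> W" using v unfolding W_def x by (simp add: co_pr)
  next
    fix S w assume S: "complex_subspace S N \<and> (\<lambda>n. pr n v) ` {n. pr n v \<noteq> \<zero>\<^bsub>N\<^esub>} \<subseteq> S" and w: "w \<in> W"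
    note S1 = conjunct1[OF S]
    have wc: "w \<in> carrier N" using w by (simp add: W_def)
    have "pr n w \<in> S" for n
    proof -
      obtain a where a: "pr n w = a \<odot>\<^bsub>N\<^esub> pr n v" using w unfolding W_def by auto
      have "pr n v \<in> S"
        using S N.subspace_closed(1)[OF S1] by (cases "pr n v = \<zero>\<^bsub>N\<^esub>") auto
      then show ?thesis unfolding a by (rule N.subspace_closed(4)[OF S1])
    qed
    then have "finsum N (\<lambda>n. pr n w) {n. pr n w \<noteq> \<zero>\<^bsub>N\<^esub>} \<in> S"
      by (intro N.subspace_finsum[OF S1])
    then show "w \<in> S" using graded.proj_sum[OF wc] by simp
  qed
  then have fdW: "finite_dimensional (N\<lparr>carrier := W\<rparr>)"
    using N.finite_dimensional_subspace_iff[OF W] by simp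
  have "\<exists>c. pr n v = c \<odot>\<^bsub>N\<^esub> pr n v" for n using v by (intro exI[of _ 1]) (simp add: co_pr)
  then have vW: "v \<in> W" using v unfolding W_def by simp
  have "kact N k w \<in> W" if k: "k \<in> SO2" and w: "w \<in> W" for k w
  proof -
    obtain \<theta> where \<theta>: "k = rot \<theta>" using k unfolding SO2_eq_range_rot by auto
    have wc: "w \<in> carrier N" using w by (simp add: W_def)
    have "\<exists>c. pr n (kact N k w) = c \<odot>\<^bsub>N\<^esub> pr n v" for n
    proof -
      obtain a where a: "pr n w = a \<odot>\<^bsub>N\<^esub> pr n v" using w unfolding W_def by auto
      have "pr n (kact N k w) = (exp (\<i> * of_int n * of_real \<theta>) * a) \<odot>\<^bsub>N\<^esub> pr n v"
        unfolding \<theta> pr_kact_rot[OF wc] a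
        by (rule N.vec_eqI) (use v in \<open>simp_all add: co_pr N.dual_simps\<close>)
      then show ?thesis by (rule exI)
    qed
    then show ?thesis unfolding W_def using wc by (simp add: co_kact)
  qed
  then show ?thesis using W fdW vW by (intro exI[of _ W]) simp
qed

lemma gk_mod_realization: "gk_mod N"
proof (rule gk_mod.intro)
  show "complex_vectorspace N" by (rule vectorspace_realization)
  show "gact N Z \<in> module_hom complex_field N N" for Z by (rule gact_realization_hom)
  show "kact N k \<in> module_hom complex_field N N" for k by (rule kact_realization_hom)
  fix v assume v: "v \<in> carrier N"
  show "gact N (Z + Z') v = gact N Z v \<oplus>\<^bsub>N\<^esub> gact N Z' v" for Z Z'
    by (rule realization_vec_eqI) (use v in \<open>simp_all add: co_gact co_add seq_gact_def coeff_add U.dual_simps algebra_simps\<close>)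
  show "gact N (mat c ** Z) v = c \<odot>\<^bsub>N\<^esub> gact N Z v" for c Z
    by (rule realization_vec_eqI) (use v in \<open>simp_all add: co_gact co_smult seq_gact_def coeff_scale U.dual_simps algebra_simps\<close>)
  show "gact N (Z ** Z' - Z' ** Z) v = gact N Z (gact N Z' v) \<ominus>\<^bsub>N\<^esub> gact N Z' (gact N Z v)"
    if "Z \<in> sl2" "Z' \<in> sl2" for Z Z' by (rule gact_bracket[OF that v])
  show "kact N (mat 1) v = v"
    unfolding rot_0[symmetric] by (rule realization_eqI) (use v in \<open>simp_all add: co_kact SO2_char_rot\<close>)
  show "kact N (k ** l) v = kact N k (kact N l v)" if kl: "k \<in> SO2" "l \<in> SO2" for k l
  proof -
    obtain a b where ab: "k = rot a" "l = rot b" using kl unfolding SO2_eq_range_rot by auto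
    show ?thesis
      unfolding ab rot_add[symmetric]
      by (rule realization_vec_eqI) (use v in \<open>simp_all add: co_kact SO2_char_rot U.dual_simps exp_add distrib_left\<close>)
  qed
  show "\<exists>W. complex_subspace W N \<and> finite_dimensional (N\<lparr>carrier := W\<rparr>) \<and> v \<in> W \<and>
    (\<forall>k\<in>SO2. \<forall>w\<in>W. kact N k w \<in> W)" by (rule realization_locally_finite[OF v])
  show "gact N (Ad k Z) v = kact N k (gact N Z (kact N (matrix_inv k) v))" if kZ: "k \<in> SO2" "Z \<in> sl2" for k Z
  proof -
    obtain \<theta> where \<theta>: "k = rot \<theta>" using kZ unfolding SO2_eq_range_rot by auto
    show ?thesis unfolding \<theta> matrix_inv_rot by (rule Ad_compat[OF kZ(2) v])
  qed
  fix \<phi> assume \<phi>: "\<phi> \<in> dual_space N"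
  show "smooth_curve (\<lambda>\<theta>. \<phi> (kact N (rot \<theta>) v))"
    unfolding dual_kact_rot[OF \<phi> v] by (rule smooth_curve_exp_sum)
  have pr_H: "pr n (gact N (mat \<i> ** H_mat) v) = (\<i> * of_int n) \<odot>\<^bsub>N\<^esub> pr n v" for n
    by (rule realization_eqI) (use v in \<open>simp_all add: co_pr co_gact co_smult seq_gact_def coeff_scale\<close>)
  have "\<phi> (gact N (mat \<i> ** H_mat) v) = (\<Sum>n\<in>{n. co v n \<noteq> \<zero>}. \<phi> (pr n (gact N (mat \<i> ** H_mat) v)))"
    by (rule dual_decompose[OF \<phi>]) (use v co_finite[OF v] in \<open>auto simp: co_gact seq_gact_def coeff_scale\<close>)
  also have "\<dots> = (\<Sum>n\<in>{n. co v n \<noteq> \<zero>}. (\<phi> (pr n v) * (\<i> * of_int n)) * exp (\<i> * of_int n * of_real 0))"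
    unfolding pr_H using \<phi> v by (simp add: N.dual_simps co_pr mult.commute)
  finally have e: "\<phi> (gact N (mat \<i> ** H_mat) v) = \<dots>" .
  show "((\<lambda>\<theta>. \<phi> (kact N (rot \<theta>) v)) has_vector_derivative \<phi> (gact N (mat \<i> ** H_mat) v)) (at 0)"
    unfolding dual_kact_rot[OF \<phi> v] e by (rule has_vector_derivative_exp_sum)
qed

end

section \<open>Submodules over the enveloping algebra\<close>

context gk_mod
begin

lemma foldr_gact_closed:
  "set Zs \<subseteq> sl2 \<Longrightarrow> s \<in> carrier M \<Longrightarrow> foldr (gact M) Zs s \<in> carrier M"
  by (induction Zs) simp_all

lemma U_span_generators:
  assumes S: "S \<subseteq> carrier M"
  shows "{foldr (gact M) Zs s | Zs s. set Zs \<subseteq> sl2 \<and> s \<in> S} \<subseteq> carrier M"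
  using S by (auto intro!: foldr_gact_closed)

lemma U_span_subspace:
  assumes S: "S \<subseteq> carrier M"
  shows "complex_subspace (U_span M S) M"
proof -
  interpret complex_vs M by (rule complex_vs)
  show ?thesis unfolding U_span_def by (rule span_is_subspace[OF U_span_generators[OF S]])
qed

lemma U_span_minimal:
  assumes S: "S \<subseteq> carrier M" and W: "complex_subspace W M"
    and gen: "\<And>Zs s. set Zs \<subseteq> sl2 \<Longrightarrow> s \<in> S \<Longrightarrow> foldr (gact M) Zs s \<in> W"
  shows "U_span M S \<subseteq> W"
proof -
  interpret complex_vs M by (rule complex_vs)
  show ?thesis unfolding U_span_def by (rule span_is_subset[OF _ is_module[OF W]]) (use gen in auto)
qed

lemma U_span_foldr:
  assumes S: "S \<subseteq> carrier M" and "set Zs \<subseteq> sl2" "s \<in> S"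
  shows "foldr (gact M) Zs s \<in> U_span M S"
proof -
  interpret complex_vs M by (rule complex_vs)
  show ?thesis
    unfolding U_span_def
    by (rule subsetD[OF in_own_span[OF U_span_generators[OF S]]])
      (use assms(2,3) in \<open>intro CollectI exI[of _ Zs] exI[of _ s] conjI refl\<close>)
qed

text \<open>The vectors that \<open>Z\<close> sends into \<open>U_span M S\<close> form a subspace,
  and it contains the generators because prefixing \<open>Z\<close> to a word gives a word.\<close>

lemma U_span_gact:
  assumes S: "S \<subseteq> carrier M" and Z: "Z \<in> sl2" and u: "u \<in> U_span M S"
  shows "gact M Z u \<in> U_span M S"
proof -
  note sub = U_span_subspace[OF S]
  have "complex_subspace {u \<in> carrier M. gact M Z u \<in> U_span M S} M"
    unfolding complex_subspace_iff
    using subspace_closed[OF sub] by (auto simp: gact_hom[OF Z])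
  then have "U_span M S \<subseteq> {u \<in> carrier M. gact M Z u \<in> U_span M S}"
  proof (rule U_span_minimal[OF S])
    fix Zs s assume Zs: "set Zs \<subseteq> sl2" "s \<in> S"
    then have "foldr (gact M) (Z # Zs) s \<in> U_span M S" using Z by (intro U_span_foldr[OF S]) auto
    then show "foldr (gact M) Zs s \<in> {u \<in> carrier M. gact M Z u \<in> U_span M S}"
      using Zs S by (simp add: foldr_gact_closed subset_iff)
  qed
  then show ?thesis using u by auto
qed

end

section \<open>The realization as an object of \<open>HC0\<close>\<close>

context graded_realization
begin

sublocale G: gk_mod N by (rule gk_mod_realization)

text \<open>Applying the idempotent first makes this a linear map defined on all of
  \<open>V\<close>, with the weight space of index \<open>n\<close> as image. A generating set of
  \<open>V\<close> thus yields one of each weight space.\<close>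

definition gen :: "int \<Rightarrow> 'u \<Rightarrow> 'u" where
  "gen n x = hvec n (idem n \<odot> x)"

lemma co_gen:
  assumes "x \<in> carrier V"
  shows "gen n x \<in> carrier N" "co (gen n x) m = (if m = n then idem n \<odot> x else \<zero>)"
proof -
  have "idem n \<odot> x \<in> carrier V" "idem n \<odot> (idem n \<odot> x) = idem n \<odot> x"
    using assms by (simp_all add: act_act idem_products)
  from hvec[OF this] show "gen n x \<in> carrier N" "co (gen n x) m = (if m = n then idem n \<odot> x else \<zero>)"
    by (simp_all add: gen_def)
qed

lemma gen_weight: "x \<in> carrier V \<Longrightarrow> gen n x \<in> weight_space N n"
  by (simp add: weight_space_realization co_gen)

lemma gen_co: "u \<in> weight_space N n \<Longrightarrow> gen n (co u n) = u"
  by (rule realization_eqI) (simp_all add: weight_space_realization co_gen co_idem)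

lemma gen_linear:
  assumes "x \<in> carrier V"
  shows "y \<in> carrier V \<Longrightarrow> gen n (x \<oplus> y) = gen n x \<oplus>\<^bsub>N\<^esub> gen n y"
    "gen n (c \<odot>\<^bsub>UV\<^esub> x) = c \<odot>\<^bsub>N\<^esub> gen n x"
  by (rule realization_eqI; use assms in \<open>simp add: co_gen co_add co_smult act_add_right act_smult\<close>)+

lemma gen_zero: "gen n \<zero> = \<zero>\<^bsub>N\<^esub>"
  by (rule realization_eqI) (simp_all add: co_gen co_zero)

text \<open>The preimage of \<open>S\<close> under \<open>gen n\<close> is a subspace of
  \<open>V\<close> containing the generators \<open>A\<close>, hence all of
  \<open>V\<close>.\<close>

lemma weight_space_subset:
  assumes A: "\<And>S. complex_subspace S UV \<Longrightarrow> A \<subseteq> S \<Longrightarrow> S = carrier V" "A \<subseteq> carrier V"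
    and S: "complex_subspace S N" and gens: "gen n ` A \<subseteq> S"
  shows "weight_space N n \<subseteq> S"
proof
  fix u assume u: "u \<in> weight_space N n"
  have "complex_subspace {x \<in> carrier V. gen n x \<in> S} UV"
    unfolding U.complex_subspace_iff
    using N.subspace_closed[OF S] by (auto simp: gen_linear gen_zero)
  then have "{x \<in> carrier V. gen n x \<in> S} = carrier V"
    by (rule A(1)) (use gens A(2) in auto)
  moreover have "co u n \<in> carrier V" using u by (simp add: weight_space_realization)
  ultimately have "gen n (co u n) \<in> S" by blast
  then show "u \<in> S" using gen_co[OF u] by simp
qed

lemma finite_generators:
  obtains A where "finite A" "A \<subseteq> carrier V" "\<And>S. complex_subspace S UV \<Longrightarrow> A \<subseteq> S \<Longrightarrow> S = carrier V"
proof -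
  obtain A where "finite A \<and> A \<subseteq> carrier V \<and> (\<forall>S. complex_subspace S UV \<and> A \<subseteq> S \<longrightarrow> S = carrier V)"
    using fd unfolding U.finite_dimensional_iff by (elim exE)
  then show thesis by (intro that[of A]) simp_all
qed

text \<open>By the normalization, \<open>X\<close> from a positive odd weight \<open>n\<close> to
  \<open>n + 2\<close> is the identity of \<open>E22 V\<close>, so the same vector of
  \<open>V\<close> placed at \<open>n\<close> is a preimage.\<close>

lemma raise_weight_surj:
  assumes u: "u \<in> weight_space N (n + 2)" and n: "odd n" "n > 0"
  shows "gact N X_mat (gen n (co u (n + 2))) = u"
proof (rule realization_eqI)
  have uc: "u \<in> carrier N" and u0: "\<And>m. m \<noteq> n + 2 \<Longrightarrow> co u m = \<zero>"
    using u by (simp_all add: weight_space_realization)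
  have i: "E22 \<odot> co u (n + 2) = co u (n + 2)" using co_idem[OF uc, of "n + 2"] n by (simp add: idem_def)
  fix m show "co (gact N X_mat (gen n (co u (n + 2)))) m = co u m"
    using uc u0 n i by (cases "m = n + 2") (simp_all add: co_X co_gen raise_def idem_def)
  show "gact N X_mat (gen n (co u (n + 2))) \<in> carrier N" using uc by (simp add: co_gact(1) co_gen(1))
qed (use u in \<open>simp add: weight_space_realization\<close>)

lemma lower_weight_surj:
  assumes u: "u \<in> weight_space N (n - 2)" and n: "odd n" "n < 0"
  shows "gact N Y_mat (gen n (co u (n - 2))) = u"
proof (rule realization_eqI)
  have uc: "u \<in> carrier N" and u0: "\<And>m. m \<noteq> n - 2 \<Longrightarrow> co u m = \<zero>"
    using u by (simp_all add: weight_space_realization)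
  have i: "E11 \<odot> co u (n - 2) = co u (n - 2)" using co_idem[OF uc, of "n - 2"] n by (simp add: idem_def)
  fix m show "co (gact N Y_mat (gen n (co u (n - 2)))) m = co u m"
    using uc u0 n i by (cases "m = n - 2") (simp_all add: co_Y co_gen lower_def idem_def)
  show "gact N Y_mat (gen n (co u (n - 2))) \<in> carrier N" using uc by (simp add: co_gact(1) co_gen(1))
qed (use u in \<open>simp add: weight_space_realization\<close>)

text \<open>Generators of \<open>V\<close> placed at the weights -1 and 1 suffice: \<open>X\<close>
  carries weight 1 onto all higher odd weights, and \<open>Y\<close> carries weight -1 onto all
  lower ones.\<close>

lemma finitely_generated: "\<exists>S. finite S \<and> S \<subseteq> carrier N \<and> U_span N S = carrier N"
proof -
  obtain A where A: "finite A" "A \<subseteq> carrier V" "\<And>S. complex_subspace S UV \<Longrightarrow> A \<subseteq> S \<Longrightarrow> S = carrier V"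
    by (rule finite_generators) (rule that)
  define S where "S = gen (-1) ` A \<union> gen 1 ` A"
  have S: "S \<subseteq> carrier N" using A(2) by (auto simp: S_def co_gen)
  note sub = G.U_span_subspace[OF S]
  have S_U: "S \<subseteq> U_span N S"
  proof
    fix s assume "s \<in> S"
    then show "s \<in> U_span N S" using G.U_span_foldr[OF S, of "[]" s] by simp
  qed
  have plus: "weight_space N (1 + 2 * int k) \<subseteq> U_span N S" for k
  proof (induction k)
    case 0
    show ?case by (rule weight_space_subset[OF A(3,2) sub]) (use S_U in \<open>auto simp: S_def\<close>)
  next
    case (Suc k)
    have eq: "1 + 2 * int (Suc k) = (1 + 2 * int k) + 2" by simp
    show ?case
      unfolding eq
    proof
      fix u assume u: "u \<in> weight_space N ((1 + 2 * int k) + 2)"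
      then have "co u ((1 + 2 * int k) + 2) \<in> carrier V" by (simp add: weight_space_realization)
      then have "gen (1 + 2 * int k) (co u ((1 + 2 * int k) + 2)) \<in> U_span N S"
        using gen_weight Suc by blast
      from G.U_span_gact[OF S generators_in_sl2(2) this] show "u \<in> U_span N S"
        using raise_weight_surj[OF u] by simp
    qed
  qed
  have minus: "weight_space N (- 1 - 2 * int k) \<subseteq> U_span N S" for k
  proof (induction k)
    case 0
    show ?case by (rule weight_space_subset[OF A(3,2) sub]) (use S_U in \<open>auto simp: S_def\<close>)
  next
    case (Suc k)
    have eq: "- 1 - 2 * int (Suc k) = (- 1 - 2 * int k) - 2" by simp
    show ?case
      unfolding eq
    proof
      fix u assume u: "u \<in> weight_space N ((- 1 - 2 * int k) - 2)"
      then have "co u ((- 1 - 2 * int k) - 2) \<in> carrier V" by (simp add: weight_space_realization)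
      then have "gen (- 1 - 2 * int k) (co u ((- 1 - 2 * int k) - 2)) \<in> U_span N S"
        using gen_weight Suc by blast
      from G.U_span_gact[OF S generators_in_sl2(3) this] show "u \<in> U_span N S"
        using lower_weight_surj[OF u] by simp
    qed
  qed
  have "U_span N S = carrier N"
  proof (rule graded.subspace_eq_carrier[OF sub])
    fix n :: int assume "n \<in> {n. odd n}"
    then obtain j where j: "n = 2 * j + 1" by (auto elim: oddE)
    show "weight_space N n \<subseteq> U_span N S"
      using plus[of "nat j"] minus[of "nat (- j - 1)"] j by (cases "j \<ge> 0") (simp_all add: algebra_simps)
  qed
  then show ?thesis using A(1) S by (intro exI[of _ S]) (simp add: S_def)
qed

lemma weight_space_finite_dimensional: "finite_dimensional (N\<lparr>carrier := weight_space N n\<rparr>)"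
proof -
  obtain A where A: "finite A" "A \<subseteq> carrier V" "\<And>S. complex_subspace S UV \<Longrightarrow> A \<subseteq> S \<Longrightarrow> S = carrier V"
    by (rule finite_generators) (rule that)
  show ?thesis
    unfolding N.finite_dimensional_subspace_iff[OF G.weight_space_subspace]
  proof (intro exI[of _ "gen n ` A"] conjI allI impI)
    show "finite (gen n ` A)" using A by simp
    show "gen n ` A \<subseteq> weight_space N n" using A(2) gen_weight by blast
    fix S assume "complex_subspace S N \<and> gen n ` A \<subseteq> S"
    then show "weight_space N n \<subseteq> S" by (intro weight_space_subset[OF A(3,2)]) simp_all
  qed
qed

text \<open>At weight \<open>n\<close> the operator \<open>C + 1\<close> is
  \<open>(n - 1)^2 + 4 (t - ((n - 1) / 2)^2) = 4 t\<close>, so its nilpotence is that of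
  \<open>t\<close>.\<close>

lemma casimir_realization:
  assumes u: "u \<in> carrier N"
  shows "casimir N u \<oplus>\<^bsub>N\<^esub> u \<in> carrier N"
    "co (casimir N u \<oplus>\<^bsub>N\<^esub> u) n = 4 \<odot>\<^bsub>UV\<^esub> (mat fps_X \<odot> co u n)"
proof -
  have co_minus: "co (a \<ominus>\<^bsub>N\<^esub> b) n = co a n \<ominus>\<^bsub>UV\<^esub> co b n" if "a \<in> carrier N" "b \<in> carrier N" for a b
    using hom_minus[OF co_hom N.complex_space_axioms complex_space_underlying that] .
  show "casimir N u \<oplus>\<^bsub>N\<^esub> u \<in> carrier N" using u by (simp add: casimir_def co_gact(1))
  show "co (casimir N u \<oplus>\<^bsub>N\<^esub> u) n = 4 \<odot>\<^bsub>UV\<^esub> (mat fps_X \<odot> co u n)"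
  proof (rule U.vec_eqI)
    fix \<phi> assume \<phi>: "\<phi> \<in> dual_space UV"
    then show "\<phi> (co (casimir N u \<oplus>\<^bsub>N\<^esub> u) n) = \<phi> (4 \<odot>\<^bsub>UV\<^esub> (mat fps_X \<odot> co u n))"
      using u by (simp add: casimir_def co_gact(1) co_add co_smult co_minus co_H co_X co_Y raise_lower_act[OF u]
          U.dual_simps power2_eq_square algebra_simps add_divide_distrib diff_divide_distrib)
  qed (use u in \<open>simp_all add: casimir_def co_gact(1)\<close>)
qed

lemma casimir_nilpotent:
  "\<exists>m>0. \<forall>u\<in>carrier N. ((\<lambda>w. casimir N w \<oplus>\<^bsub>N\<^esub> w) ^^ m) u = \<zero>\<^bsub>N\<^esub>"
proof -
  obtain d where d: "\<forall>v\<in>carrier V. mat (fps_X ^ d) \<odot> v = \<zero>" using t_nilpotent[OF fd] ..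
  let ?S = "\<lambda>w. casimir N w \<oplus>\<^bsub>N\<^esub> w"
  have pow: "(?S ^^ k) u \<in> carrier N \<and> co ((?S ^^ k) u) n = 4 ^ k \<odot>\<^bsub>UV\<^esub> (mat (fps_X ^ k) \<odot> co u n)"
    if u: "u \<in> carrier N" for u k n
  proof (induction k)
    case (Suc k)
    note IH = conjunct1[OF Suc] conjunct2[OF Suc]
    have "co ((?S ^^ Suc k) u) n = 4 \<odot>\<^bsub>UV\<^esub> (mat fps_X \<odot> co ((?S ^^ k) u) n)"
      using casimir_realization(2)[OF IH(1)] by simp
    also have "\<dots> = 4 ^ Suc k \<odot>\<^bsub>UV\<^esub> (mat fps_X \<odot> (mat (fps_X ^ k) \<odot> co u n))"
      unfolding IH(2) by (rule U.vec_eqI) (use u in \<open>simp_all add: act_smult U.dual_simps\<close>)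
    also have "mat fps_X \<odot> (mat (fps_X ^ k) \<odot> co u n) = mat (fps_X ^ Suc k) \<odot> co u n"
      using u by (simp add: act_act mat_fps_simps(2))
    finally show ?case using casimir_realization(1)[OF IH(1)] by simp
  qed (use u in simp)
  \<comment> \<open>The exponent is \<open>Suc d\<close> because it has to be positive, while
    \<open>d\<close> may be 0.\<close>
  have "((?S ^^ Suc d) u) = \<zero>\<^bsub>N\<^esub>" if u: "u \<in> carrier N" for u
  proof (rule realization_eqI)
    fix n
    have "mat (fps_X ^ Suc d) \<odot> co u n = mat fps_X \<odot> (mat (fps_X ^ d) \<odot> co u n)"
      using u by (simp add: act_act mat_fps_simps(2))
    also have "\<dots> = \<zero>" using d u by simp
    finally show "co ((?S ^^ Suc d) u) n = co \<zero>\<^bsub>N\<^esub> n"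
      using conjunct2[OF pow[OF u, of "Suc d" n]] by (simp add: co_zero)
  qed (use pow[OF u] co_zero(1) in blast)+
  then show ?thesis by (intro exI[of _ "Suc d"]) simp
qed

lemma realization_in_HC0: "N \<in> Ob HC0"
proof -
  have "internal_direct_sum N UNIV (weight_space N)"
    by (rule graded_space.internal_direct_sum[OF graded_realization]) simp
  moreover note graded.internal_direct_sum
  ultimately show ?thesis
    using casimir_nilpotent gk_mod_realization finitely_generated weight_space_finite_dimensional
    by (simp add: HC0_def HC_def harish_chandra_def)
qed

sublocale HC: HC0_module N by (rule HC0_module.intro) (rule realization_in_HC0)

text \<open>Makes the chosen projections explicit: both families are linear and agree on homogeneous
  vectors.\<close>

lemma weight_proj_realization: "u \<in> carrier N \<Longrightarrow> weight_proj N n u = pr n u"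
proof (rule graded.hom_eqI[OF HC.proj_hom pr_hom N.complex_space_axioms])
  fix k v assume "k \<in> {n. odd n}" "v \<in> weight_space N k"
  then show "weight_proj N n v = pr n v"
    using HC.proj_homogeneous[of k v n] graded.proj_homogeneous[of k v n] by simp
qed

lemma core_realization:
  "u \<in> core N \<longleftrightarrow> u \<in> carrier N \<and> (\<forall>n. n \<noteq> -1 \<and> n \<noteq> 1 \<longrightarrow> co u n = \<zero>)"
  unfolding core_def by (auto simp: weight_proj_realization pr_eq_zero_iff)

end

section \<open>The equivalence\<close>

lemma category_HC0: "category (HC0 :: ('u gk_module, 'u \<Rightarrow> 'u) cat)"
proof
  fix A B D E :: "'u gk_module" and f g h :: "'u \<Rightarrow> 'u"
  assume Obs: "A \<in> Ob HC0"
  interpret A: HC0_module A by (rule HC0_module.intro) (rule Obs)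
  show "Idt HC0 A \<in> Hom HC0 A A"
    by (simp add: HC0_def HC_def gk_hom_def module_hom_iff)
  {
    assume f: "f \<in> Hom HC0 A B"
    then have fe: "f \<in> extensional (carrier A)" and fm: "f \<in> carrier A \<rightarrow> carrier B"
      by (auto simp: HC0_def HC_def gk_hom_def module_hom_iff)
    show "Cmp HC0 A A B f (Idt HC0 A) = f"
      using fe by (intro extensionalityI[of _ "carrier A"]) (auto simp: HC0_def HC_def compose_def)
    show "Cmp HC0 A B B (Idt HC0 B) f = f"
      using fe fm by (intro extensionalityI[of _ "carrier A"]) (auto simp: HC0_def HC_def compose_def)
    assume g: "g \<in> Hom HC0 B D"
    show "Cmp HC0 A B D g f \<in> Hom HC0 A D"
      using f g by (auto simp: HC0_def HC_def gk_hom_def module_hom_iff compose_def)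
    show "Cmp HC0 A D E h (Cmp HC0 A B D g f) = Cmp HC0 A B E (Cmp HC0 B D E h g) f"
      using fm by (auto simp: HC0_def HC_def compose_def fun_eq_iff)
  }
qed

lemma category_RepB: "category (RepB :: ((B_elem, 'u) module, 'u \<Rightarrow> 'u) cat)"
proof
  fix A B D E :: "(B_elem, 'u) module" and f g h :: "'u \<Rightarrow> 'u"
  assume Obs: "A \<in> Ob RepB"
  interpret A: B_module A using Obs by (simp add: RepB_def B_module_def)
  show "Idt RepB A \<in> Hom RepB A A"
    by (simp add: RepB_def B_hom_def module_hom_def)
  {
    assume f: "f \<in> Hom RepB A B"
    then have fe: "f \<in> extensional (carrier A)" and fm: "f \<in> carrier A \<rightarrow> carrier B"
      by (auto simp: RepB_def B_hom_def module_hom_def)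
    show "Cmp RepB A A B f (Idt RepB A) = f"
      using fe by (intro extensionalityI[of _ "carrier A"]) (auto simp: RepB_def compose_def)
    show "Cmp RepB A B B (Idt RepB B) f = f"
      using fe fm by (intro extensionalityI[of _ "carrier A"]) (auto simp: RepB_def compose_def)
    assume g: "g \<in> Hom RepB B D"
    show "Cmp RepB A B D g f \<in> Hom RepB A D"
      using f g by (auto simp: RepB_def B_hom_def module_hom_def compose_def Pi_iff)
    show "Cmp RepB A D E h (Cmp RepB A B D g f) = Cmp RepB A B E (Cmp RepB B D E h g) f"
      using fm by (auto simp: RepB_def compose_def fun_eq_iff)
  }
qed

lemma cat_iso_RepB:
  assumes V: "V \<in> Ob RepB" and W: "W \<in> Ob RepB" and f: "f \<in> B_hom V W"
    and bij: "bij_betw f (carrier V) (carrier W)"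
  shows "cat_iso RepB V W f"
proof -
  interpret V: B_module V using V by (simp add: RepB_def B_module_def)
  interpret W: B_module W using W by (simp add: RepB_def B_module_def)
  define g where "g = restrict (inv_into (carrier V) f) (carrier W)"
  have g: "g w \<in> carrier V" "f (g w) = w" if "w \<in> carrier W" for w
    using bij that unfolding g_def bij_betw_def by (auto intro: inv_into_into f_inv_into_f)
  have gf: "g (f v) = v" if "v \<in> carrier V" for v
    using bij that unfolding g_def bij_betw_def by (auto intro: inv_into_f_f)
  have inj: "v = w" if "f v = f w" "v \<in> carrier V" "w \<in> carrier V" for v w
    using bij that by (auto simp: bij_betw_def inj_on_def)
  have f_add: "f (v \<oplus>\<^bsub>V\<^esub> w) = f v \<oplus>\<^bsub>W\<^esub> f w" if "v \<in> carrier V" "w \<in> carrier V" for v w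
    using f that by (simp add: B_hom_def module_hom_def)
  have f_act: "f (P \<odot>\<^bsub>V\<^esub> v) = P \<odot>\<^bsub>W\<^esub> f v" if "P \<in> carrier B_ring" "v \<in> carrier V" for P v
    using f that by (simp add: B_hom_def module_hom_def)
  have "g \<in> module_hom B_ring W V"
    unfolding module_hom_def
  proof (intro CollectI conjI allI impI)
    show "g \<in> carrier W \<rightarrow> carrier V" using g by auto
    fix x y assume "x \<in> carrier W \<and> y \<in> carrier W"
    then show "g (x \<oplus>\<^bsub>W\<^esub> y) = g x \<oplus>\<^bsub>V\<^esub> g y" by - (rule inj, simp_all add: g f_add)
  next
    fix P x assume "P \<in> carrier B_ring \<and> x \<in> carrier W"
    then show "g (P \<odot>\<^bsub>W\<^esub> x) = P \<odot>\<^bsub>V\<^esub> g x" by - (rule inj, simp_all add: g f_act)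
  qed
  then have "g \<in> B_hom W V" by (simp add: B_hom_def g_def)
  moreover have "compose (carrier V) g f = restrict (\<lambda>v. v) (carrier V)"
    by (auto simp: compose_def fun_eq_iff gf)
  moreover have "compose (carrier W) f g = restrict (\<lambda>v. v) (carrier W)"
    by (auto simp: compose_def fun_eq_iff g)
  ultimately show ?thesis
    unfolding cat_iso_def using f by (auto simp: RepB_def)
qed

text \<open>A nonzero complex vector space \<open>V\<close> is infinite, so it has as many elements as there are finite
  subsets of \<open>\<int> \<times> V\<close>; a finitely supported sequence is encoded by its graph over the support.
  For \<open>V = 0\<close> there is only one sequence.\<close>

lemma (in B_module) graded_seqs_embedding:
  "\<exists>\<iota> :: (int \<Rightarrow> 'u) \<Rightarrow> 'u. inj_on \<iota> (graded_seqs V)"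
proof (cases "carrier V = {\<zero>}")
  case True
  then have *: "x = (\<lambda>_. \<zero>)" if "x \<in> graded_seqs V" for x
    using that by (intro ext) (simp add: graded_seqs_def)
  have "inj_on (\<lambda>_. undefined) (graded_seqs V)"
    by (rule inj_onI) (rule trans[OF * *[symmetric]])
  then show ?thesis by (rule exI[of _ "\<lambda>_. undefined"])
next
  case False
  then have "\<not> carrier V \<subseteq> {\<zero>}" using U.vec_closed(1) by (metis empty_iff subset_singletonD)
  then obtain v where v: "v \<in> carrier V" "v \<noteq> \<zero>" by (auto simp only: subset_iff singleton_iff)
  have "\<exists>\<phi>\<in>dual_space (underlying_vs V). \<phi> v \<noteq> 0"
    using v by (intro complex_vs.dual_space_separates[OF U.complex_vs]) (simp_all add: underlying_simps)
  then obtain \<phi> where \<phi>: "\<phi> \<in> dual_space (underlying_vs V)" "\<phi> v \<noteq> 0" by (rule bexE)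
  \<comment> \<open>The line of a nonzero vector is a copy of the complex numbers, which makes the
    carrier infinite.\<close>
  have "inj (\<lambda>c. c \<odot>\<^bsub>underlying_vs V\<^esub> v)"
  proof (rule injI)
    fix c d assume "c \<odot>\<^bsub>underlying_vs V\<^esub> v = d \<odot>\<^bsub>underlying_vs V\<^esub> v"
    then have "\<phi> (c \<odot>\<^bsub>underlying_vs V\<^esub> v) = \<phi> (d \<odot>\<^bsub>underlying_vs V\<^esub> v)" by (rule arg_cong)
    then show "c = d" using \<phi> v by (simp add: U.dual_simps)
  qed
  then have "infinite ((\<lambda>c. c \<odot>\<^bsub>underlying_vs V\<^esub> v) ` (UNIV :: complex set))"
    using infinite_UNIV_char_0 by (simp add: finite_image_iff)
  moreover have "(\<lambda>c. c \<odot>\<^bsub>underlying_vs V\<^esub> v) ` UNIV \<subseteq> carrier V" using v by auto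
  ultimately have inf: "infinite (carrier V)" by (rule contrapos_nn[OF _ finite_subset])
  have "|UNIV :: int set| \<le>o |carrier V|"
  proof -
    have "(UNIV :: int set) \<lesssim> (UNIV :: nat set)"
      using inj_int_encode by (auto simp: lepoll_def)
    then have "(UNIV :: int set) \<lesssim> carrier V"
      by (rule lepoll_trans) (use inf in \<open>simp flip: infinite_le_lepoll\<close>)
    then show ?thesis by (simp add: lepoll_def card_of_ordLeq)
  qed
  then have "|(UNIV :: int set) \<times> carrier V| =o |carrier V|"
    using card_of_Times_infinite[OF inf, of "UNIV :: int set"] by simp
  then have times: "(UNIV :: int set) \<times> carrier V \<approx> carrier V"
    by (simp add: eqpoll_iff_card_of_ordIso)
  have "infinite ((UNIV :: int set) \<times> carrier V)" using inf eqpoll_finite_iff[OF times] by simp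
  then have "Fpow ((UNIV :: int set) \<times> carrier V) \<approx> carrier V"
    by (rule eqpoll_trans[OF eqpoll_Fpow times])
  then obtain h where h: "bij_betw h (Fpow ((UNIV :: int set) \<times> carrier V)) (carrier V)"
    unfolding eqpoll_def by (rule exE)
  define graph where "graph x = (\<lambda>n. (n, x n)) ` {n. x n \<noteq> \<zero>}" for x :: "int \<Rightarrow> 'u"
  have "graph x \<in> Fpow (UNIV \<times> carrier V)" if "x \<in> graded_seqs V" for x
    using that by (auto simp: Fpow_def graph_def graded_seqs_def)
  then have sub: "graph ` graded_seqs V \<subseteq> Fpow (UNIV \<times> carrier V)" by (rule image_subsetI)
  have "inj graph"
  proof (rule injI, rule ext)
    fix x y :: "int \<Rightarrow> 'u" and n
    assume eq: "graph x = graph y"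
    have mem: "(n, z) \<in> graph x \<longleftrightarrow> x n = z \<and> z \<noteq> \<zero>" for x z
      by (auto simp: graph_def)
    have "(x n = z \<and> z \<noteq> \<zero>) = (y n = z \<and> z \<noteq> \<zero>)" for z
      unfolding mem[symmetric] eq ..
    from this[of "x n"] this[of "y n"] show "x n = y n" by metis
  qed
  then have "inj_on (h \<circ> graph) (graded_seqs V)"
    using h sub by (intro comp_inj_on) (auto simp: bij_betw_def intro: inj_on_subset)
  then show ?thesis by (rule exI[of _ "h \<circ> graph"])
qed

section \<open>The core of the realization is isomorphic to the given module\<close>

context graded_realization
begin

text \<open>Reassembles a vector of \<open>V\<close> from its parts in \<open>E11 V\<close> and
  \<open>E22 V\<close>, which the realization keeps at the weights -1 and 1.\<close>

definition core_iso :: "'u \<Rightarrow> 'u" where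
  "core_iso u = co u (-1) \<oplus> co u 1"

lemma unit_act_co:
  assumes "u \<in> carrier N"
  shows "E11 \<odot> co u (-1) = co u (-1)" "E22 \<odot> co u (-1) = \<zero>" "tE12 \<odot> co u (-1) = \<zero>"
    "E11 \<odot> co u 1 = \<zero>" "E22 \<odot> co u 1 = co u 1" "E21 \<odot> co u 1 = \<zero>"
proof -
  show m: "E11 \<odot> co u (-1) = co u (-1)" using co_idem[OF assms, of "-1"] by (simp add: idem_def)
  show p: "E22 \<odot> co u 1 = co u 1" using co_idem[OF assms, of 1] by (simp add: idem_def)
  have "P \<odot> co u (-1) = (P ** E11) \<odot> co u (-1)" if "P \<in> carrier B_ring" for P
    using act_act[OF that B_closed(2), of "co u (-1)"] assms m by simp
  from this[of E22] this[of tE12] show "E22 \<odot> co u (-1) = \<zero>" "tE12 \<odot> co u (-1) = \<zero>"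
    using assms by (simp_all add: B_unit_products)
  have "P \<odot> co u 1 = (P ** E22) \<odot> co u 1" if "P \<in> carrier B_ring" for P
    using act_act[OF that B_closed(3), of "co u 1"] assms p by simp
  from this[of E11] this[of E21] show "E11 \<odot> co u 1 = \<zero>" "E21 \<odot> co u 1 = \<zero>"
    using assms by (simp_all add: B_unit_products)
qed

lemma act_core_iso:
  assumes "u \<in> carrier N"
  shows "E11 \<odot> core_iso u = co u (-1)" "E22 \<odot> core_iso u = co u 1"
    "E21 \<odot> core_iso u = E21 \<odot> co u (-1)" "tE12 \<odot> core_iso u = tE12 \<odot> co u 1"
  using assms by (simp_all add: core_iso_def act_add_right unit_act_co)

lemma core_iso_hom: "restrict core_iso (core N) \<in> B_hom (HC0_to_RepB N) V"
proof -
  interpret BN: B_module "HC0_to_RepB N" by (simp add: B_module_def HC.left_module)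
  have carrier: "carrier (HC0_to_RepB N) = core N" by (simp add: HC0_to_RepB_def)
  have act: "P \<odot>\<^bsub>HC0_to_RepB N\<^esub> w = B_act N P w" for P w by (simp add: HC0_to_RepB_def)
  have "restrict core_iso (core N) \<in> module_hom B_ring (HC0_to_RepB N) V"
  proof (rule B_hom_of_quiver_hom)
    show "restrict core_iso (core N) \<in> module_hom complex_field (underlying_vs (HC0_to_RepB N)) UV"
      unfolding module_hom_iff BN.underlying_simps underlying_simps(1-3) carrier act
    proof (intro conjI ballI allI)
      fix x assume x: "x \<in> core N"
      then have xc: "x \<in> carrier N" by simp
      show "restrict core_iso (core N) x \<in> carrier V" using x xc by (simp add: core_iso_def)
      fix c show "restrict core_iso (core N) (B_act N (mat (fps_const c)) x) = c \<odot>\<^bsub>UV\<^esub> restrict core_iso (core N) x"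
        unfolding HC.B_act_scalar[OF x]
        by (rule U.vec_eqI)
          (use x xc N.subspace_closed(4)[OF HC.core_subspace x] in
            \<open>simp_all add: core_iso_def co_smult U.dual_simps distrib_left\<close>)
    next
      fix x y assume x: "x \<in> core N" and y: "y \<in> core N"
      then have xy: "x \<in> carrier N" "y \<in> carrier N" "x \<oplus>\<^bsub>N\<^esub> y \<in> core N"
        using N.subspace_closed(3)[OF HC.core_subspace] by simp_all
      have "restrict core_iso (core N) (x \<oplus>\<^bsub>N\<^esub> y) =
          restrict core_iso (core N) x \<oplus> restrict core_iso (core N) y"
        by (rule U.vec_eqI) (use x y xy in \<open>simp_all add: core_iso_def co_add U.dual_simps\<close>)
      then show "restrict core_iso (core N) (x \<oplus>\<^bsub>HC0_to_RepB N\<^esub> y) =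
          restrict core_iso (core N) x \<oplus> restrict core_iso (core N) y"
        by (simp add: HC0_to_RepB_def)
    qed
    fix u assume "u \<in> carrier (HC0_to_RepB N)"
    then have u: "u \<in> core N" "u \<in> carrier N" by (simp_all add: HC0_to_RepB_def)
    have r: "restrict core_iso (core N) (B_act N P u) = core_iso (B_act N P u)" "restrict core_iso (core N) u = core_iso u" for P
      using u HC.B_act_core[OF u(2)] by simp_all
    have raise_lower: "raise (-1) = E21" "lower 1 = tE12" by (simp_all add: raise_def lower_def)
    show "restrict core_iso (core N) (E11 \<odot>\<^bsub>HC0_to_RepB N\<^esub> u) = E11 \<odot> restrict core_iso (core N) u"
      "restrict core_iso (core N) (E22 \<odot>\<^bsub>HC0_to_RepB N\<^esub> u) = E22 \<odot> restrict core_iso (core N) u"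
      "restrict core_iso (core N) (E21 \<odot>\<^bsub>HC0_to_RepB N\<^esub> u) = E21 \<odot> restrict core_iso (core N) u"
      "restrict core_iso (core N) (tE12 \<odot>\<^bsub>HC0_to_RepB N\<^esub> u) = tE12 \<odot> restrict core_iso (core N) u"
      unfolding act unfolding r
      unfolding act_core_iso[OF u(2)] HC.B_act_units[OF u(2)] weight_proj_realization[OF u(2)]
      using u(2) by (simp_all add: core_iso_def co_pr co_X co_Y raise_lower)
  qed (simp_all add: HC.left_module HC.HC0_to_RepB_finite_dimensional fd left_module_axioms)
  then show ?thesis by (simp add: B_hom_def carrier)
qed

lemma core_iso_bij: "bij_betw (restrict core_iso (core N)) (core N) (carrier V)"
proof (rule bij_betwI')
  fix u w assume u: "u \<in> core N" and w: "w \<in> core N"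
  then have c: "u \<in> carrier N" "w \<in> carrier N" by simp_all
  have "u = w" if eq: "core_iso u = core_iso w"
  proof (rule realization_eqI)
    fix n
    \<comment> \<open>The two components are recovered from their sum by acting with
      \<open>E11\<close> and \<open>E22\<close>.\<close>
    have "co u (-1) = co w (-1)" "co u 1 = co w 1"
      using act_core_iso(1,2)[OF c(1)] act_core_iso(1,2)[OF c(2)] eq by simp_all
    then show "co u n = co w n"
      using u w unfolding core_realization by (cases "n = -1 \<or> n = 1") auto
  qed (use c in simp_all)
  then show "(restrict core_iso (core N) u = restrict core_iso (core N) w) = (u = w)"
    using u w by auto
next
  fix u assume "u \<in> core N"
  then show "restrict core_iso (core N) u \<in> carrier V" by (simp add: core_iso_def)
next
  fix v assume v: "v \<in> carrier V"
  \<comment> \<open>The preimage comes from \<open>v = E11 v + E22 v\<close>, with the two parts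
    placed at the weights -1 and 1.\<close>
  define u where "u = gen (-1) v \<oplus>\<^bsub>N\<^esub> gen 1 v"
  have uc: "u \<in> carrier N" using v by (simp add: u_def co_gen(1))
  have co_u: "co u n = (if n = -1 then E11 \<odot> v else if n = 1 then E22 \<odot> v else \<zero>)" for n
    using v by (simp add: u_def co_add co_gen idem_def)
  have "u \<in> core N" unfolding core_realization using uc co_u by simp
  moreover have "core_iso u = v"
  proof -
    have "core_iso u = (E11 + E22) \<odot> v" using v by (simp add: core_iso_def co_u act_add_left)
    then show ?thesis using v by (simp add: B_unit_products)
  qed
  ultimately show "\<exists>u\<in>core N. v = restrict core_iso (core N) u" by (intro bexI[of _ u]) simp_all
qed

end

lemma HC0_to_RepB_essentially_surjective:
  fixes V :: "(B_elem, 'u) module"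
  assumes V: "V \<in> Ob RepB"
  shows "\<exists>M\<in>Ob HC0. \<exists>e. cat_iso RepB (HC0_to_RepB M) V e"
proof -
  have mod: "left_module B_ring V" "finite_dimensional (underlying_vs V)"
    using V by (simp_all add: RepB_def)
  interpret B_module V by (simp add: B_module_def mod)
  obtain \<iota> :: "(int \<Rightarrow> 'u) \<Rightarrow> 'u" where "inj_on \<iota> (graded_seqs V)"
    using graded_seqs_embedding ..
  then interpret graded_realization V \<iota> by unfold_locales (rule mod)
  have "cat_iso RepB (HC0_to_RepB (realization V \<iota>)) V (restrict core_iso (core (realization V \<iota>)))"
    by (rule cat_iso_RepB[OF HC.HC0_to_RepB_in_Ob V core_iso_hom])
      (use core_iso_bij in \<open>simp add: HC0_to_RepB_def\<close>)
  then show ?thesis using realization_in_HC0 by blast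
qed

definition HC0_to_RepB_hom :: "'u gk_module \<Rightarrow> 'u gk_module \<Rightarrow> ('u \<Rightarrow> 'u) \<Rightarrow> 'u \<Rightarrow> 'u" where
  "HC0_to_RepB_hom M N f = restrict f (core M)"

lemma HC0_to_RepB_functor: "cat_functor HC0 RepB HC0_to_RepB HC0_to_RepB_hom"
proof (intro cat_functor.intro category_HC0 category_RepB cat_functor_axioms.intro)
  fix A :: "'u gk_module" assume A: "A \<in> Ob HC0"
  then interpret A: HC0_module A by (rule HC0_module.intro)
  show "HC0_to_RepB A \<in> Ob RepB" by (rule A.HC0_to_RepB_in_Ob)
  show "HC0_to_RepB_hom A A (Idt HC0 A) = Idt RepB (HC0_to_RepB A)"
    by (auto simp: HC0_to_RepB_hom_def HC0_def HC_def RepB_def HC0_to_RepB_def fun_eq_iff)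
next
  fix A B :: "'u gk_module" and f assume "A \<in> Ob HC0" "B \<in> Ob HC0" and f: "f \<in> Hom HC0 A B"
  then interpret HC0_pair A B by (simp add: HC0_pair_def HC0_module_def)
  show "HC0_to_RepB_hom A B f \<in> Hom RepB (HC0_to_RepB A) (HC0_to_RepB B)"
    using restrict_B_hom[of f] f by (simp add: HC0_to_RepB_hom_def RepB_def HC0_def HC_def)
next
  fix A B D :: "'u gk_module" and f g
  assume "A \<in> Ob HC0" "B \<in> Ob HC0" "D \<in> Ob HC0" and f: "f \<in> Hom HC0 A B"
  then interpret HC0_pair A B by (simp add: HC0_pair_def HC0_module_def)
  have "f v \<in> core B" if "v \<in> core A" for v
    using f_core[of f v] f that by (simp add: HC0_def HC_def)
  then show "HC0_to_RepB_hom A D (Cmp HC0 A B D g f) =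
      Cmp RepB (HC0_to_RepB A) (HC0_to_RepB B) (HC0_to_RepB D) (HC0_to_RepB_hom B D g) (HC0_to_RepB_hom A B f)"
    by (auto simp: HC0_to_RepB_hom_def HC0_def HC_def RepB_def HC0_to_RepB_def compose_def fun_eq_iff)
qed

lemma HC0_to_RepB_fully_faithful:
  assumes "M \<in> Ob HC0" "N \<in> Ob HC0"
  shows "bij_betw (HC0_to_RepB_hom M N) (Hom HC0 M N) (Hom RepB (HC0_to_RepB M) (HC0_to_RepB N))"
proof -
  interpret HC0_pair M N using assms by (simp add: HC0_pair_def HC0_module_def)
  have Hom: "Hom HC0 M N = gk_hom M N" "Hom RepB (HC0_to_RepB M) (HC0_to_RepB N) = B_hom (HC0_to_RepB M) (HC0_to_RepB N)"
    by (simp_all add: HC0_def HC_def RepB_def)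
  show ?thesis
    unfolding bij_betw_def Hom
  proof (intro conjI equalityI subsetI)
    show "inj_on (HC0_to_RepB_hom M N) (gk_hom M N)"
    proof (rule inj_onI)
      fix f f' assume f: "f \<in> gk_hom M N" "f' \<in> gk_hom M N" and eq: "HC0_to_RepB_hom M N f = HC0_to_RepB_hom M N f'"
      show "f = f'"
      proof (rule gk_hom_eqI[OF f])
        fix v assume "v \<in> core M"
        then show "f v = f' v" using fun_cong[OF eq, of v] by (simp add: HC0_to_RepB_hom_def)
      qed
    qed
  next
    fix g assume "g \<in> HC0_to_RepB_hom M N ` gk_hom M N"
    then show "g \<in> B_hom (HC0_to_RepB M) (HC0_to_RepB N)"
      using restrict_B_hom by (auto simp: HC0_to_RepB_hom_def)
  next
    fix g assume "g \<in> B_hom (HC0_to_RepB M) (HC0_to_RepB N)"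
    from exists_extension[OF this] show "g \<in> HC0_to_RepB_hom M N ` gk_hom M N"
      by (auto simp: HC0_to_RepB_hom_def)
  qed
qed

theorem proposition1p6:
  shows "\<exists>(Eo :: 'u gk_module \<Rightarrow> (B_elem, 'u) module) Em.
    equivalence_of_categories (HC0 :: ('u gk_module, 'u \<Rightarrow> 'u) cat) RepB Eo Em \<and>
    (\<forall>M \<in> Ob HC0.
       same_quiver_rep (quiver_rep_of_B_module (Eo M)) (quiver_rep_of_gk_module M)) \<and>
    (\<forall>M \<in> Ob HC0. \<forall>N \<in> Ob HC0. \<forall>f \<in> Hom HC0 M N.
       \<forall>v \<in> weight_space M (-1) \<union> weight_space M 1. Em M N f v = f v)"
proof (intro exI[of _ HC0_to_RepB] exI[of _ HC0_to_RepB_hom] conjI ballI)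
  show "equivalence_of_categories (HC0 :: ('u gk_module, 'u \<Rightarrow> 'u) cat) RepB HC0_to_RepB HC0_to_RepB_hom"
    by (rule equivalence_of_categoriesI[OF HC0_to_RepB_functor HC0_to_RepB_fully_faithful
        HC0_to_RepB_essentially_surjective])
next
  fix M :: "'u gk_module" assume "M \<in> Ob HC0"
  then interpret HC0_module M by (rule HC0_module.intro)
  show "same_quiver_rep (quiver_rep_of_B_module (HC0_to_RepB M)) (quiver_rep_of_gk_module M)"
    by (rule HC0_to_RepB_quiver)
  fix N f v assume "v \<in> weight_space M (-1) \<union> weight_space M 1"
  then show "HC0_to_RepB_hom M N f v = f v"
    using weight_in_core[of v] by (simp add: HC0_to_RepB_hom_def)
qed

end
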